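(* Let $m>1$ and $d\ge 2$ be integers. Then the free soluble group $\mathrm{Sol}(m,d)=F_m/F_m^{(d)}$, with the generating set given by the images of the free generators of $F_m$, has strict dead end elements of depth at least $2\cdot 3^{d-2}-1$; that is, there exist an integer $k\ge 2\cdot 3^{d-2}-1$ and an element $g\in \mathrm{Sol}(m,d)$ such that $g$ is a strict dead end of depth $k$.
   Context: $F_m$ is the free group of rank $m$ with its standard free generating set. For a group $H$, the derived subgroups are defined by $H^{(0)}=H$ and $H^{(n+1)}=[H^{(n)},H^{(n)}]$ for $n\ge0$. The free soluble group of rank $m$ and degree of solvability $d$ is $\mathrm{Sol}(m,d)=F_m/F_m^{(d)}$, with generating set $A$ given by the images of the standard free generators of $F_m$. For a group $G$ generated by a finite set $A$ and $g\in G$, $|g|$ denotes the distance from $g$ to the identity in the Cayley graph of $G$ with respect to $A$ (the word length of $g$). An element $g\in G$ is a strict dead end of depth $k$ (with respect to $A$) if $|g|>|ga_1|>|ga_1a_2|>\cdots>|ga_1a_2\cdots a_k|$ for all $a_1,\dots,a_k\in A^{\pm1}$ such that the word $a_1a_2\cdots a_k$ is freely irreducible (i.e. freely reduced: no letter is immediately followed by its formal inverse). *)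

theory Defs
  imports "HOL-Algebra.Generated_Groups"
begin

section \<open>Free groups\<close>

text \<open>A letter is a generator together with a sign: \<open>(x, True)\<close> is the generator \<open>x\<close> and
  \<open>(x, False)\<close> is its formal inverse. Elements of the free group are freely reduced words.\<close>

definition inv_letter :: "'a \<times> bool \<Rightarrow> 'a \<times> bool" where
  "inv_letter l = (fst l, \<not> snd l)"

definition freely_reduced :: "('a \<times> bool) list \<Rightarrow> bool" where
  "freely_reduced w \<longleftrightarrow> successively (\<lambda>l l'. l' \<noteq> inv_letter l) w"

fun cons_reduce :: "'a \<times> bool \<Rightarrow> ('a \<times> bool) list \<Rightarrow> ('a \<times> bool) list" where
  "cons_reduce l [] = [l]"
| "cons_reduce l (l' # w) = (if l' = inv_letter l then w else l # l' # w)"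

definition reduce_word :: "('a \<times> bool) list \<Rightarrow> ('a \<times> bool) list" where
  "reduce_word w = foldr cons_reduce w []"

definition free_group :: "'a set \<Rightarrow> ('a \<times> bool) list monoid" where
  "free_group S =
     \<lparr>carrier = {w. freely_reduced w \<and> fst ` set w \<subseteq> S},
      mult = (\<lambda>u v. reduce_word (u @ v)),
      one = []\<rparr>"

section \<open>Cayley graphs and strict dead ends\<close>

definition cayley_edges :: "('g, 'b) monoid_scheme \<Rightarrow> 'g set \<Rightarrow> ('g \<times> 'g) set" where
  "cayley_edges G A = {(g, g \<otimes>\<^bsub>G\<^esub> a) | g a. g \<in> carrier G \<and> a \<in> A \<union> m_inv G ` A}"

definition cayley_dist :: "('g, 'b) monoid_scheme \<Rightarrow> 'g set \<Rightarrow> 'g \<Rightarrow> 'g \<Rightarrow> nat" where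
  "cayley_dist G A g h = (LEAST n. (g, h) \<in> cayley_edges G A ^^ n)"

definition word_length :: "('g, 'b) monoid_scheme \<Rightarrow> 'g set \<Rightarrow> 'g \<Rightarrow> nat" where
  "word_length G A g = cayley_dist G A g \<one>\<^bsub>G\<^esub>"

definition letter_value :: "('g, 'b) monoid_scheme \<Rightarrow> 'g \<times> bool \<Rightarrow> 'g" where
  "letter_value G l = (if snd l then fst l else inv\<^bsub>G\<^esub> (fst l))"

definition word_value :: "('g, 'b) monoid_scheme \<Rightarrow> ('g \<times> bool) list \<Rightarrow> 'g" where
  "word_value G w = foldr (\<lambda>l h. letter_value G l \<otimes>\<^bsub>G\<^esub> h) w \<one>\<^bsub>G\<^esub>"

text \<open>The words range over formal letters \<open>a\<^sup>\<plusminus>\<^sup>1\<close> with \<open>a \<in> A\<close>, so free reducedness refers to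
  formal inverses and not to equality of elements of \<open>G\<close>.\<close>

definition strict_dead_end :: "('g, 'b) monoid_scheme \<Rightarrow> 'g set \<Rightarrow> nat \<Rightarrow> 'g \<Rightarrow> bool" where
  "strict_dead_end G A k g \<longleftrightarrow>
     g \<in> carrier G \<and>
     (\<forall>w. length w = k \<and> fst ` set w \<subseteq> A \<and> freely_reduced w \<longrightarrow>
        (\<forall>i<k. word_length G A (g \<otimes>\<^bsub>G\<^esub> word_value G (take i w))
              > word_length G A (g \<otimes>\<^bsub>G\<^esub> word_value G (take (Suc i) w))))"

section \<open>Free soluble groups\<close>

definition derived_term :: "('g, 'b) monoid_scheme \<Rightarrow> nat \<Rightarrow> 'g set" where
  "derived_term G n = (derived G ^^ n) (carrier G)"

definition free_soluble_group :: "nat \<Rightarrow> nat \<Rightarrow> (nat \<times> bool) list set monoid" where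
  "free_soluble_group m d = free_group {..<m} Mod derived_term (free_group {..<m}) d"

definition free_soluble_gens :: "nat \<Rightarrow> nat \<Rightarrow> (nat \<times> bool) list set set" where
  "free_soluble_gens m d =
     (\<lambda>i. derived_term (free_group {..<m}) d #>\<^bsub>free_group {..<m}\<^esub> [(i, True)]) ` {..<m}"

section \<open>Basic facts\<close>

lemma inv_letter_inv_letter [simp]: "inv_letter (inv_letter l) = l"
  by (simp add: inv_letter_def)

lemma inv_letter_neq [simp]: "inv_letter l \<noteq> l" "l \<noteq> inv_letter l"
  by (auto simp: inv_letter_def prod_eq_iff)

lemma fst_inv_letter [simp]: "fst (inv_letter l) = fst l"
  by (simp add: inv_letter_def)

lemma freely_reduced_Nil [simp]: "freely_reduced []"
  by (simp add: freely_reduced_def)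

lemma freely_reduced_ConsD: "freely_reduced (l # w) \<Longrightarrow> freely_reduced w"
  by (cases w) (auto simp: freely_reduced_def)

lemma freely_reduced_cons_reduce: "freely_reduced w \<Longrightarrow> freely_reduced (cons_reduce l w)"
  by (cases w) (auto simp: freely_reduced_def successively_Cons)

lemma set_cons_reduce: "fst ` set (cons_reduce l w) \<subseteq> insert (fst l) (fst ` set w)"
  by (cases w) auto

lemma cons_reduce_cancel:
  "freely_reduced w \<Longrightarrow> cons_reduce (inv_letter l) (cons_reduce l w) = w"
proof (cases w)
  case (Cons l' w')
  assume "freely_reduced w"
  then show ?thesis
    using Cons by (cases w') (auto simp: freely_reduced_def)
qed simp

lemma freely_reduced_foldr: "freely_reduced v \<Longrightarrow> freely_reduced (foldr cons_reduce u v)"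
  by (induction u) (auto intro: freely_reduced_cons_reduce)

lemma set_foldr: "fst ` set (foldr cons_reduce u v) \<subseteq> fst ` set u \<union> fst ` set v"
proof (induction u)
  case (Cons l u)
  have "fst ` set (foldr cons_reduce (l # u) v) \<subseteq> insert (fst l) (fst ` set (foldr cons_reduce u v))"
    using set_cons_reduce[of l "foldr cons_reduce u v"] by simp
  also have "\<dots> \<subseteq> insert (fst l) (fst ` set u \<union> fst ` set v)"
    using Cons.IH by (rule insert_mono)
  finally show ?case by simp
qed simp

lemma foldr_cons_reduce:
  assumes "freely_reduced v"
  shows "foldr cons_reduce (cons_reduce l u) v = cons_reduce l (foldr cons_reduce u v)"
proof (cases u)
  case (Cons l' u')
  show ?thesis
  proof (cases "l' = inv_letter l")
    case True
    have "cons_reduce (inv_letter (inv_letter l))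
            (cons_reduce (inv_letter l) (foldr cons_reduce u' v)) = foldr cons_reduce u' v"
      by (rule cons_reduce_cancel) (rule freely_reduced_foldr[OF assms])
    then show ?thesis using True Cons by simp
  qed (simp add: Cons)
qed simp

lemma foldr_foldr_cons_reduce:
  assumes "freely_reduced v"
  shows "foldr cons_reduce (foldr cons_reduce u w) v = foldr cons_reduce u (foldr cons_reduce w v)"
  by (induction u) (simp_all add: foldr_cons_reduce[OF assms])

lemma reduce_word_id: "freely_reduced w \<Longrightarrow> reduce_word w = w"
proof (induction w)
  case (Cons l w)
  then have "reduce_word w = w" using freely_reduced_ConsD by blast
  then show ?case
    using Cons.prems by (cases w) (auto simp: reduce_word_def freely_reduced_def)
qed (simp add: reduce_word_def)

lemma reduce_word_append:
  "freely_reduced v \<Longrightarrow> reduce_word (u @ v) = foldr cons_reduce u v"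
  using reduce_word_id[of v] by (simp add: reduce_word_def)

lemma foldr_inverse:
  "freely_reduced v \<Longrightarrow>
     foldr cons_reduce (rev (map inv_letter u)) (foldr cons_reduce u v) = v"
  by (induction u arbitrary: v) (simp_all add: cons_reduce_cancel freely_reduced_foldr)

theorem group_free_group: "group (free_group S)"
proof (rule groupI)
  fix x y assume "x \<in> carrier (free_group S)" "y \<in> carrier (free_group S)"
  then show "x \<otimes>\<^bsub>free_group S\<^esub> y \<in> carrier (free_group S)"
    using freely_reduced_foldr[of y x] order_trans[OF set_foldr[of x y], of S]
    by (simp add: free_group_def reduce_word_append)
next
  fix x y z
  assume "x \<in> carrier (free_group S)" "y \<in> carrier (free_group S)" "z \<in> carrier (free_group S)"
  then show "x \<otimes>\<^bsub>free_group S\<^esub> y \<otimes>\<^bsub>free_group S\<^esub> z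
           = x \<otimes>\<^bsub>free_group S\<^esub> (y \<otimes>\<^bsub>free_group S\<^esub> z)"
    by (simp add: free_group_def reduce_word_append freely_reduced_foldr foldr_foldr_cons_reduce)
next
  fix x assume x: "x \<in> carrier (free_group S)"
  let ?y = "reduce_word (rev (map inv_letter x))"
  have "?y \<in> carrier (free_group S)"
    using x freely_reduced_foldr[of "[]" "rev (map inv_letter x)"]
      set_foldr[of "rev (map inv_letter x)" "[]"]
    by (auto simp: free_group_def reduce_word_def image_image)
  moreover have "?y \<otimes>\<^bsub>free_group S\<^esub> x = \<one>\<^bsub>free_group S\<^esub>"
  proof -
    have red: "freely_reduced x" using x by (simp add: free_group_def)
    have "foldr cons_reduce ?y x = foldr cons_reduce (rev (map inv_letter x)) x"
      using foldr_foldr_cons_reduce[OF red, of "rev (map inv_letter x)" "[]"]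
      by (simp add: reduce_word_def)
    also have "\<dots> = []"
      using foldr_inverse[of "[]" x] reduce_word_id[OF red] by (simp add: reduce_word_def)
    finally show ?thesis using red by (simp add: free_group_def reduce_word_append)
  qed
  ultimately show "\<exists>y\<in>carrier (free_group S). y \<otimes>\<^bsub>free_group S\<^esub> x = \<one>\<^bsub>free_group S\<^esub>" by blast
qed (auto simp: free_group_def reduce_word_append reduce_word_id)

lemma (in group) free_group_universal:
  assumes f: "f \<in> S \<rightarrow> carrier G"
  shows "\<exists>h \<in> hom (free_group S) G. \<forall>s\<in>S. h [(s, True)] = f s"
proof -
  define v where "v l = (if snd l then f (fst l) else inv (f (fst l)))" for l :: "_ \<times> bool"
  define h where "h w = foldr (\<lambda>l y. v l \<otimes> y) w \<one>" for w
  have v: "v l \<in> carrier G" if "fst l \<in> S" for l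
    using f that by (auto simp: v_def)
  have vinv: "v (inv_letter l) = inv (v l)" if "fst l \<in> S" for l
    using f[THEN funcset_mem, OF that] by (simp add: v_def inv_letter_def)
  have hc: "h w \<in> carrier G" if "fst ` set w \<subseteq> S" for w
    using that by (induction w) (auto simp: h_def v)
  have hcons: "h (cons_reduce l w) = v l \<otimes> h w" if "fst l \<in> S" "fst ` set w \<subseteq> S" for l w
  proof (cases w)
    case (Cons l' w')
    then have "h w' \<in> carrier G" using hc that by auto
    then show ?thesis
      using Cons that v[of l] vinv[of l] by (auto simp: h_def m_assoc[symmetric])
  qed (simp add: h_def)
  have hfold: "h (foldr cons_reduce u w) = h u \<otimes> h w"
    if "fst ` set u \<subseteq> S" "fst ` set w \<subseteq> S" for u w
    using that(1)
  proof (induction u)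
    case Nil
    then show ?case using hc[OF that(2)] by (simp add: h_def)
  next
    case (Cons l u)
    then have "fst ` set (foldr cons_reduce u w) \<subseteq> S"
      using order_trans[OF set_foldr[of u w], of S] that(2) by simp
    then have "h (foldr cons_reduce (l # u) w) = v l \<otimes> h (foldr cons_reduce u w)"
      using Cons.prems by (simp add: hcons)
    also have "\<dots> = v l \<otimes> (h u \<otimes> h w)" using Cons by simp
    also have "\<dots> = h (l # u) \<otimes> h w"
      using Cons.prems v[of l] hc[of u] hc[OF that(2)] by (simp add: h_def m_assoc)
    finally show ?case .
  qed
  have "h \<in> hom (free_group S) G"
    using hc hfold by (auto simp: hom_def free_group_def reduce_word_append)
  moreover have "h [(s, True)] = f s" if "s \<in> S" for s
    using f[THEN funcset_mem, OF that] by (simp add: h_def v_def)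
  ultimately show ?thesis by blast
qed

lemma (in group) derived_term_normal: "derived_term G n \<lhd> G"
  unfolding derived_term_def by (induction n) (auto simp: normal_self intro: derived_is_normal)

theorem group_free_soluble_group: "group (free_soluble_group m d)"
  unfolding free_soluble_group_def
  by (rule normal.factorgroup_is_group) (rule group.derived_term_normal[OF group_free_group])

lemma freely_reduced_in_generate:
  assumes "freely_reduced w" "fst ` set w \<subseteq> S"
  shows "w \<in> generate (free_group S) ((\<lambda>s. [(s, True)]) ` S)"
  using assms
proof (induction w)
  case Nil
  then show ?case using generate.one[of "free_group S"] by (simp add: free_group_def)
next
  case (Cons l w)
  interpret F: group "free_group S" by (rule group_free_group)
  let ?X = "(\<lambda>s. [(s, True)]) ` S"
  have w: "w \<in> generate (free_group S) ?X"
    using Cons freely_reduced_ConsD[of l w] by auto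
  have s: "fst l \<in> S" using Cons.prems by simp
  have "[l] \<in> generate (free_group S) ?X"
  proof (cases "snd l")
    case True
    then show ?thesis using s by (intro generate.incl) (auto simp: image_iff prod_eq_iff)
  next
    case False
    have car: "[l] \<in> carrier (free_group S)" "[(fst l, True)] \<in> carrier (free_group S)"
      using s by (auto simp: free_group_def freely_reduced_def)
    have "[l] \<otimes>\<^bsub>free_group S\<^esub> [(fst l, True)] = \<one>\<^bsub>free_group S\<^esub>"
      using False by (auto simp: free_group_def reduce_word_def inv_letter_def)
    then have "[l] = inv\<^bsub>free_group S\<^esub> [(fst l, True)]"
      using car by (simp add: F.inv_equality)
    moreover have "inv\<^bsub>free_group S\<^esub> [(fst l, True)] \<in> generate (free_group S) ?X"
      using s by (intro generate.inv) auto
    ultimately show ?thesis by simp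
  qed
  then have "[l] \<otimes>\<^bsub>free_group S\<^esub> w \<in> generate (free_group S) ?X"
    using w by (rule generate.eng)
  moreover have "[l] \<otimes>\<^bsub>free_group S\<^esub> w = l # w"
    using reduce_word_id[OF Cons.prems(1)] by (simp add: free_group_def)
  ultimately show ?case by simp
qed

theorem generate_free_group:
  "generate (free_group S) ((\<lambda>s. [(s, True)]) ` S) = carrier (free_group S)"
proof
  show "generate (free_group S) ((\<lambda>s. [(s, True)]) ` S) \<subseteq> carrier (free_group S)"
    by (rule group.generate_incl[OF group_free_group])
       (auto simp: free_group_def freely_reduced_def)
  show "carrier (free_group S) \<subseteq> generate (free_group S) ((\<lambda>s. [(s, True)]) ` S)"
    using freely_reduced_in_generate by (auto simp: free_group_def)
qed

end

theory Submission
  imports Defs "HOL-Library.Multiset"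
begin

text \<open>Write \<open>\<Gamma>\<close> for the Cayley graph of \<open>Sol(m, d-1)\<close> and \<open>k = 2 \<sqdot> 3\<^sup>d\<^sup>-\<^sup>2 - 1\<close>. Words that are equal
  in \<open>Sol(m, d)\<close> have the same flow (signed number of crossings of each edge) in \<open>\<Gamma>\<close>. The girth of
  \<open>\<Gamma>\<close> is at least \<open>2k + 2\<close>: a reduced closed path of zero flow crosses every edge of its support at
  least twice and its support contains two independent cycles, so that the girth is multiplied by
  at least three in each step of the derived series. Hence reduced words of length at most \<open>k\<close> are
  geodesic in \<open>\<Gamma>\<close>.

  There is a closed walk \<open>t\<close> outside the open ball of radius \<open>k\<close> that visits all vertices at distance
  \<open>k\<close> and crosses no edge in both directions. The element given by \<open>t\<close>, conjugated by a path to a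
  vertex of \<open>t\<close>, is the required dead end \<open>g\<close>: for a reduced word \<open>w\<close> of length \<open>i \<le> k\<close>, a path with the
  flow of \<open>g w\<close> has at least \<open>|t|\<close> edges outside the ball, and it has to leave the ball and come back to
  distance \<open>i\<close>, which takes \<open>k + (k - i)\<close> further edges. Walking along \<open>w\<close> to \<open>t\<close>, around \<open>t\<close> and back
  attains this bound, so \<open>|g w| = |t| + 2k - i\<close>.\<close>

section \<open>Graphs whose edges have a reversal\<close>

text \<open>The upper bound on |g w| rests on commutation: closed words of level n commute on level
  n + 1, which lets the loop \<open>t\<close> be entered at any vertex at distance k. The main
  obstacle is the existence of \<open>t\<close>. A bridge of the graph outside the ball is crossed
  by a closed walk equally often in both directions, so the vertices at distance k have to be joined
  by arcs that are not bridges there. Girth alone does not give this, since a path leading away from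
  the ball might come back to it. Hence a second invariant is carried up the derived series: no
  nonempty reduced word of length less than 2k + 1 whose first and last letters differ from a and
  a^-1 leads from the line < a > back to it. It keeps the rays w b^j outside the ball if b and the
  last letter of w belong to different generators. Far away, the ends of such rays are joined by
  detours built from commutators. The constants start from Z^m, where the girth is 4 and the
  shortest excursion b a b^-1 from < a > has length 3; tripling gives 4 * 3^n = 2k + 2 with n = d -
  2.\<close>

text \<open>Loops and parallel arcs are allowed; only an arc that equals its own reversal is
  excluded. The locale serves for Cayley graphs, for their subgraphs outside a ball and for the
  quotient in which a line is contracted to a vertex.\<close>

locale graph_with_reversal =
  fixes src tgt :: "'e \<Rightarrow> 'v" and rv :: "'e \<Rightarrow> 'e" and X :: "'e set"
  assumes rv_rv: "e \<in> X \<Longrightarrow> rv (rv e) = e"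
    and rv_neq: "e \<in> X \<Longrightarrow> rv e \<noteq> e"
    and src_rv: "e \<in> X \<Longrightarrow> src (rv e) = tgt e"
    and rv_in: "e \<in> X \<Longrightarrow> rv e \<in> X"
begin

lemma tgt_rv: "e \<in> X \<Longrightarrow> tgt (rv e) = src e"
  by (metis rv_rv src_rv rv_in)

fun path :: "'v \<Rightarrow> 'e list \<Rightarrow> 'v \<Rightarrow> bool" where
  "path u [] v \<longleftrightarrow> u = v"
| "path u (e # P) v \<longleftrightarrow> e \<in> X \<and> src e = u \<and> path (tgt e) P v"

lemma path_append: "path u (P @ Q) v \<longleftrightarrow> (\<exists>x. path u P x \<and> path x Q v)"
  by (induction P arbitrary: u) auto

lemma path_appendI: "path u P x \<Longrightarrow> path x Q v \<Longrightarrow> path u (P @ Q) v"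
  by (auto simp: path_append)

lemma path_in_X: "path u P v \<Longrightarrow> set P \<subseteq> X"
  by (induction P arbitrary: u) auto

lemma path_split_src:
  assumes "path u P v" "e \<in> set P"
  obtains P1 P2 where "P = P1 @ P2" "path u P1 (src e)" "path (src e) P2 v" "P2 \<noteq> []" "hd P2 = e"
proof -
  obtain P1 P2 where P: "P = P1 @ e # P2" using assms(2) by (meson split_list)
  with assms(1) have "path u P1 (src e)" "path (src e) (e # P2) v" by (auto simp: path_append)
  with P that show thesis by fastforce
qed

lemma path_split_tgt:
  assumes "path u P v" "e \<in> set P"
  obtains P1 P2 where "P = P1 @ P2" "path u P1 (tgt e)" "path (tgt e) P2 v"
proof -
  obtain P1 P2 where P: "P = P1 @ e # P2" using assms(2) by (meson split_list)
  with assms(1) have "path u (P1 @ [e]) (tgt e)" "path (tgt e) P2 v" by (auto simp: path_append)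
  with P that[of "P1 @ [e]" P2] show thesis by simp
qed

definition rev_path :: "'e list \<Rightarrow> 'e list" where
  "rev_path P = rev (map rv P)"

lemma path_rev_path: "path u P v \<Longrightarrow> path v (rev_path P) u"
  by (induction P arbitrary: u) (auto simp: rev_path_def path_append rv_in src_rv tgt_rv)

text \<open>Stronger than \<open>reduced\<close>: an edge is not crossed backwards even at a distant
  place, so the flow at an arc of the path is the number of its crossings.\<close>

definition no_turn :: "'e list \<Rightarrow> bool" where
  "no_turn P \<longleftrightarrow> (\<forall>e \<in> set P. rv e \<notin> set P)"

definition reduced :: "'e list \<Rightarrow> bool" where
  "reduced P \<longleftrightarrow> successively (\<lambda>e f. f \<noteq> rv e) P"

lemma reduced_appendD: "reduced (P @ Q) \<Longrightarrow> reduced P" "reduced (P @ Q) \<Longrightarrow> reduced Q"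
  by (auto simp: reduced_def successively_append_iff)

lemma turn_decomp:
  assumes "\<not> no_turn P" "set P \<subseteq> X"
  obtains A e B D where "P = A @ e # B @ rv e # D" "e \<in> X"
proof -
  obtain e where e: "e \<in> set P" "rv e \<in> set P" using assms(1) by (auto simp: no_turn_def)
  obtain A B where P: "P = A @ e # B" using e(1) by (meson split_list)
  have X: "e \<in> X" using e assms(2) by auto
  have "rv e \<noteq> e" using X rv_neq by auto
  then consider "rv e \<in> set A" | "rv e \<in> set B" using e(2) P by auto
  then show thesis
  proof cases
    case 1
    then obtain A1 A2 where "A = A1 @ rv e # A2" by (meson split_list)
    then have "P = A1 @ rv e # A2 @ rv (rv e) # B" using P X by (simp add: rv_rv)
    then show ?thesis using that X rv_in by blast
  next
    case 2
    then obtain A1 A2 where "B = A1 @ rv e # A2" by (meson split_list)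
    then show ?thesis using that P X by simp
  qed
qed

section \<open>Circuits in reduced closed paths and the tripling of length\<close>

text \<open>A repeated source, or an arc followed later by its reversal, encloses a shorter reduced
  closed path; reducedness keeps it nonempty in the second case.\<close>

lemma circuit_in_closed_path:
  assumes "path v P v" "P \<noteq> []" "reduced P"
  shows "\<exists>u C. path u C u \<and> C \<noteq> [] \<and> set C \<subseteq> set P \<and> distinct (map src C) \<and> no_turn C"
  using assms
proof (induction "length P" arbitrary: v P rule: less_induct)
  case less
  note X = path_in_X[OF less.prems(1)]
  show ?case
  proof (cases "distinct (map src P)")
    case False
    then obtain As x Bs Cs where d: "map src P = As @ [x] @ Bs @ [x] @ Cs"
      using not_distinct_decomp by blast
    then obtain A P1 where "P = A @ P1" "map src P1 = x # Bs @ x # Cs"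
      by (auto simp: map_eq_append_conv)
    then obtain e P2 where "P = A @ e # P2" "src e = x" "map src P2 = Bs @ x # Cs"
      by (auto simp: map_eq_Cons_conv)
    then obtain B P3 where "P = A @ e # B @ P3" "src e = x" "map src P3 = x # Cs"
      by (auto simp: map_eq_append_conv)
    then obtain f D where P: "P = A @ e # B @ f # D" and "src e = x" "src f = x"
      by (auto simp: map_eq_Cons_conv)
    then have "path (src e) (e # B) (src e)" using less.prems(1) by (auto simp: path_append)
    moreover have "reduced (e # B)"
      using less.prems(3) P reduced_appendD(1)[of "e # B" "f # D"] reduced_appendD(2)[of A] by simp
    moreover have "length (e # B) < length P" using P by simp
    ultimately have "\<exists>u C. path u C u \<and> C \<noteq> [] \<and> set C \<subseteq> set (e # B) \<and> distinct (map src C) \<and> no_turn C"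
      using less.hyps[of "e # B" "src e"] by blast
    moreover have "set (e # B) \<subseteq> set P" using P by auto
    ultimately show ?thesis by (meson order_trans)
  next
    case True
    show ?thesis
    proof (cases "no_turn P")
      case False
      obtain A e B D where P: "P = A @ e # B @ rv e # D" and e: "e \<in> X"
        using turn_decomp[OF False X] by blast
      have "path (tgt e) B (tgt e)" using less.prems(1) P e by (auto simp: path_append src_rv)
      moreover have "B \<noteq> []"
        using less.prems(3) P by (auto simp: reduced_def successively_append_iff)
      moreover have "reduced B"
        using less.prems(3) P reduced_appendD(1)[of B] reduced_appendD(2)[of "A @ [e]" "B @ rv e # D"]
        by simp
      moreover have "length B < length P" using P by simp
      ultimately have "\<exists>u C. path u C u \<and> C \<noteq> [] \<and> set C \<subseteq> set B \<and> distinct (map src C) \<and> no_turn C"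
        using less.hyps[of B "tgt e"] by blast
      moreover have "set B \<subseteq> set P" using P by auto
      ultimately show ?thesis by (meson order_trans)
    qed (use less.prems True in blast)
  qed
qed

text \<open>The part between two occurrences of an arc, or between an arc and its reversal, can be
  cut out without moving the ends. This provides the arc attached to the circuit in
  \<open>tripling\<close>.\<close>

lemma shortcut:
  assumes "path u P v"
  shows "\<exists>Q. path u Q v \<and> set Q \<subseteq> set P \<and> distinct Q \<and> no_turn Q"
  using assms
proof (induction "length P" arbitrary: P rule: less_induct)
  case less
  note X = path_in_X[OF less.prems(1)]
  have *: ?case if "path u P' v" "length P' < length P" "set P' \<subseteq> set P" for P'
    using less.hyps[OF that(2) that(1)] that(3) by (meson order_trans)
  show ?case
  proof (cases "distinct P")
    case False
    then obtain A e B D where P: "P = A @ [e] @ B @ [e] @ D"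
      using not_distinct_decomp by blast
    show ?thesis
      by (rule *[of "A @ e # D"]) (use P less.prems in \<open>auto simp: path_append\<close>)
  next
    case True
    show ?thesis
    proof (cases "no_turn P")
      case False
      obtain A e B D where P: "P = A @ e # B @ rv e # D" and e: "e \<in> X"
        using turn_decomp[OF False X] by blast
      show ?thesis
        by (rule *[of "A @ D"]) (use P e less.prems in \<open>auto simp: path_append tgt_rv\<close>)
    qed (use less.prems True in blast)
  qed
qed

text \<open>The targets of a closed path are its sources shifted by one place, so both lists are
  equal as multisets.\<close>

lemma distinct_tgt:
  assumes "path u C u" "distinct (map src C)"
  shows "distinct (map tgt C)"
proof -
  have shift: "map src P @ [v] = u # map tgt P" if "path u P v" for u P v
    using that by (induction P arbitrary: u) auto
  have "mset (map src C @ [u]) = mset (u # map tgt C)" using shift[OF assms(1)] by simp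
  then have "mset (map src C) = mset (map tgt C)" by simp
  then show ?thesis using assms(2) by (metis mset_eq_imp_distinct_iff)
qed

lemma closed_path_vertices:
  assumes "path u C u" "e \<in> set C"
  shows "tgt e \<in> src ` set C"
proof -
  have shift: "map src P @ [v] = u # map tgt P" if "path u P v" for u P v
    using that by (induction P arbitrary: u) auto
  have "mset (map src C @ [u]) = mset (u # map tgt C)" using shift[OF assms(1)] by simp
  then have "mset (map src C) = mset (map tgt C)" by simp
  then have "src ` set C = tgt ` set C" by (metis set_map set_mset_mset)
  then show ?thesis using assms(2) by auto
qed

text \<open>Exactly one arc of C enters and one leaves each vertex of the circuit, so changing the
  orientation would mean going straight back.\<close>

lemma path_along_circuit:
  assumes C: "path u C u" "distinct (map src C)" "no_turn C"
    and P: "path v P w" "reduced P" "set P \<subseteq> set C \<union> rv ` set C"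
  shows "set P \<subseteq> set C \<or> set P \<subseteq> rv ` set C"
  using P
proof (induction P arbitrary: v)
  case (Cons e P)
  note CX = path_in_X[OF C(1)]
  have inj_src: "inj_on src (set C)" using C(2) by (simp add: distinct_map)
  have inj_tgt: "inj_on tgt (set C)" using distinct_tgt[OF C(1,2)] by (simp add: distinct_map)
  show ?case
  proof (cases P)
    case Nil
    then show ?thesis using Cons.prems by auto
  next
    case (Cons f P')
    have IH: "set P \<subseteq> set C \<or> set P \<subseteq> rv ` set C"
      using Cons.IH[of "tgt e"] Cons.prems reduced_appendD(2)[of "[e]" P] by simp
    have f: "f \<noteq> rv e" "src f = tgt e" "e \<in> X" "f \<in> X"
      using Cons.prems Cons by (auto simp: reduced_def)
    have 1: "f \<in> set C" if e: "e \<in> set C" and fC: "f \<in> set C \<union> rv ` set C"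
    proof (rule ccontr)
      assume "f \<notin> set C"
      then obtain c where c: "c \<in> set C" "f = rv c" using fC by auto
      then have "tgt c = tgt e" using f CX src_rv by auto
      then have "c = e" using inj_tgt c e by (auto dest: inj_onD)
      then show False using f c by simp
    qed
    have 2: "f \<in> rv ` set C" if e: "e \<in> rv ` set C" and fC: "f \<in> set C \<union> rv ` set C"
    proof (rule ccontr)
      assume "f \<notin> rv ` set C"
      then have fC: "f \<in> set C" using fC by auto
      obtain c where c: "c \<in> set C" "e = rv c" using e by auto
      then have "src c = src f" using f CX tgt_rv by auto
      then have "c = f" using inj_src c fC by (auto dest: inj_onD)
      then show False using f c CX rv_rv by auto
    qed
    have disj: "\<not> (f \<in> set C \<and> f \<in> rv ` set C)"
      using C(3) CX rv_rv by (auto simp: no_turn_def)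
    show ?thesis using 1 2 disj IH Cons.prems(3) Cons by auto
  qed
qed simp

lemma card_both_orientations:
  assumes "distinct P" "no_turn P" "set P \<subseteq> X"
  shows "card (set P \<union> rv ` set P) = 2 * length P"
proof -
  have "inj_on rv (set P)" using assms(3) by (intro inj_onI) (metis rv_rv subsetD)
  then have "card (rv ` set P) = length P" using assms(1) by (simp add: card_image distinct_card)
  moreover have "set P \<inter> rv ` set P = {}" using assms(2) by (auto simp: no_turn_def)
  ultimately show ?thesis using assms(1) by (simp add: card_Un_disjoint distinct_card)
qed

text \<open>The set of edges of \<open>P\<close> contains a circuit \<open>C\<close> and, as \<open>P\<close> cannot run along \<open>C\<close> only, an arc or
  circuit \<open>Q'\<close> attached to \<open>C\<close> and edge-disjoint from it. In the first case the three closed paths of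
  the theta graph \<open>C \<union> Q'\<close> give \<open>2 |C \<union> Q'| \<ge> 3 \<gamma>\<close>, and \<open>P\<close> passes through every edge of \<open>C \<union> Q'\<close> in
  both directions.\<close>

lemma tripling:
  assumes girth: "\<And>v C. \<lbrakk>path v C v; C \<noteq> []; distinct C; no_turn C\<rbrakk> \<Longrightarrow> \<gamma> \<le> length C"
    and P: "path v P v" "P \<noteq> []" "reduced P"
    and bal: "\<And>e. e \<in> X \<Longrightarrow> count_list P e = count_list P (rv e)"
  shows "\<exists>s. 2 * s \<le> length P \<and> 3 * \<gamma> \<le> 2 * s"
  using P bal
proof (induction "length P" arbitrary: v P rule: less_induct)
  case less
  note PX = path_in_X[OF less.prems(1)]
  have closed: "rv e \<in> set P" if "e \<in> set P" for e
    using less.prems(4)[of e] that PX by (metis count_list_0_iff subsetD)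
  show ?case
  proof (cases "hd P = rv (last P)")
    \<comment> \<open>Here P is not cyclically reduced. Removing both end arcs preserves the
      hypotheses; in the other case P may be rotated.\<close>
    case True
    obtain e Q where Q: "P = e # Q" using less.prems(2) by (cases P) auto
    have eX: "e \<in> X" using Q PX by auto
    have "Q \<noteq> []" using True Q rv_neq[OF eX] by auto
    then obtain R f where R: "Q = R @ [f]" by (cases Q rule: rev_cases) auto
    have fX: "f \<in> X" using PX Q R by auto
    have ef: "f = rv e" using True Q R fX by (simp add: rv_rv)
    have P': "P = e # R @ [rv e]" using Q R ef by simp
    have "path (tgt e) R (tgt e)" using less.prems(1) P' eX by (auto simp: path_append src_rv)
    moreover have "R \<noteq> []" using less.prems(3) P' by (auto simp: reduced_def)
    moreover have "reduced R"
      using less.prems(3) P' reduced_appendD(2)[of "[e]" "R @ [rv e]"]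
        reduced_appendD(1)[of R "[rv e]"] by simp
    moreover have "count_list R x = count_list R (rv x)" if "x \<in> X" for x
    proof -
      have "rv x = e \<longleftrightarrow> x = rv e" "rv x = rv e \<longleftrightarrow> x = e" using that eX by (metis rv_rv)+
      then show ?thesis using less.prems(4)[OF that] P' rv_neq[OF eX] by (auto split: if_splits)
    qed
    ultimately obtain s where "2 * s \<le> length R" "3 * \<gamma> \<le> 2 * s"
      using less.hyps[of R "tgt e"] P' by auto
    then show ?thesis using P' by (intro exI[of _ s]) auto
  next
    case False
    obtain u C where C: "path u C u" "C \<noteq> []" "set C \<subseteq> set P" "distinct (map src C)" "no_turn C"
      using circuit_in_closed_path[OF less.prems(1-3)] by blast
    have dC: "distinct C" using C(4) by (simp add: distinct_map)
    have c\<gamma>: "\<gamma> \<le> length C" using girth C dC by blast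
    note CX = path_in_X[OF C(1)]
    define Cs where "Cs = set C \<union> rv ` set C"
    have Cs_rv: "rv e \<in> Cs" if "e \<in> Cs" for e using that CX rv_rv by (auto simp: Cs_def)
    have Cs_P: "Cs \<subseteq> set P" using C(3) closed by (auto simp: Cs_def)
    have src_Cs: "src e \<in> src ` set C" if "e \<in> Cs" for e
      using that closed_path_vertices[OF C(1)] CX src_rv by (auto simp: Cs_def)
    have tgt_Cs: "tgt e \<in> src ` set C" if "e \<in> Cs" for e
      using that closed_path_vertices[OF C(1)] CX tgt_rv by (auto simp: Cs_def)
    have "\<not> set P \<subseteq> Cs"
    proof
      assume "set P \<subseteq> Cs"
      then have "set P \<subseteq> set C \<or> set P \<subseteq> rv ` set C"
        using path_along_circuit[OF C(1,4,5) less.prems(1,3)] by (simp add: Cs_def)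
      moreover obtain c where "c \<in> set C" using C(2) by (cases C) auto
      ultimately show False using C(3,5) closed CX rv_rv unfolding no_turn_def by (metis imageE subsetD)
    qed
    obtain c where c: "c \<in> set C" using C(2) by (cases C) auto
    then obtain A B where AB: "P = A @ c # B" using C(3) by (meson split_list subsetD)
    \<comment> \<open>P rotated to start with an arc of C; it stays reduced because the first arc of
      P does not reverse the last one.\<close>
    define R where "R = c # B @ A"
    have Rp: "path (src c) R (src c)"
      using less.prems(1) AB by (auto simp: R_def path_append)
    have setR: "set R = set P" using AB by (auto simp: R_def)
    have Rred: "reduced R"
    proof (cases "A = []")
      case True
      then show ?thesis using less.prems(3) AB by (simp add: R_def)
    next
      case Ane: False
      have "reduced A" "reduced (c # B)" using less.prems(3) AB reduced_appendD by blast+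
      moreover have "hd A \<noteq> rv (last (c # B))" using False AB Ane by simp
      ultimately show ?thesis
        unfolding R_def reduced_def append_Cons[symmetric] successively_append_iff by auto
    qed
    define B1 where "B1 = takeWhile (\<lambda>e. e \<in> Cs) R"
    define R1 where "R1 = dropWhile (\<lambda>e. e \<in> Cs) R"
    \<comment> \<open>The first maximal stretch of R off C. Both its ends are on C: it is preceded
      by an arc of C, and followed by another one or by the start of R.\<close>
    define Q where "Q = takeWhile (\<lambda>e. e \<notin> Cs) R1"
    define R2 where "R2 = dropWhile (\<lambda>e. e \<notin> Cs) R1"
    have RB: "R = B1 @ Q @ R2" by (simp add: B1_def Q_def R2_def R1_def)
    have B1ne: "B1 \<noteq> []" using c by (simp add: B1_def R_def Cs_def)
    have B1Cs: "set B1 \<subseteq> Cs" unfolding B1_def by (auto dest: set_takeWhileD)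
    have R1ne: "R1 \<noteq> []" using \<open>\<not> set P \<subseteq> Cs\<close> setR by (auto simp: R1_def dropWhile_eq_Nil_conv)
    have "hd R1 \<notin> Cs" using R1ne hd_dropWhile unfolding R1_def by blast
    then have Qne: "Q \<noteq> []" using R1ne by (cases R1) (auto simp: Q_def)
    have QCs: "set Q \<inter> Cs = {}" unfolding Q_def by (auto dest: set_takeWhileD)
    obtain x y where xy: "path (src c) B1 x" "path x Q y" "path y R2 (src c)"
      using Rp RB by (auto simp: path_append)
    have x: "x \<in> src ` set C"
    proof -
      obtain B' b where b: "B1 = B' @ [b]" using B1ne by (cases B1 rule: rev_cases) auto
      then have "x = tgt b" using xy(1) by (auto simp: path_append)
      then show ?thesis using tgt_Cs b B1Cs by auto
    qed
    have y: "y \<in> src ` set C"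
    proof (cases R2)
      case Nil
      then show ?thesis using xy c by auto
    next
      case (Cons f R')
      then have "f \<in> Cs" unfolding R2_def using hd_dropWhile[of "\<lambda>e. e \<notin> Cs" R1] by auto
      then show ?thesis using xy Cons src_Cs by auto
    qed
    have QP: "set Q \<subseteq> set P" using setR RB by auto
    \<comment> \<open>The arcs of C and Q' with their reversals are 2 (|C| + |Q'|) distinct arcs of
      P, which gives s = |C| + |Q'|.\<close>
    have finish: ?thesis if Q': "distinct Q'" "no_turn Q'" "set Q' \<subseteq> set Q"
      and "3 * \<gamma> \<le> 2 * (length C + length Q')" for Q'
    proof -
      have Q'X: "set Q' \<subseteq> X" using Q'(3) QP PX by auto
      have "(set Q' \<union> rv ` set Q') \<inter> Cs = {}"
      proof -
        have "e \<notin> Cs \<and> rv e \<notin> Cs" if "e \<in> set Q'" for e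
        proof -
          have "e \<notin> Cs" "rv (rv e) = e" using that Q'(3) QCs Q'X rv_rv by auto
          then show ?thesis using Cs_rv[of "rv e"] by auto
        qed
        then show ?thesis by auto
      qed
      then have "card (Cs \<union> (set Q' \<union> rv ` set Q')) = 2 * length C + 2 * length Q'"
        using card_both_orientations[OF dC C(5) CX] card_both_orientations[OF Q'(1,2) Q'X]
        by (subst card_Un_disjoint) (auto simp: Cs_def)
      moreover have "Cs \<union> (set Q' \<union> rv ` set Q') \<subseteq> set P" using Cs_P Q'(3) QP closed by auto
      then have "card (Cs \<union> (set Q' \<union> rv ` set Q')) \<le> length P"
        by (meson card_length card_mono finite_set order_trans)
      ultimately show ?thesis using that(4) by (intro exI[of _ "length C + length Q'"]) auto
    qed
    show ?thesis
    proof (cases "x = y")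
      case True
      have "reduced Q" using Rred RB reduced_appendD by blast
      then obtain z Q' where Q': "path z Q' z" "Q' \<noteq> []" "set Q' \<subseteq> set Q" "distinct (map src Q')" "no_turn Q'"
        using circuit_in_closed_path[of x Q] xy(2) True Qne by blast
      then have dQ': "distinct Q'" by (simp add: distinct_map)
      then have "\<gamma> \<le> length Q'" using girth Q' by blast
      then show ?thesis using finish[OF dQ' Q'(5,3)] c\<gamma> by simp
    next
      case ne: False
      obtain Q' where Q': "path x Q' y" "set Q' \<subseteq> set Q" "distinct Q'" "no_turn Q'"
        using shortcut[OF xy(2)] by blast
      have Q'ne: "Q' \<noteq> []" using Q'(1) ne by auto
      obtain c1 c2 where c12: "c1 \<in> set C" "x = src c1" "c2 \<in> set C" "y = src c2" using x y by auto
      obtain D1 D2 where D: "C = D1 @ D2" "path u D1 x" "path x D2 u"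
        using path_split_src[OF C(1) c12(1)] c12 by metis
      have "path x (D2 @ D1) x" using D path_append by blast
      moreover have "c2 \<in> set (D2 @ D1)" using c12 D by auto
      ultimately obtain C1 C2 where C12: "D2 @ D1 = C1 @ C2" "path x C1 y" "path y C2 x"
        using path_split_src c12(4) by metis
      have len: "length C1 + length C2 = length C"
        using arg_cong[OF C12(1), of length] D(1) by simp
      have setC: "set C1 \<union> set C2 = set C" using arg_cong[OF C12(1), of set] D(1) by auto
      have dC12: "distinct C1" "distinct C2"
        using arg_cong[OF C12(1), of distinct] D(1) dC by auto
      have Q'X: "set Q' \<subseteq> X" using Q'(2) QP PX by auto
      have disj: "e \<notin> Cs" "rv e \<notin> Cs" if "e \<in> set Q'" for e
      proof -
        show "e \<notin> Cs" using that Q'(2) QCs by auto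
        then show "rv e \<notin> Cs" using that Q'X rv_rv Cs_rv[of "rv e"] by auto
      qed
      have C12Cs: "set C1 \<subseteq> Cs" "set C2 \<subseteq> Cs" "rv ` set C1 \<subseteq> Cs" "rv ` set C2 \<subseteq> Cs"
        using setC by (auto simp: Cs_def)
      have nC2: "no_turn C2" using C(5) setC by (auto simp: no_turn_def)
      have "\<gamma> \<le> length (Q' @ C2)"
      proof (rule girth)
        show "path x (Q' @ C2) x" using Q' C12 by (auto simp: path_append)
        show "distinct (Q' @ C2)" using Q'(3) dC12 disj C12Cs by auto
        show "no_turn (Q' @ C2)"
          using Q'(4) nC2 disj C12Cs unfolding no_turn_def set_append by blast
      qed (use Q'ne in auto)
      moreover have "\<gamma> \<le> length (Q' @ rev_path C1)"
      proof (rule girth)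
        have s: "set (rev_path C1) = rv ` set C1" by (simp add: rev_path_def)
        show "path x (Q' @ rev_path C1) x" using Q' C12 path_rev_path by (auto simp: path_append)
        have "inj_on rv (set C1)" using setC CX by (intro inj_onI) (metis UnI1 rv_rv subsetD)
        then have "distinct (rev_path C1)" using dC12 by (simp add: rev_path_def distinct_map)
        then show "distinct (Q' @ rev_path C1)" using Q'(3) disj C12Cs s by auto
        have C1: "rv (rv e) = e" "e \<in> Cs" "rv e \<in> Cs" "rv e \<notin> set C1" if "e \<in> set C1" for e
          using that setC CX rv_rv C(5) by (auto simp: Cs_def no_turn_def)
        show "no_turn (Q' @ rev_path C1)"
          unfolding no_turn_def s set_append
        proof
          fix e assume "e \<in> set Q' \<union> rv ` set C1"
          then consider "e \<in> set Q'" | c where "c \<in> set C1" "e = rv c" by auto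
          then show "rv e \<notin> set Q' \<union> rv ` set C1"
          proof cases
            case 1
            then have "rv e \<notin> set Q'" "rv e \<notin> Cs" using Q'(4) disj by (auto simp: no_turn_def)
            then show ?thesis using C1(3) by auto
          next
            case 2
            then have "rv e = c" using C1 by auto
            moreover have "c \<notin> rv ` set C1"
            proof
              assume "c \<in> rv ` set C1"
              then obtain c' where "c' \<in> set C1" "c = rv c'" by auto
              then show False using C1(4)[of c'] 2 by simp
            qed
            ultimately show ?thesis using C1(2)[OF 2(1)] disj(1)[of c] by auto
          qed
        qed
      qed (use Q'ne in auto)
      \<comment> \<open>Each of C1, C2 and Q' belongs to two of the three closed paths, so the three
        bounds add up to 3 \<gamma> \<le> 2 (|C| + |Q'|).\<close>
      ultimately show ?thesis using finish[OF Q'(3,4,2)] len c\<gamma> by (simp add: rev_path_def)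
    qed
  qed
qed

section \<open>Flows and closed paths without turns\<close>

definition flow :: "'e list \<Rightarrow> 'e \<Rightarrow> int" where
  "flow P e = int (count_list P e) - int (count_list P (rv e))"

lemma flow_append [simp]: "flow (P @ Q) e = flow P e + flow Q e"
  by (simp add: flow_def)

lemma flow_Nil [simp]: "flow [] e = 0"
  by (simp add: flow_def)

lemma flow_rv: "e \<in> X \<Longrightarrow> flow P (rv e) = - flow P e"
  by (simp add: flow_def rv_rv)

lemma flow_nonzeroD: "flow P e \<noteq> 0 \<Longrightarrow> e \<in> set P \<or> rv e \<in> set P"
  unfolding flow_def by (metis count_list_0_iff diff_self)

lemma abs_flow_le: "\<bar>flow P e\<bar> \<le> int (length P)"
  using count_le_length[of P e] count_le_length[of P "rv e"] by (simp add: flow_def)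

lemma flow_cancel_pair:
  assumes "e \<in> X" "f \<in> X"
  shows "flow [e, rv e] f = 0"
proof -
  have "rv f = e \<longleftrightarrow> f = rv e" "rv f = rv e \<longleftrightarrow> f = e" using assms by (metis rv_rv)+
  then show ?thesis using rv_neq[OF assms(1)] by (auto simp: flow_def)
qed

text \<open>A weakening of \<open>no_turn\<close> that depends on the path only through its support
  and its flow. It survives the insertion of large powers of closed paths and can be turned into
  \<open>no_turn\<close> at the end.\<close>

definition full :: "'e list \<Rightarrow> bool" where
  "full P \<longleftrightarrow> (\<forall>e \<in> set P. flow P e \<noteq> 0)"

lemma no_turn_full: "no_turn P \<Longrightarrow> full P"
  unfolding no_turn_def full_def flow_def
  by (metis count_list_0_iff diff_zero of_nat_0 of_nat_eq_0_iff)

lemma full_same_flow: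
  assumes "full P" "set Q \<subseteq> set P" "\<And>f. f \<in> X \<Longrightarrow> flow Q f = flow P f" "set P \<subseteq> X"
  shows "full Q"
  using assms unfolding full_def by (metis subsetD)

text \<open>Removing a pair \<open>e \<dots> rv e\<close> splits off a closed path between the two; since the flow at \<open>e\<close> is
  nonzero, one of the two pieces still passes through \<open>e\<close>, so that they can be joined again.\<close>

lemma full_imp_no_turn:
  assumes "path v P v" "full P"
  shows "\<exists>Q. path v Q v \<and> no_turn Q \<and> (\<forall>f \<in> X. flow Q f = flow P f)"
  using assms
proof (induction "length P" arbitrary: P rule: less_induct)
  case less
  note X = path_in_X[OF less.prems(1)]
  show ?case
  proof (cases "no_turn P")
    case False
    obtain A e B D where P: "P = A @ e # B @ rv e # D" and e: "e \<in> X"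
      using turn_decomp[OF False X] by blast
    have pA: "path v A (src e)" and pB: "path (tgt e) B (tgt e)" and pD: "path (src e) D v"
      using less.prems(1) P e by (auto simp: path_append src_rv tgt_rv)
    have fl: "flow P f = flow A f + flow B f + flow D f" if "f \<in> X" for f
    proof -
      have "flow P f = flow A f + flow B f + flow D f + flow [e, rv e] f"
        by (simp add: P flow_def)
      then show ?thesis using flow_cancel_pair e that by simp
    qed
    \<comment> \<open>A closed path composed of the arcs of A, B and D has the flow of P, is full
      and is shorter by two, so only the splicing remains.\<close>
    have *: ?thesis if Q: "path v Q v" "mset Q = mset (A @ B @ D)" for Q
    proof -
      have "count_list Q f = count_list (A @ B @ D) f" for f
        using Q(2) by (metis count_mset)
      then have flQ: "flow Q f = flow P f" if "f \<in> X" for f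
        using fl[OF that] by (simp add: flow_def)
      have "set Q = set (A @ B @ D)" using Q(2) mset_eq_setD by blast
      then have "full Q"
        using full_same_flow[OF less.prems(2) _ flQ X] P by auto
      moreover have "length Q < length P" using mset_eq_length[OF Q(2)] P by simp
      ultimately obtain R where "path v R v \<and> no_turn R \<and> (\<forall>f \<in> X. flow R f = flow Q f)"
        using less.hyps[of Q] Q(1) by blast
      then show ?thesis using flQ by auto
    qed
    have "flow A e + flow B e + flow D e \<noteq> 0" using fl[OF e] less.prems(2) P by (auto simp: full_def)
    then obtain g where g: "g \<in> set A \<union> set B \<union> set D" "g = e \<or> g = rv e"
      using flow_nonzeroD[of A e] flow_nonzeroD[of B e] flow_nonzeroD[of D e] by fastforce
    then have ends: "(src g = src e \<and> tgt g = tgt e) \<or> (src g = tgt e \<and> tgt g = src e)"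
      using e src_rv tgt_rv by auto
    consider "g \<in> set A" | "g \<in> set B" | "g \<in> set D" using g by auto
    then show ?thesis
    proof cases
      case 1
      then obtain A1 A2 where "A = A1 @ A2" "path v A1 (tgt e)" "path (tgt e) A2 (src e)"
        using path_split_src[OF pA 1] path_split_tgt[OF pA 1] ends by metis
      then show ?thesis using * [of "A1 @ B @ A2 @ D"] pB pD by (auto intro!: path_appendI)
    next
      case 2
      then obtain B1 B2 where "B = B1 @ B2" "path (tgt e) B1 (src e)" "path (src e) B2 (tgt e)"
        using path_split_src[OF pB 2] path_split_tgt[OF pB 2] ends by metis
      then show ?thesis using * [of "A @ B2 @ B1 @ D"] pA pD by (auto intro!: path_appendI)
    next
      case 3
      then obtain D1 D2 where "D = D1 @ D2" "path (src e) D1 (tgt e)" "path (tgt e) D2 v"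
        using path_split_src[OF pD 3] path_split_tgt[OF pD 3] ends by metis
      then show ?thesis using * [of "A @ D1 @ B @ D2"] pA pB by (auto intro!: path_appendI)
    qed
  qed (use less.prems in blast)
qed

section \<open>Closed paths through prescribed vertices\<close>

text \<open>The arcs that are not bridges: a closed path crosses a bridge equally often in both
  directions.\<close>

definition cyclic_edges :: "'e set" where
  "cyclic_edges = {e \<in> X. \<exists>v P. path v P v \<and> flow P e \<noteq> 0}"

text \<open>A turn splits P into two shorter closed paths whose flows add up to that of P, and one
  of them keeps a nonzero flow at e. The base point may change.\<close>

lemma closed_no_turn_through:
  assumes "path v P v" "flow P e \<noteq> 0" "e \<in> X"
  shows "\<exists>u Q. path u Q u \<and> no_turn Q \<and> flow Q e \<noteq> 0"
  using assms(1,2)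
proof (induction "length P" arbitrary: v P rule: less_induct)
  case less
  note X = path_in_X[OF less.prems(1)]
  show ?case
  proof (cases "no_turn P")
    case False
    obtain A f B D where P: "P = A @ f # B @ rv f # D" and f: "f \<in> X"
      using turn_decomp[OF False X] by blast
    have pB: "path (tgt f) B (tgt f)" and pAD: "path v (A @ D) v"
      using less.prems(1) P f by (auto simp: path_append src_rv tgt_rv)
    have "flow P e = flow B e + flow (A @ D) e + flow [f, rv f] e"
      by (simp add: P flow_def)
    then have "flow B e \<noteq> 0 \<or> flow (A @ D) e \<noteq> 0"
      using less.prems(2) flow_cancel_pair[OF f assms(3)] by auto
    then show ?thesis
      using less.hyps[of B, OF _ pB] less.hyps[of "A @ D", OF _ pAD] P by fastforce
  qed (use less.prems in blast)
qed

lemma path_power: "path u C u \<Longrightarrow> path u (concat (replicate k C)) u"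
  by (induction k) (auto intro: path_appendI)

lemma flow_power: "flow (concat (replicate k C)) e = int k * flow C e"
  by (induction k) (auto simp: algebra_simps)

definition visits :: "'v \<Rightarrow> 'e list \<Rightarrow> 'v set" where
  "visits v P = insert v (src ` set P \<union> tgt ` set P)"

lemma path_split_visit:
  assumes "path v P w" "u \<in> visits v P"
  obtains P1 P2 where "P = P1 @ P2" "path v P1 u" "path u P2 w"
proof -
  consider "u = v" | e where "e \<in> set P" "u = src e" | e where "e \<in> set P" "u = tgt e"
    using assms(2) by (auto simp: visits_def)
  then show thesis
  proof cases
    case 1
    then show ?thesis using that[of "[]" P] assms(1) by simp
  next
    case 2
    then show ?thesis using path_split_src[OF assms(1)] that by metis
  next
    case 3
    then show ?thesis using path_split_tgt[OF assms(1)] that by metis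
  qed
qed

text \<open>A path with nonzero flow at an arc crosses that edge in some direction and thus visits
  both of its ends. Hence visits survive every change of the path that keeps the flow.\<close>

lemma visits_subset_of_flow:
  assumes "full P" "set P \<subseteq> X" "\<And>f. f \<in> set P \<Longrightarrow> flow Q f \<noteq> 0"
  shows "visits v P \<subseteq> visits v Q"
proof -
  have "src e \<in> visits v Q \<and> tgt e \<in> visits v Q" if "e \<in> set P" for e
  proof -
    have "e \<in> set Q \<or> rv e \<in> set Q" using flow_nonzeroD assms(3) that by blast
    moreover have "e \<in> X" using assms that by auto
    ultimately show ?thesis unfolding visits_def using src_rv tgt_rv
      by (metis UnI1 UnI2 image_eqI insertCI)
  qed
  then show ?thesis by (auto simp: visits_def)
qed

text \<open>Inserting a high power of a closed path through \<open>e\<close> makes its edges dominate the old flow.\<close>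

lemma full_extend:
  assumes P: "path v P v" "full P" "src e \<in> visits v P" and e: "e \<in> cyclic_edges"
  shows "\<exists>Q. path v Q v \<and> full Q \<and> visits v P \<subseteq> visits v Q \<and> tgt e \<in> visits v Q"
proof -
  note PX = path_in_X[OF P(1)]
  have eX: "e \<in> X" using e by (simp add: cyclic_edges_def)
  obtain u C where C: "path u C u" "no_turn C" "flow C e \<noteq> 0"
    using e closed_no_turn_through[OF _ _ eX] unfolding cyclic_edges_def by blast
  have "e \<in> set C \<or> rv e \<in> set C" using flow_nonzeroD C(3) by blast
  then have "src e \<in> visits u C" unfolding visits_def using src_rv tgt_rv eX
      by (metis UnI1 UnI2 image_eqI insertCI)
  then obtain C1 C2 where C12: "C = C1 @ C2" "path u C1 (src e)" "path (src e) C2 u"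
    using path_split_visit[OF C(1)] by blast
  define D where "D = C2 @ C1"
  have D: "path (src e) D (src e)" using C12 path_appendI by (auto simp: D_def)
  have flD: "flow D f = flow C f" for f by (simp add: D_def C12)
  have "full D" using no_turn_full[OF C(2)] by (auto simp: full_def D_def C12 add.commute)
  obtain P1 P2 where P12: "P = P1 @ P2" "path v P1 (src e)" "path (src e) P2 v"
    using path_split_visit[OF P(1,3)] by blast
  define M where "M = Suc (length P)"
  define Q where "Q = P1 @ concat (replicate M D) @ P2"
  have Q: "path v Q v" using P12 path_power[OF D] by (auto simp: Q_def intro!: path_appendI)
  have flQ: "flow Q f = flow P f + int M * flow D f" for f
    by (simp add: Q_def P12 flow_power)
  have big: "flow Q f \<noteq> 0" if "flow D f \<noteq> 0" for f
  proof -
    have "int M \<le> \<bar>int M * flow D f\<bar>" using that mult_left_mono[of 1 "\<bar>flow D f\<bar>" "int M"] by (simp add: abs_mult)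
    moreover have "\<bar>flow P f\<bar> < int M" using abs_flow_le[of P f] by (simp add: M_def)
    ultimately show ?thesis unfolding flQ by linarith
  qed
  \<comment> \<open>Where D has no flow, Q has the flow of P, which is nonzero on P.\<close>
  have small: "flow Q f \<noteq> 0" if "f \<in> set P" for f
    using big[of f] flQ[of f] P(2) that by (cases "flow D f = 0") (auto simp: full_def)
  have "set Q \<subseteq> set P \<union> set D" by (auto simp: Q_def P12)
  then have fQ: "full Q" using big small \<open>full D\<close> by (auto simp: full_def)
  have "visits v P \<subseteq> visits v Q" using visits_subset_of_flow[OF P(2) PX small] .
  moreover have "flow Q e \<noteq> 0" using big flD C(3) by simp
  then have "tgt e \<in> visits v Q"
    using flow_nonzeroD[of Q e] src_rv tgt_rv eX unfolding visits_def
      by (metis UnI1 UnI2 image_eqI insertCI)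
  ultimately show ?thesis using Q fQ by blast
qed

definition cyc_conn :: "('v \<times> 'v) set" where
  "cyc_conn = {(src e, tgt e) | e. e \<in> cyclic_edges}\<^sup>*"

lemma cyclic_edges_rv:
  assumes "e \<in> cyclic_edges"
  shows "rv e \<in> cyclic_edges"
proof -
  obtain v P where "e \<in> X" "path v P v" "flow P e \<noteq> 0"
    using assms by (auto simp: cyclic_edges_def)
  moreover from this have "flow P (rv e) \<noteq> 0" by (simp add: flow_rv)
  ultimately show ?thesis using rv_in by (auto simp: cyclic_edges_def)
qed

lemma sym_cyc_conn: "sym cyc_conn"
  unfolding cyc_conn_def
proof (rule sym_rtrancl, rule symI)
  fix a b assume "(a, b) \<in> {(src e, tgt e) | e. e \<in> cyclic_edges}"
  then obtain e where e: "a = src e" "b = tgt e" "e \<in> cyclic_edges" by auto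
  then have "e \<in> X" by (simp add: cyclic_edges_def)
  then have "(b, a) = (src (rv e), tgt (rv e))" by (simp add: e(1,2) src_rv tgt_rv)
  then show "(b, a) \<in> {(src e, tgt e) | e. e \<in> cyclic_edges}"
    using cyclic_edges_rv[OF e(3)] by blast
qed

lemma trans_cyc_conn: "trans cyc_conn"
  unfolding cyc_conn_def by (rule trans_rtrancl)

lemma full_visit:
  assumes P: "path v P v" "full P" and z: "(v, z) \<in> cyc_conn"
  shows "\<exists>Q. path v Q v \<and> full Q \<and> visits v P \<subseteq> visits v Q \<and> z \<in> visits v Q"
  using z unfolding cyc_conn_def
proof (induction rule: rtrancl_induct)
  case base
  then show ?case using P by (auto simp: visits_def)
next
  case (step y z)
  then obtain Q e where "path v Q v" "full Q" "visits v P \<subseteq> visits v Q" "y \<in> visits v Q"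
    "e \<in> cyclic_edges" "y = src e" "z = tgt e" by auto
  then show ?case using full_extend[of v Q e] by (meson order_trans)
qed

text \<open>The vertices of Z are collected one at a time by full paths. Only the last of these is
  replaced by a path without turns, which has the same flow and therefore misses none of the
  vertices.\<close>

theorem no_turn_closed_path_visiting:
  assumes "finite Z" "\<And>z. z \<in> Z \<Longrightarrow> (v, z) \<in> cyc_conn"
  shows "\<exists>P. path v P v \<and> no_turn P \<and> Z \<subseteq> visits v P"
proof -
  have "\<exists>P. path v P v \<and> full P \<and> Z \<subseteq> visits v P"
    using assms
  proof (induction Z rule: finite_induct)
    case empty
    then show ?case by (intro exI[of _ "[]"]) (auto simp: full_def)
  next
    case (insert z Z)
    then obtain P where "path v P v" "full P" "Z \<subseteq> visits v P" by auto
    then show ?case using full_visit[of v P z] insert.prems by (metis insertI1 insert_subset order_trans)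
  qed
  then obtain P where P: "path v P v" "full P" "Z \<subseteq> visits v P" by blast
  obtain Q where Q: "path v Q v" "no_turn Q" "\<forall>f \<in> X. flow Q f = flow P f"
    using full_imp_no_turn[OF P(1,2)] by blast
  note PX = path_in_X[OF P(1)]
  have "flow Q f \<noteq> 0" if "f \<in> set P" for f using that Q(3) PX P(2) by (auto simp: full_def)
  then have "visits v P \<subseteq> visits v Q" using visits_subset_of_flow[OF P(2) PX] by blast
  then show ?thesis using Q P(3) by blast
qed

end

section \<open>Cayley graphs of marked groups\<close>

definition word_inv :: "('s \<times> bool) list \<Rightarrow> ('s \<times> bool) list" where
  "word_inv w = rev (map inv_letter w)"

lemma length_word_inv [simp]: "length (word_inv w) = length w"
  by (simp add: word_inv_def)

lemma word_inv_simps [simp]: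
  "word_inv [] = []" "word_inv (l # w) = word_inv w @ [inv_letter l]"
  "word_inv (u @ v) = word_inv v @ word_inv u" "word_inv (word_inv w) = w"
  by (simp_all add: word_inv_def rev_map[symmetric] comp_def)

text \<open>Words are over an index set and not over the group, so that one word can be evaluated in
  the groups Sol(m, n) of all levels.\<close>

locale marked_group = group G for G (structure) +
  fixes S :: "'s set" and gen :: "'s \<Rightarrow> 'a"
  assumes gen_closed: "s \<in> S \<Longrightarrow> gen s \<in> carrier G"
begin

definition letters :: "('s \<times> bool) set" where
  "letters = {l. fst l \<in> S}"

definition words :: "('s \<times> bool) list set" where
  "words = lists letters"

definition lv :: "'s \<times> bool \<Rightarrow> 'a" where
  "lv l = (if snd l then gen (fst l) else inv (gen (fst l)))"

fun ev :: "('s \<times> bool) list \<Rightarrow> 'a" where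
  "ev [] = \<one>"
| "ev (l # w) = lv l \<otimes> ev w"

lemma words_simps [simp]:
  "[] \<in> words" "l # w \<in> words \<longleftrightarrow> l \<in> letters \<and> w \<in> words"
  "u @ v \<in> words \<longleftrightarrow> u \<in> words \<and> v \<in> words"
  by (auto simp: words_def)

lemma words_iff: "w \<in> words \<longleftrightarrow> fst ` set w \<subseteq> S"
  by (auto simp: words_def letters_def)

lemma inv_letter_letters [simp]: "inv_letter l \<in> letters \<longleftrightarrow> l \<in> letters"
  by (simp add: letters_def)

lemma word_inv_words [simp]: "word_inv w \<in> words \<longleftrightarrow> w \<in> words"
  by (induction w) auto

lemma lv_closed [simp]: "l \<in> letters \<Longrightarrow> lv l \<in> carrier G"
  by (auto simp: lv_def letters_def gen_closed)

lemma lv_inv_letter: "l \<in> letters \<Longrightarrow> lv (inv_letter l) = inv (lv l)"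
  by (auto simp: lv_def letters_def inv_letter_def gen_closed)

lemma ev_closed [simp]: "w \<in> words \<Longrightarrow> ev w \<in> carrier G"
  by (induction w) auto

lemma ev_append: "u \<in> words \<Longrightarrow> v \<in> words \<Longrightarrow> ev (u @ v) = ev u \<otimes> ev v"
  by (induction u) (auto simp: m_assoc)

lemma ev_word_inv: "w \<in> words \<Longrightarrow> ev (word_inv w) = inv (ev w)"
  by (induction w) (auto simp: ev_append lv_inv_letter inv_mult_group)

section \<open>The Cayley graph and its flows\<close>

text \<open>The formal letter is part of the arc. Thus an arc differs from its reversal even where
  the letter has trivial value, and Sol(m, 0) yields a bouquet of m loops.\<close>

definition arcs :: "('a \<times> ('s \<times> bool)) set" where
  "arcs = carrier G \<times> letters"

definition head :: "'a \<times> ('s \<times> bool) \<Rightarrow> 'a" where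
  "head e = fst e \<otimes> lv (snd e)"

definition flip :: "'a \<times> ('s \<times> bool) \<Rightarrow> 'a \<times> ('s \<times> bool)" where
  "flip e = (head e, inv_letter (snd e))"

lemma head_pair [simp]: "head (g, l) = g \<otimes> lv l"
  by (simp add: head_def)

lemma flip_pair [simp]: "flip (g, l) = (g \<otimes> lv l, inv_letter l)"
  by (simp add: flip_def)

lemma arcs_pair [simp]: "(g, l) \<in> arcs \<longleftrightarrow> g \<in> carrier G \<and> l \<in> letters"
  by (auto simp: arcs_def)

sublocale graph_with_reversal fst head flip arcs
proof
  fix e assume e: "e \<in> arcs"
  then obtain g l where gl: "e = (g, l)" "g \<in> carrier G" "l \<in> letters" by (auto simp: arcs_def)
  then show "flip (flip e) = e" by (simp add: lv_inv_letter m_assoc)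
  show "flip e \<noteq> e" using gl by auto
  show "fst (flip e) = head e" by (simp add: flip_def)
  show "flip e \<in> arcs" using gl by simp
qed

fun walk :: "'a \<Rightarrow> ('s \<times> bool) list \<Rightarrow> ('a \<times> ('s \<times> bool)) list" where
  "walk g [] = []"
| "walk g (l # w) = (g, l) # walk (g \<otimes> lv l) w"

lemma length_walk [simp]: "length (walk g w) = length w"
  by (induction w arbitrary: g) auto

lemma map_snd_walk [simp]: "map snd (walk g w) = w"
  by (induction w arbitrary: g) auto

lemma walk_eq_Nil [simp]: "walk g w = [] \<longleftrightarrow> w = []"
  by (cases w) auto

lemma walk_append:
  "g \<in> carrier G \<Longrightarrow> u \<in> words \<Longrightarrow> v \<in> words \<Longrightarrow> walk g (u @ v) = walk g u @ walk (g \<otimes> ev u) v"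
  by (induction u arbitrary: g) (auto simp: m_assoc)

lemma path_walk: "g \<in> carrier G \<Longrightarrow> w \<in> words \<Longrightarrow> path g (walk g w) (g \<otimes> ev w)"
  by (induction w arbitrary: g) (auto simp: m_assoc[symmetric])

lemma walk_arcs: "g \<in> carrier G \<Longrightarrow> w \<in> words \<Longrightarrow> set (walk g w) \<subseteq> arcs"
  using path_in_X path_walk by blast

lemma path_is_walk:
  assumes "path g P h" "g \<in> carrier G"
  shows "P = walk g (map snd P)" "map snd P \<in> words" "h = g \<otimes> ev (map snd P)"
proof -
  have "P = walk g (map snd P) \<and> map snd P \<in> words \<and> h = g \<otimes> ev (map snd P)"
    using assms
  proof (induction P arbitrary: g)
    case (Cons e P)
    obtain x l where "e = (x, l)" by (cases e)
    then show ?case using Cons by (fastforce simp: m_assoc)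
  qed simp
  then show "P = walk g (map snd P)" "map snd P \<in> words" "h = g \<otimes> ev (map snd P)" by auto
qed

lemma reduced_walk:
  "reduced (walk g w) \<longleftrightarrow> freely_reduced w"
proof (induction w arbitrary: g)
  case (Cons l w)
  then show ?case by (cases w) (auto simp: reduced_def freely_reduced_def)
qed (simp add: reduced_def)

text \<open>Left multiplication is an automorphism of the labelled Cayley graph.\<close>

lemma count_walk_translate:
  assumes "x \<in> carrier G" "g \<in> carrier G" "h \<in> carrier G" "w \<in> words"
  shows "count_list (walk (x \<otimes> g) w) (x \<otimes> h, l) = count_list (walk g w) (h, l)"
  using assms(2,4)
proof (induction w arbitrary: g)
  case (Cons a w)
  then have "count_list (walk (x \<otimes> (g \<otimes> lv a)) w) (x \<otimes> h, l) = count_list (walk (g \<otimes> lv a) w) (h, l)"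
    using Cons.IH[of "g \<otimes> lv a"] by auto
  then show ?case using Cons.prems assms by (auto simp: m_assoc)
qed simp

lemma flow_walk_translate:
  assumes "x \<in> carrier G" "g \<in> carrier G" "h \<in> carrier G" "w \<in> words" "l \<in> letters"
  shows "flow (walk (x \<otimes> g) w) (x \<otimes> h, l) = flow (walk g w) (h, l)"
  using assms count_walk_translate[OF assms(1-4)]
    count_walk_translate[OF assms(1,2) _ assms(4), of "h \<otimes> lv l"]
  by (simp add: flow_def m_assoc)

lemma flow_walk_from:
  assumes "g \<in> carrier G" "h \<in> carrier G" "w \<in> words" "l \<in> letters"
  shows "flow (walk g w) (h, l) = flow (walk \<one> w) (inv g \<otimes> h, l)"
  using flow_walk_translate[of g \<one> "inv g \<otimes> h" w l] assms
  by (simp add: m_assoc[symmetric])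

lemma flow_cons_reduce:
  assumes "g \<in> carrier G" "l \<in> letters" "w \<in> words" "e \<in> arcs"
  shows "flow (walk g (cons_reduce l w)) e = flow (walk g (l # w)) e"
proof (cases w)
  case (Cons a w')
  show ?thesis
  proof (cases "a = inv_letter l")
    case True
    have "g \<otimes> lv l \<otimes> lv a = g" using assms True by (simp add: lv_inv_letter m_assoc)
    then have "walk g (l # w) = [(g, l), flip (g, l)] @ walk g w'" using Cons True by simp
    then have "flow (walk g (l # w)) e = flow [(g, l), flip (g, l)] e + flow (walk g w') e"
      by (metis flow_append)
    then show ?thesis using Cons True flow_cancel_pair[OF _ assms(4), of "(g, l)"] assms by simp
  qed (simp add: Cons)
qed simp

lemma cons_reduce_words: "l \<in> letters \<Longrightarrow> w \<in> words \<Longrightarrow> cons_reduce l w \<in> words"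
  by (cases w) auto

lemma reduce_word_words: "w \<in> words \<Longrightarrow> reduce_word w \<in> words"
  unfolding reduce_word_def by (induction w) (auto simp: cons_reduce_words)

lemma ev_cons_reduce: "l \<in> letters \<Longrightarrow> w \<in> words \<Longrightarrow> ev (cons_reduce l w) = ev (l # w)"
  by (cases w) (auto simp: lv_inv_letter m_assoc[symmetric])

lemma ev_reduce_word: "w \<in> words \<Longrightarrow> ev (reduce_word w) = ev w"
proof (induction w)
  case (Cons l w)
  then have "reduce_word w \<in> words" using reduce_word_words by auto
  then show ?case using Cons by (simp add: reduce_word_def ev_cons_reduce)
qed (simp add: reduce_word_def)

text \<open>Every cancellation removes an arc followed by its reversal, so the flow is an invariant
  of the element of the free group.\<close>

lemma flow_reduce_word:
  assumes "g \<in> carrier G" "w \<in> words" "e \<in> arcs"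
  shows "flow (walk g (reduce_word w)) e = flow (walk g w) e"
  using assms(1,2)
proof (induction w arbitrary: g)
  case (Cons l w)
  then have w: "reduce_word w \<in> words" "l \<in> letters" "w \<in> words" using reduce_word_words by auto
  have "flow (walk g (reduce_word (l # w))) e = flow (walk g (l # reduce_word w)) e"
    using flow_cons_reduce[OF Cons.prems(1) w(2,1) assms(3)] by (simp add: reduce_word_def)
  also have "\<dots> = flow [(g, l)] e + flow (walk (g \<otimes> lv l) (reduce_word w)) e"
    by (metis flow_append append_Cons append_Nil walk.simps(2))
  also have "\<dots> = flow [(g, l)] e + flow (walk (g \<otimes> lv l) w) e"
    using Cons w by simp
  also have "\<dots> = flow (walk g (l # w)) e"
    by (metis flow_append append_Cons append_Nil walk.simps(2))
  finally show ?case .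
qed (simp add: reduce_word_def)

lemma length_reduce_word: "length (reduce_word w) \<le> length w"
proof (induction w)
  case (Cons l w)
  have "length (cons_reduce l v) \<le> Suc (length v)" for v by (cases v) auto
  from this[of "reduce_word w"] show ?case using Cons by (simp add: reduce_word_def)
qed (simp add: reduce_word_def)

lemma freely_reduced_reduce_word: "freely_reduced (reduce_word w)"
  unfolding reduce_word_def by (rule freely_reduced_foldr) simp

lemma walk_word_inv:
  assumes "g \<in> carrier G" "w \<in> words"
  shows "walk (g \<otimes> ev w) (word_inv w) = rev_path (walk g w)"
  using assms
proof (induction w arbitrary: g)
  case (Cons l w)
  then have c: "lv l \<in> carrier G" "ev w \<in> carrier G" "w \<in> words" "l \<in> letters" by auto
  have "walk (g \<otimes> ev (l # w)) (word_inv (l # w)) =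
      walk (g \<otimes> lv l \<otimes> ev w) (word_inv w) @ walk (g \<otimes> lv l \<otimes> ev w \<otimes> inv (ev w)) [inv_letter l]"
    using c Cons.prems by (simp add: walk_append ev_word_inv m_assoc)
  also have "g \<otimes> lv l \<otimes> ev w \<otimes> inv (ev w) = g \<otimes> lv l"
    using c Cons.prems by (simp add: m_assoc)
  finally show ?case using c Cons by (simp add: rev_path_def)
qed (simp add: rev_path_def)

lemma flow_rev_path:
  assumes "set P \<subseteq> arcs" "e \<in> arcs"
  shows "flow (rev_path P) e = - flow P e"
proof -
  have *: "count_list (rev_path P) e = count_list P (flip e)" if "e \<in> arcs" for e
    using assms(1)
  proof (induction P)
    case (Cons f P)
    have "flip f = e \<longleftrightarrow> f = flip e" using Cons.prems that rv_rv by (metis list.set_intros(1) subsetD)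
    then show ?case using Cons by (simp add: rev_path_def)
  qed (simp add: rev_path_def)
  show ?thesis
    using *[OF assms(2)] *[OF rv_in[OF assms(2)]] by (simp only: flow_def rv_rv[OF assms(2)])
qed

lemma flow_word_inv:
  assumes "g \<in> carrier G" "w \<in> words" "e \<in> arcs"
  shows "flow (walk (g \<otimes> ev w) (word_inv w)) e = - flow (walk g w) e"
  using assms flow_rev_path walk_arcs by (simp add: walk_word_inv)

section \<open>Word length and strict dead ends\<close>

text \<open>A lower bound on distance from the identity, quantified over all words so that it
  follows directly from invariants of words such as exponent sums and flows.\<close>

definition far :: "nat \<Rightarrow> 'a \<Rightarrow> bool" where
  "far D g \<longleftrightarrow> (\<forall>w \<in> words. ev w = g \<longrightarrow> D \<le> length w)"

lemma far_mono: "far D g \<Longrightarrow> D' \<le> D \<Longrightarrow> far D' g"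
  by (auto simp: far_def intro: order_trans)

lemma far_step:
  assumes "far D g" "g \<in> carrier G" "w \<in> words"
  shows "far (D - length w) (g \<otimes> ev w)"
  unfolding far_def
proof (intro ballI impI)
  fix v assume v: "v \<in> words" "ev v = g \<otimes> ev w"
  then have "ev (v @ word_inv w) = g" using assms by (simp add: ev_append ev_word_inv m_assoc)
  then have "D \<le> length (v @ word_inv w)" using assms v unfolding far_def
    by (metis words_simps(3) word_inv_words)
  then show "D - length w \<le> length v" by simp
qed

text \<open>Here the factor is on the left: it moves the centre of the ball and not the point. This
  is how paths around a ball are carried to other places.\<close>

lemma far_translate:
  assumes "far D g" "g \<in> carrier G" "w \<in> words"
  shows "far (D - length w) (ev w \<otimes> g)"
  unfolding far_def
proof (intro ballI impI)
  fix v assume v: "v \<in> words" "ev v = ev w \<otimes> g"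
  then have "ev (word_inv w @ v) = g" using assms by (simp add: ev_append ev_word_inv m_assoc[symmetric])
  then have "D \<le> length (word_inv w @ v)" using assms v unfolding far_def
    by (metis words_simps(3) word_inv_words)
  then show "D - length w \<le> length v" by simp
qed

lemma lv_image: "lv ` letters = gen ` S \<union> m_inv G ` gen ` S"
proof
  show "lv ` letters \<subseteq> gen ` S \<union> m_inv G ` gen ` S" by (auto simp: lv_def letters_def)
  have "gen s = lv (s, True)" "inv (gen s) = lv (s, False)" for s by (auto simp: lv_def)
  then show "gen ` S \<union> m_inv G ` gen ` S \<subseteq> lv ` letters"
    by (auto simp: letters_def)
qed

lemma cayley_edges_power:
  assumes "g \<in> carrier G"
  shows "(g, h) \<in> cayley_edges G (gen ` S) ^^ n \<longleftrightarrow> (\<exists>w \<in> words. length w = n \<and> h = g \<otimes> ev w)"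
  using assms
proof (induction n arbitrary: g)
  case 0
  then show ?case by auto
next
  case (Suc n)
  have step: "(g, x) \<in> cayley_edges G (gen ` S) \<longleftrightarrow> (\<exists>l \<in> letters. x = g \<otimes> lv l)" for x
    using Suc.prems unfolding cayley_edges_def lv_image[symmetric] by auto
  have "(g, h) \<in> cayley_edges G (gen ` S) ^^ Suc n \<longleftrightarrow>
      (\<exists>l \<in> letters. (g \<otimes> lv l, h) \<in> cayley_edges G (gen ` S) ^^ n)"
  proof
    assume "(g, h) \<in> cayley_edges G (gen ` S) ^^ Suc n"
    then obtain x where "(g, x) \<in> cayley_edges G (gen ` S)" "(x, h) \<in> cayley_edges G (gen ` S) ^^ n"
      using relpow_Suc_D2 by metis
    then show "\<exists>l \<in> letters. (g \<otimes> lv l, h) \<in> cayley_edges G (gen ` S) ^^ n"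
      using step by metis
  next
    assume "\<exists>l \<in> letters. (g \<otimes> lv l, h) \<in> cayley_edges G (gen ` S) ^^ n"
    then obtain l where "l \<in> letters" "(g \<otimes> lv l, h) \<in> cayley_edges G (gen ` S) ^^ n" by blast
    then show "(g, h) \<in> cayley_edges G (gen ` S) ^^ Suc n"
      using step relpow_Suc_I2 by metis
  qed
  also have "\<dots> \<longleftrightarrow> (\<exists>l \<in> letters. \<exists>w \<in> words. length w = n \<and> h = g \<otimes> ev (l # w))"
  proof -
    have "(g \<otimes> lv l, h) \<in> cayley_edges G (gen ` S) ^^ n \<longleftrightarrow>
        (\<exists>w \<in> words. length w = n \<and> h = g \<otimes> ev (l # w))" if "l \<in> letters" for l
    proof -
      have "g \<otimes> lv l \<otimes> ev w = g \<otimes> ev (l # w)" if "w \<in> words" for w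
        using that \<open>l \<in> letters\<close> Suc.prems by (simp add: m_assoc)
      then show ?thesis using Suc.IH[of "g \<otimes> lv l"] that Suc.prems by (metis lv_closed m_closed)
    qed
    then show ?thesis by metis
  qed
  also have "\<dots> \<longleftrightarrow> (\<exists>w \<in> words. length w = Suc n \<and> h = g \<otimes> ev w)"
  proof
    assume "\<exists>w \<in> words. length w = Suc n \<and> h = g \<otimes> ev w"
    then obtain w where w: "w \<in> words" "length w = Suc n" "h = g \<otimes> ev w" by blast
    then obtain l v where "w = l # v" by (cases w) auto
    then show "\<exists>l \<in> letters. \<exists>w \<in> words. length w = n \<and> h = g \<otimes> ev (l # w)"
      using w by auto
  next
    assume "\<exists>l \<in> letters. \<exists>w \<in> words. length w = n \<and> h = g \<otimes> ev (l # w)"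
    then obtain l w where "l \<in> letters" "w \<in> words" "length w = n" "h = g \<otimes> ev (l # w)" by blast
    then show "\<exists>w \<in> words. length w = Suc n \<and> h = g \<otimes> ev w"
      by (intro bexI[of _ "l # w"]) auto
  qed
  finally show ?case .
qed

lemma word_length_eqI:
  assumes "u \<in> words" "length u = n" "far n (ev u)"
  shows "word_length G (gen ` S) (ev u) = n"
  unfolding word_length_def cayley_dist_def
proof (rule Least_equality)
  show "(ev u, \<one>) \<in> cayley_edges G (gen ` S) ^^ n"
    using assms by (auto simp: cayley_edges_power ev_word_inv intro!: bexI[of _ "word_inv u"])
  fix k assume "(ev u, \<one>) \<in> cayley_edges G (gen ` S) ^^ k"
  then obtain w where w: "w \<in> words" "length w = k" "\<one> = ev u \<otimes> ev w"
    using assms(1) by (auto simp: cayley_edges_power)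
  then have "ev (word_inv w) = ev u"
    using assms(1) by (metis ev_closed ev_word_inv inv_equality)
  then show "n \<le> k" using assms(3) w unfolding far_def by (metis length_word_inv word_inv_words)
qed

lemma strict_dead_endI:
  assumes g: "g \<in> carrier G"
    and dec: "\<And>w i. \<lbrakk>w \<in> words; freely_reduced w; length w = k; i < k\<rbrakk> \<Longrightarrow>
      word_length G (gen ` S) (g \<otimes> ev (take i w)) > word_length G (gen ` S) (g \<otimes> ev (take (Suc i) w))"
  shows "strict_dead_end G (gen ` S) k g"
  unfolding strict_dead_end_def
proof (intro conjI allI impI g)
  fix w :: "('a \<times> bool) list" and i
  assume w: "length w = k \<and> fst ` set w \<subseteq> gen ` S \<and> freely_reduced w" and i: "i < k"
  \<comment> \<open>A section of \<open>gen\<close> lifts words in the generators to words in the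
    indices. As \<open>gen\<close> undoes it, letters that are not formally inverse stay so.\<close>
  define f where "f l = (inv_into S gen (fst l), snd l)" for l :: "'a \<times> bool"
  have val: "word_value G v = ev (map f v)" if "fst ` set v \<subseteq> gen ` S" for v
    using that
  proof (induction v)
    case (Cons l v)
    then have "gen (inv_into S gen (fst l)) = fst l" by (auto intro: f_inv_into_f)
    then have "lv (f l) = letter_value G l" by (simp add: lv_def letter_value_def f_def)
    then show ?case using Cons by (simp add: word_value_def)
  qed (simp add: word_value_def)
  have "map f w \<in> words" using w by (auto simp: f_def words_iff image_image intro!: inv_into_into)
  moreover have "freely_reduced (map f w)"
  proof -
    have "successively (\<lambda>l l'. f l' \<noteq> inv_letter (f l)) w"
      unfolding successively_map[symmetric]
    proof (rule successively_mono)
      show "successively (\<lambda>l l'. l' \<noteq> inv_letter l) w" using w by (simp add: freely_reduced_def)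
      fix l l' assume l: "l \<in> set w" "l' \<in> set w" "l' \<noteq> inv_letter l"
      then have "gen (fst (f l)) = fst l" "gen (fst (f l')) = fst l'"
        using w by (auto simp: f_def intro!: f_inv_into_f)
      then show "f l' \<noteq> inv_letter (f l)"
        using l(3) by (auto simp: inv_letter_def prod_eq_iff f_def)
    qed
    then show ?thesis by (simp add: freely_reduced_def successively_map)
  qed
  ultimately have "word_length G (gen ` S) (g \<otimes> ev (take i (map f w))) >
      word_length G (gen ` S) (g \<otimes> ev (take (Suc i) (map f w)))"
    using dec w i by simp
  moreover have "fst ` set (take j w) \<subseteq> gen ` S" for j using w by (meson image_mono order_trans set_take_subset)
  ultimately show "word_length G (gen ` S) (g \<otimes> word_value G (take (Suc i) w))
      < word_length G (gen ` S) (g \<otimes> word_value G (take i w))"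
    using val by (simp add: take_map)
qed

end

section \<open>The derived series and flows\<close>

definition expsum :: "'s \<Rightarrow> ('s \<times> bool) list \<Rightarrow> int" where
  "expsum a w = int (count_list w (a, True)) - int (count_list w (a, False))"

lemma expsum_simps [simp]:
  "expsum a [] = 0" "expsum a (u @ v) = expsum a u + expsum a v"
  "expsum a (l # w) = (if fst l = a then (if snd l then 1 else -1) else 0) + expsum a w"
  by (auto simp: expsum_def prod_eq_iff)

lemma expsum_word_inv [simp]: "expsum a (word_inv w) = - expsum a w"
  by (induction w) (auto simp: inv_letter_def)

lemma abs_expsum_le: "\<bar>expsum a w\<bar> \<le> int (length w)"
  by (induction w) auto

lemma expsum_power: "expsum a (concat (replicate k w)) = int k * expsum a w"
  by (induction k) (auto simp: algebra_simps)

locale free_soluble =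
  fixes m :: nat
begin

abbreviation "F \<equiv> free_group {..<m}"
abbreviation "N \<equiv> derived_term F"
abbreviation "Sol \<equiv> free_soluble_group m"

definition sgen :: "nat \<Rightarrow> nat \<Rightarrow> (nat \<times> bool) list set" where
  "sgen n i = N n #>\<^bsub>F\<^esub> [(i, True)]"

lemma gens_eq: "free_soluble_gens m n = sgen n ` {..<m}"
  by (simp add: free_soluble_gens_def sgen_def image_def)

sublocale F: group F by (rule group_free_group)

lemma N_normal: "N n \<lhd> F" by (rule F.derived_term_normal)

lemma N_subgroup: "subgroup (N n) F" using N_normal normal_imp_subgroup by blast

sublocale L: marked_group "Sol n" "{..<m}" "sgen n" for n
proof (intro marked_group.intro marked_group_axioms.intro group_free_soluble_group)
  fix s assume "s \<in> {..<m}"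
  then have "[(s, True)] \<in> carrier F" by (simp add: free_group_def freely_reduced_def)
  then show "sgen n s \<in> carrier (Sol n)"
    by (simp add: sgen_def free_soluble_group_def carrier_FactGroup)
qed

abbreviation "W \<equiv> marked_group.words {..<m}"

lemma carrier_F: "carrier F = {w \<in> W. freely_reduced w}"
  using L.words_iff by (auto simp: free_group_def)

lemma reduce_word_carrier: "w \<in> W \<Longrightarrow> reduce_word w \<in> carrier F"
  using L.reduce_word_words L.freely_reduced_reduce_word carrier_F by blast

lemma mult_F: "x \<otimes>\<^bsub>F\<^esub> y = reduce_word (x @ y)"
  by (simp add: free_group_def)

lemma one_F: "\<one>\<^bsub>F\<^esub> = []"
  by (simp add: free_group_def)

lemma one_Sol: "\<one>\<^bsub>Sol n\<^esub> = N n"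
  by (simp add: free_soluble_group_def)

lemma mult_Sol: "x \<in> carrier F \<Longrightarrow> y \<in> carrier F \<Longrightarrow>
    (N n #>\<^bsub>F\<^esub> x) \<otimes>\<^bsub>Sol n\<^esub> (N n #>\<^bsub>F\<^esub> y) = N n #>\<^bsub>F\<^esub> (x \<otimes>\<^bsub>F\<^esub> y)"
  using normal.rcos_sum[OF N_normal] by (simp add: free_soluble_group_def)

lemma lv_Sol:
  assumes "l \<in> L.letters"
  shows "L.lv n l = N n #>\<^bsub>F\<^esub> [l]"
proof -
  have c: "[(fst l, b)] \<in> carrier F" for b
    using assms by (simp add: carrier_F L.letters_def freely_reduced_def)
  show ?thesis
  proof (cases "snd l")
    case True
    then show ?thesis by (simp add: L.lv_def sgen_def prod_eq_iff[symmetric]) (metis prod.collapse)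
  next
    case False
    have "[(fst l, False)] \<otimes>\<^bsub>F\<^esub> [(fst l, True)] = \<one>\<^bsub>F\<^esub>"
      by (simp add: mult_F one_F reduce_word_def inv_letter_def)
    then have "(N n #>\<^bsub>F\<^esub> [(fst l, False)]) \<otimes>\<^bsub>Sol n\<^esub> sgen n (fst l) = \<one>\<^bsub>Sol n\<^esub>"
      unfolding sgen_def using mult_Sol[OF c c] F.coset_join2[OF F.one_closed N_subgroup]
      by (simp add: one_Sol subgroup.one_closed[OF N_subgroup])
    moreover have "sgen n (fst l) \<in> carrier (Sol n)" using assms L.gen_closed by (simp add: L.letters_def)
    moreover have "N n #>\<^bsub>F\<^esub> [(fst l, False)] \<in> carrier (Sol n)"
      using c by (simp add: free_soluble_group_def carrier_FactGroup)
    ultimately have "inv\<^bsub>Sol n\<^esub> (sgen n (fst l)) = N n #>\<^bsub>F\<^esub> [(fst l, False)]"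
      using L.inv_equality by blast
    then show ?thesis using False by (simp add: L.lv_def) (metis prod.collapse)
  qed
qed

lemma ev_coset:
  assumes "w \<in> W"
  shows "L.ev n w = N n #>\<^bsub>F\<^esub> reduce_word w"
  using assms
proof (induction w)
  case Nil
  have "N n #>\<^bsub>F\<^esub> \<one>\<^bsub>F\<^esub> = N n"
    by (rule F.coset_join2[OF F.one_closed N_subgroup subgroup.one_closed[OF N_subgroup]])
  then show ?case by (simp add: one_Sol reduce_word_def one_F)
next
  case (Cons l w)
  then have c: "[l] \<in> carrier F" "reduce_word w \<in> carrier F"
    using reduce_word_carrier by (auto simp: carrier_F freely_reduced_def)
  have "L.ev n (l # w) = N n #>\<^bsub>F\<^esub> ([l] \<otimes>\<^bsub>F\<^esub> reduce_word w)"
    using Cons mult_Sol[OF c] by (simp add: lv_Sol)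
  also have "[l] \<otimes>\<^bsub>F\<^esub> reduce_word w = reduce_word (l # w)"
    using reduce_word_id[OF L.freely_reduced_reduce_word[of w]] by (simp add: mult_F reduce_word_def)
  finally show ?case .
qed

lemma ev_one_iff:
  assumes "w \<in> W"
  shows "L.ev n w = \<one>\<^bsub>Sol n\<^esub> \<longleftrightarrow> reduce_word w \<in> N n"
proof -
  have c: "reduce_word w \<in> carrier F" using assms by (rule reduce_word_carrier)
  have "N n #>\<^bsub>F\<^esub> reduce_word w = N n \<longleftrightarrow> reduce_word w \<in> N n"
    using F.coset_join1[OF _ c N_subgroup] F.coset_join2[OF c N_subgroup]
      subgroup.subset[OF N_subgroup] by blast
  then show ?thesis by (simp add: ev_coset[OF assms] one_Sol)
qed

lemma carrier_Sol: "carrier (Sol n) = L.ev n ` W"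
proof -
  have "N n #>\<^bsub>F\<^esub> x \<in> L.ev n ` W" if "x \<in> carrier F" for x
    using that ev_coset[of x n] reduce_word_id[of x] by (metis (no_types, lifting) carrier_F image_eqI mem_Collect_eq)
  then show ?thesis
    using L.ev_closed by (auto simp: free_soluble_group_def carrier_FactGroup)
qed

lemma ev_mult_F: "x \<in> carrier F \<Longrightarrow> y \<in> carrier F \<Longrightarrow> L.ev n (x \<otimes>\<^bsub>F\<^esub> y) = L.ev n x \<otimes>\<^bsub>Sol n\<^esub> L.ev n y"
  by (simp add: mult_F carrier_F L.ev_reduce_word L.ev_append)

lemma ev_inv_F:
  assumes "x \<in> carrier F"
  shows "L.ev n (inv\<^bsub>F\<^esub> x) = inv\<^bsub>Sol n\<^esub> (L.ev n x)"
proof -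
  have i: "inv\<^bsub>F\<^esub> x \<in> carrier F" using assms by simp
  have "L.ev n (inv\<^bsub>F\<^esub> x) \<otimes>\<^bsub>Sol n\<^esub> L.ev n x = \<one>\<^bsub>Sol n\<^esub>"
    using ev_mult_F[OF i assms, of n] assms by (simp add: one_F)
  then show ?thesis using assms i by (metis (no_types, lifting) L.ev_closed L.inv_equality carrier_F mem_Collect_eq)
qed

abbreviation "fl n w \<equiv> L.flow n (L.walk n \<one>\<^bsub>Sol n\<^esub> w)"

lemma flow_mult_F:
  assumes "x \<in> carrier F" "y \<in> carrier F" "L.ev n x = \<one>\<^bsub>Sol n\<^esub>" "e \<in> L.arcs n"
  shows "fl n (x \<otimes>\<^bsub>F\<^esub> y) e = fl n x e + fl n y e"
proof -
  have "fl n (x \<otimes>\<^bsub>F\<^esub> y) e = fl n (x @ y) e"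
    using assms by (simp add: mult_F carrier_F L.flow_reduce_word)
  also have "\<dots> = fl n x e + fl n y e"
    using assms by (simp add: carrier_F L.walk_append)
  finally show ?thesis .
qed

lemma flow_inv_F:
  assumes "x \<in> carrier F" "L.ev n x = \<one>\<^bsub>Sol n\<^esub>" "e \<in> L.arcs n"
  shows "fl n (inv\<^bsub>F\<^esub> x) e = - fl n x e"
proof -
  have "fl n (x \<otimes>\<^bsub>F\<^esub> inv\<^bsub>F\<^esub> x) e = fl n x e + fl n (inv\<^bsub>F\<^esub> x) e"
    using assms by (intro flow_mult_F) auto
  then show ?thesis using assms(1) by (simp add: one_F)
qed

text \<open>On \<open>N n\<close> the flow is a homomorphism to the 1-cycles of the Cayley graph of
  level n; this is its kernel.\<close>

definition flow_kernel :: "nat \<Rightarrow> (nat \<times> bool) list set" where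
  "flow_kernel n = {x \<in> carrier F. L.ev n x = \<one>\<^bsub>Sol n\<^esub> \<and> (\<forall>e \<in> L.arcs n. fl n x e = 0)}"

lemma subgroup_flow_kernel: "subgroup (flow_kernel n) F"
proof (rule F.subgroupI)
  show "flow_kernel n \<subseteq> carrier F" by (auto simp: flow_kernel_def)
  have "\<one>\<^bsub>F\<^esub> \<in> flow_kernel n" using F.one_closed by (simp add: flow_kernel_def one_F)
  then show "flow_kernel n \<noteq> {}" by blast
next
  fix x assume "x \<in> flow_kernel n"
  then show "inv\<^bsub>F\<^esub> x \<in> flow_kernel n"
    by (auto simp: flow_kernel_def ev_inv_F flow_inv_F)
next
  fix x y assume "x \<in> flow_kernel n" "y \<in> flow_kernel n"
  then show "x \<otimes>\<^bsub>F\<^esub> y \<in> flow_kernel n"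
    by (auto simp: flow_kernel_def ev_mult_F flow_mult_F)
qed

lemma N_Suc: "N (Suc n) = derived F (N n)"
  by (simp add: derived_term_def)

lemma N_ev:
  assumes "x \<in> N n"
  shows "x \<in> carrier F" "L.ev n x = \<one>\<^bsub>Sol n\<^esub>"
proof -
  show x: "x \<in> carrier F" using assms subgroup.subset[OF N_subgroup] by blast
  then have "x \<in> W" "reduce_word x = x" by (auto simp: carrier_F reduce_word_id)
  then show "L.ev n x = \<one>\<^bsub>Sol n\<^esub>" using ev_one_iff assms by simp
qed

text \<open>The flow homomorphism on \<open>N n\<close> has an abelian target and so vanishes on the
  commutators generating \<open>N (Suc n)\<close>.\<close>

lemma N_Suc_flow_kernel: "N (Suc n) \<subseteq> flow_kernel n"
  unfolding N_Suc derived_def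
proof (rule F.generate_subgroup_incl[OF _ subgroup_flow_kernel], safe)
  fix x y assume "x \<in> N n" "y \<in> N n"
  then have x: "x \<in> carrier F" "L.ev n x = \<one>\<^bsub>Sol n\<^esub>" and y: "y \<in> carrier F" "L.ev n y = \<one>\<^bsub>Sol n\<^esub>"
    using N_ev by auto
  then show "x \<otimes>\<^bsub>F\<^esub> y \<otimes>\<^bsub>F\<^esub> inv\<^bsub>F\<^esub> x \<otimes>\<^bsub>F\<^esub> inv\<^bsub>F\<^esub> y \<in> flow_kernel n"
    by (simp add: flow_kernel_def ev_mult_F ev_inv_F flow_mult_F flow_inv_F)
qed

theorem ev_Suc_one:
  assumes "w \<in> W" "L.ev (Suc n) w = \<one>\<^bsub>Sol (Suc n)\<^esub>"
  shows "L.ev n w = \<one>\<^bsub>Sol n\<^esub>" "e \<in> L.arcs n \<Longrightarrow> fl n w e = 0"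
proof -
  have "reduce_word w \<in> flow_kernel n" using assms ev_one_iff N_Suc_flow_kernel by blast
  then show "L.ev n w = \<one>\<^bsub>Sol n\<^esub>" "e \<in> L.arcs n \<Longrightarrow> fl n w e = 0"
    using assms(1) by (auto simp: flow_kernel_def L.ev_reduce_word L.flow_reduce_word)
qed

lemma ev_eq_iff: "u \<in> W \<Longrightarrow> v \<in> W \<Longrightarrow> L.ev n u = L.ev n v \<longleftrightarrow> L.ev n (u @ word_inv v) = \<one>\<^bsub>Sol n\<^esub>"
  by (metis L.ev_append L.ev_closed L.ev_word_inv L.inv_closed L.inv_equality L.inv_inv L.r_inv L.word_inv_words)

text \<open>The word u v^-1 is trivial on level n + 1, and its walk on level n is that of u followed
  by that of v backwards.\<close>

theorem ev_Suc_eq: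
  assumes "u \<in> W" "v \<in> W" "L.ev (Suc n) u = L.ev (Suc n) v"
  shows "L.ev n u = L.ev n v" "e \<in> L.arcs n \<Longrightarrow> fl n u e = fl n v e"
proof -
  have one: "L.ev (Suc n) (u @ word_inv v) = \<one>\<^bsub>Sol (Suc n)\<^esub>" using assms ev_eq_iff by blast
  have w: "u @ word_inv v \<in> W" using assms by simp
  show eq: "L.ev n u = L.ev n v" using ev_Suc_one(1)[OF w one] ev_eq_iff assms by blast
  assume e: "e \<in> L.arcs n"
  have "fl n (u @ word_inv v) e = fl n u e + L.flow n (L.walk n (L.ev n v) (word_inv v)) e"
    using assms eq by (simp add: L.walk_append)
  also have "L.flow n (L.walk n (L.ev n v) (word_inv v)) e = - fl n v e"
    using L.flow_word_inv[of "\<one>\<^bsub>Sol n\<^esub>" n v e] assms(2) e by simp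
  finally show "fl n u e = fl n v e" using ev_Suc_one(2)[OF w one e] by simp
qed

text \<open>Closed words of level n represent elements of \<open>N n\<close>, whose commutators lie
  in \<open>N (Suc n)\<close>.\<close>

theorem ev_Suc_commute:
  assumes "x \<in> W" "y \<in> W" "L.ev n x = \<one>\<^bsub>Sol n\<^esub>" "L.ev n y = \<one>\<^bsub>Sol n\<^esub>"
  shows "L.ev (Suc n) x \<otimes>\<^bsub>Sol (Suc n)\<^esub> L.ev (Suc n) y = L.ev (Suc n) y \<otimes>\<^bsub>Sol (Suc n)\<^esub> L.ev (Suc n) x"
proof -
  define x' y' where "x' = reduce_word x" and "y' = reduce_word y"
  have N: "x' \<in> N n" "y' \<in> N n" using assms ev_one_iff by (auto simp: x'_def y'_def)
  then have c: "x' \<in> carrier F" "y' \<in> carrier F" using N_ev by auto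
  have "x' \<otimes>\<^bsub>F\<^esub> y' \<otimes>\<^bsub>F\<^esub> inv\<^bsub>F\<^esub> x' \<otimes>\<^bsub>F\<^esub> inv\<^bsub>F\<^esub> y' \<in> N (Suc n)"
    unfolding N_Suc derived_def using N by (intro generate.incl) blast
  then have "L.ev (Suc n) (x' \<otimes>\<^bsub>F\<^esub> y' \<otimes>\<^bsub>F\<^esub> inv\<^bsub>F\<^esub> x' \<otimes>\<^bsub>F\<^esub> inv\<^bsub>F\<^esub> y') = \<one>\<^bsub>Sol (Suc n)\<^esub>"
    using N_ev by blast
  moreover have e: "L.ev (Suc n) x' = L.ev (Suc n) x" "L.ev (Suc n) y' = L.ev (Suc n) y"
    using assms by (simp_all add: x'_def y'_def L.ev_reduce_word)
  moreover have cc: "L.ev (Suc n) x \<in> carrier (Sol (Suc n))" "L.ev (Suc n) y \<in> carrier (Sol (Suc n))"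
    using assms by simp_all
  ultimately have "L.ev (Suc n) x \<otimes>\<^bsub>Sol (Suc n)\<^esub> L.ev (Suc n) y \<otimes>\<^bsub>Sol (Suc n)\<^esub> inv\<^bsub>Sol (Suc n)\<^esub> (L.ev (Suc n) x)
      \<otimes>\<^bsub>Sol (Suc n)\<^esub> inv\<^bsub>Sol (Suc n)\<^esub> (L.ev (Suc n) y) = \<one>\<^bsub>Sol (Suc n)\<^esub>"
    using c by (simp add: ev_mult_F ev_inv_F)
  then show ?thesis using cc
    by (metis L.inv_closed L.inv_equality L.inv_inv L.inv_solve_right' L.m_closed)
qed

section \<open>Exponent sums as flows, and lower bounds on length\<close>

lemma ev_0: "w \<in> W \<Longrightarrow> L.ev 0 w = \<one>\<^bsub>Sol 0\<^esub>"
  using ev_one_iff[of w 0] reduce_word_carrier by (simp add: derived_term_def)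

text \<open>On the bouquet of loops that is the Cayley graph of the trivial group, the flow through
  a loop counts the signed occurrences of its generator.\<close>

lemma fl_0: 
  assumes "w \<in> W" "a < m"
  shows "fl 0 w (\<one>\<^bsub>Sol 0\<^esub>, (a, True)) = expsum a w"
proof -
  have one: "g = \<one>\<^bsub>Sol 0\<^esub>" if "g \<in> carrier (Sol 0)" for g
    using that carrier_Sol ev_0 by auto
  have *: "count_list (L.walk 0 \<one>\<^bsub>Sol 0\<^esub> w) (\<one>\<^bsub>Sol 0\<^esub>, l) = count_list w l" for l
    using assms(1)
  proof (induction w)
    case (Cons k w)
    then have "\<one>\<^bsub>Sol 0\<^esub> \<otimes>\<^bsub>Sol 0\<^esub> L.lv 0 k = \<one>\<^bsub>Sol 0\<^esub>" by (intro one) simp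
    then show ?case using Cons by simp
  qed simp
  have "\<one>\<^bsub>Sol 0\<^esub> \<otimes>\<^bsub>Sol 0\<^esub> L.lv 0 (a, True) = \<one>\<^bsub>Sol 0\<^esub>"
    using assms(2) by (intro one) (simp add: L.letters_def)
  then show ?thesis by (simp add: L.flow_def * expsum_def inv_letter_def)
qed

lemma expsum_eq:
  assumes "u \<in> W" "v \<in> W" "L.ev (Suc n) u = L.ev (Suc n) v" "a < m"
  shows "expsum a u = expsum a v"
  using assms(3)
proof (induction n)
  case 0
  then show ?case using ev_Suc_eq(2)[OF assms(1,2) 0, of "(\<one>\<^bsub>Sol 0\<^esub>, (a, True))"] fl_0 assms
    by (simp add: L.letters_def)
next
  case (Suc n)
  then show ?case using ev_Suc_eq(1)[OF assms(1,2)] by blast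
qed

text \<open>An exponent sum is determined by the group element and bounded by the length of every
  word for it. In \<open>far_flow\<close> the flow at one arc plays the same part.\<close>

lemma far_expsum:
  assumes "u \<in> W" "a < m" "int D \<le> \<bar>expsum a u\<bar>"
  shows "L.far (Suc n) D (L.ev (Suc n) u)"
  unfolding L.far_def
proof (intro ballI impI)
  fix w assume w: "w \<in> W" "L.ev (Suc n) w = L.ev (Suc n) u"
  then have "expsum a w = expsum a u" using expsum_eq assms by blast
  then show "D \<le> length w" using abs_expsum_le[of a w] assms(3) by linarith
qed

lemma far_flow:
  assumes "u \<in> W" "e \<in> L.arcs n" "int D \<le> \<bar>fl n u e\<bar>"
  shows "L.far (Suc n) D (L.ev (Suc n) u)"
  unfolding L.far_def
proof (intro ballI impI)
  fix w assume w: "w \<in> W" "L.ev (Suc n) w = L.ev (Suc n) u"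
  then have "fl n w e = fl n u e" using ev_Suc_eq(2) assms by blast
  then show "D \<le> length w" using L.abs_flow_le[of n "L.walk n \<one>\<^bsub>Sol n\<^esub> w" e] assms(3) by simp
qed

end

section \<open>Girth\<close>

text \<open>Consecutive entries of a filtered list enclose only rejected entries in the original
  one. It is used to show that a path stays reduced when the arcs of a line are dropped.\<close>

lemma successively_filterI:
  assumes "\<And>A e B f D. \<lbrakk>xs = A @ e # B @ f # D; P e; P f; \<forall>x \<in> set B. \<not> P x\<rbrakk> \<Longrightarrow> R e f"
  shows "successively R (filter P xs)"
  using assms
proof (induction xs)
  case (Cons x xs)
  have IH: "successively R (filter P xs)"
  proof (rule Cons.IH)
    fix A e B f D assume "xs = A @ e # B @ f # D" "P e" "P f" "\<forall>x \<in> set B. \<not> P x"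
    then show "R e f" using Cons.prems[of "x # A" e B f D] by simp
  qed
  show ?case
  proof (cases "P x \<and> filter P xs \<noteq> []")
    case True
    then obtain f ys where f: "filter P xs = f # ys" by (cases "filter P xs") auto
    then obtain B D where "xs = B @ f # D" "\<forall>x \<in> set B. \<not> P x" "P f"
      by (auto simp: filter_eq_Cons_iff)
    then have "R x f" using Cons.prems[of "[]" x B f D] True by simp
    then show ?thesis using IH f True by (simp add: successively_Cons)
  qed (use IH in auto)
qed simp

lemma freely_reduced_one_generator:
  assumes "freely_reduced (l # w)" "fst ` set (l # w) \<subseteq> {a}"
  shows "set (l # w) = {l}"
  using assms
proof (induction w arbitrary: l)
  case (Cons k w)
  then have "set (k # w) = {k}" using freely_reduced_ConsD[of l "k # w"] by simp
  moreover have "k = l" using Cons.prems by (auto simp: freely_reduced_def inv_letter_def prod_eq_iff)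
  ultimately show ?case by simp
qed simp

lemma expsum_constant:
  assumes "set w \<subseteq> {l}"
  shows "expsum (fst l) w = (if snd l then int (length w) else - int (length w))"
  using assms by (induction w) auto

lemma expsum_one_generator:
  assumes "freely_reduced w" "fst ` set w \<subseteq> {a}" "w \<noteq> []"
  shows "expsum a w \<noteq> 0"
proof -
  obtain l v where w: "w = l # v" using assms(3) by (cases w) auto
  then have "set w = {l}" "fst l = a" using freely_reduced_one_generator[of l v a] assms by auto
  then show ?thesis using expsum_constant[of w l] assms(3) by auto
qed

context marked_group
begin

lemma mult_ev_eq_self: "g \<in> carrier G \<Longrightarrow> w \<in> words \<Longrightarrow> g \<otimes> ev w = g \<longleftrightarrow> ev w = \<one>"
  using l_cancel_one[of g "ev w"] by simp

lemma no_turn_walk_reduced: "no_turn (walk g w) \<Longrightarrow> freely_reduced w"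
proof -
  assume *: "no_turn (walk g w)"
  have "successively (\<lambda>e f. f \<noteq> flip e) P" if "\<forall>e \<in> set P. flip e \<notin> set P" for P
    using that
  proof (induction P)
    case (Cons e P)
    then show ?case by (cases P) auto
  qed simp
  then have "reduced (walk g w)" using * by (simp add: reduced_def no_turn_def)
  then show ?thesis by (simp add: reduced_walk)
qed

end

context free_soluble
begin

section \<open>Girth and excursions from a line\<close>

text \<open>The cyclic subgroup < a > of Sol(m, n).\<close>

definition line :: "nat \<Rightarrow> nat \<Rightarrow> (nat \<times> bool) list set set" where
  "line n a = L.ev n ` {w. fst ` set w \<subseteq> {a}}"

lemma one_generator_word: "a < m \<Longrightarrow> fst ` set w \<subseteq> {a} \<Longrightarrow> w \<in> W"
  using L.words_iff by blast

lemma line_closed: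
  assumes "a < m"
  shows "line n a \<subseteq> carrier (Sol n)"
    and "\<one>\<^bsub>Sol n\<^esub> \<in> line n a"
    and "x \<in> line n a \<Longrightarrow> y \<in> line n a \<Longrightarrow> x \<otimes>\<^bsub>Sol n\<^esub> y \<in> line n a"
    and "x \<in> line n a \<Longrightarrow> inv\<^bsub>Sol n\<^esub> x \<in> line n a"
proof -
  show "line n a \<subseteq> carrier (Sol n)" using one_generator_word[OF assms] by (auto simp: line_def)
  show "\<one>\<^bsub>Sol n\<^esub> \<in> line n a" unfolding line_def by (intro image_eqI[of _ _ "[]"]) auto
  show "x \<otimes>\<^bsub>Sol n\<^esub> y \<in> line n a" if xy: "x \<in> line n a" "y \<in> line n a"
  proof -
    obtain u v where "x = L.ev n u" "fst ` set u \<subseteq> {a}" "y = L.ev n v" "fst ` set v \<subseteq> {a}"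
      using xy by (auto simp: line_def)
    then show ?thesis unfolding line_def using one_generator_word[OF assms]
      by (intro image_eqI[of _ _ "u @ v"]) (auto simp: L.ev_append)
  qed
  show "inv\<^bsub>Sol n\<^esub> x \<in> line n a" if x: "x \<in> line n a"
  proof -
    obtain u where "x = L.ev n u" "fst ` set u \<subseteq> {a}" using x by (auto simp: line_def)
    then show ?thesis unfolding line_def using one_generator_word[OF assms]
      by (intro image_eqI[of _ _ "word_inv u"]) (simp_all add: L.ev_word_inv, simp add: word_inv_def image_image)
  qed
qed

lemma line_step:
  assumes "a < m" "g \<in> carrier (Sol n)" "fst l = a"
  shows "g \<otimes>\<^bsub>Sol n\<^esub> L.lv n l \<in> line n a \<longleftrightarrow> g \<in> line n a"
proof -
  have l: "l \<in> L.letters" using assms by (simp add: L.letters_def)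
  then have ll: "L.lv n l \<in> line n a" unfolding line_def using assms(3)
    by (intro image_eqI[of _ _ "[l]"]) auto
  have "g = g \<otimes>\<^bsub>Sol n\<^esub> L.lv n l \<otimes>\<^bsub>Sol n\<^esub> inv\<^bsub>Sol n\<^esub> (L.lv n l)"
    using l assms(2) by (simp add: L.m_assoc)
  then show ?thesis using line_closed(3,4)[OF assms(1)] ll by metis
qed

definition girth_ge :: "nat \<Rightarrow> nat \<Rightarrow> bool" where
  "girth_ge n \<gamma> \<longleftrightarrow> (\<forall>x \<in> W. freely_reduced x \<longrightarrow> x \<noteq> [] \<longrightarrow> L.ev n x = \<one>\<^bsub>Sol n\<^esub> \<longrightarrow> \<gamma> \<le> length x)"

text \<open>Only the two end letters have to leave the line; the path may meet it in between. The
  bound is what keeps rays out of a ball in \<open>far_ray\<close>.\<close>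

definition excursion_ge :: "nat \<Rightarrow> nat \<Rightarrow> bool" where
  "excursion_ge n \<delta> \<longleftrightarrow> (\<forall>a < m. \<forall>x \<in> W. freely_reduced x \<longrightarrow> x \<noteq> [] \<longrightarrow> fst (hd x) \<noteq> a \<longrightarrow>
     fst (last x) \<noteq> a \<longrightarrow> L.ev n x \<in> line n a \<longrightarrow> \<delta> \<le> length x)"

lemma girth_closed_path:
  assumes "girth_ge n \<gamma>" "L.path n v C v" "C \<noteq> []" "L.no_turn n C"
  shows "\<gamma> \<le> length C"
proof -
  obtain e C' where "C = e # C'" using assms(3) by (cases C) auto
  then have "e \<in> L.arcs n" "fst e = v" using assms(2) by auto
  then have v: "v \<in> carrier (Sol n)" by (auto simp: L.arcs_def)
  define w where "w = map snd C"
  have w: "C = L.walk n v w" "w \<in> W" "v = v \<otimes>\<^bsub>Sol n\<^esub> L.ev n w"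
    using L.path_is_walk[OF assms(2) v] by (auto simp: w_def)
  then have "L.ev n w = \<one>\<^bsub>Sol n\<^esub>" using v L.mult_ev_eq_self by metis
  moreover have "freely_reduced w" using assms(4) w(1) L.no_turn_walk_reduced by metis
  moreover have "w \<noteq> []" using assms(3) by (simp add: w_def)
  ultimately have "\<gamma> \<le> length w" using assms(1) w(2) unfolding girth_ge_def by blast
  then show ?thesis by (simp add: w_def)
qed

lemma girth_Suc:
  assumes "girth_ge n \<gamma>"
  shows "girth_ge (Suc n) (3 * \<gamma>)"
  unfolding girth_ge_def
proof (intro ballI impI)
  fix x assume x: "x \<in> W" "freely_reduced x" "x \<noteq> []" "L.ev (Suc n) x = \<one>\<^bsub>Sol (Suc n)\<^esub>"
  define P where "P = L.walk n \<one>\<^bsub>Sol n\<^esub> x"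
  have "\<exists>s. 2 * s \<le> length P \<and> 3 * \<gamma> \<le> 2 * s"
  proof (rule L.tripling)
    show "L.path n \<one>\<^bsub>Sol n\<^esub> P \<one>\<^bsub>Sol n\<^esub>"
      using L.path_walk[of "\<one>\<^bsub>Sol n\<^esub>" n x] x ev_Suc_one(1)[OF x(1,4)] by (simp add: P_def)
    show "P \<noteq> []" "L.reduced n P" using x by (simp_all add: P_def L.reduced_walk)
    show "count_list P e = count_list P (L.flip n e)" if "e \<in> L.arcs n" for e
      using ev_Suc_one(2)[OF x(1,4) that] by (simp add: P_def L.flow_def)
  qed (use girth_closed_path[OF assms] in blast)
  then show "3 * \<gamma> \<le> length x" by (auto simp: P_def)
qed

text \<open>Contracting the line \<open>\<langle>a\<rangle>\<close> to a point turns excursions from the line into closed paths, so the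
  contracted graph has girth at least \<open>\<gamma> - 1\<close>. The missing unit is recovered from an edge of the line
  and from parity.\<close>

lemma excursion_Suc:
  assumes n: "n > 0" and girth: "girth_ge n \<gamma>" and exc: "excursion_ge n (\<gamma> - 1)" and "even \<gamma>" "\<gamma> > 0"
  shows "excursion_ge (Suc n) (3 * \<gamma> - 1)"
  unfolding excursion_ge_def
proof (intro allI ballI impI)
  fix a x
  assume a: "a < m" and x: "x \<in> W" "freely_reduced x" "x \<noteq> []" "fst (hd x) \<noteq> a" "fst (last x) \<noteq> a"
    and xl: "L.ev (Suc n) x \<in> line (Suc n) a"
  obtain u0 where u0: "fst ` set u0 \<subseteq> {a}" "L.ev (Suc n) x = L.ev (Suc n) u0"
    using xl by (auto simp: line_def)
  define u where "u = reduce_word u0"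
  have u: "fst ` set u \<subseteq> {a}" "freely_reduced u"
    using set_foldr[of u0 "[]"] u0(1) L.freely_reduced_reduce_word unfolding u_def
    by (auto simp: reduce_word_def)
  have uW: "u \<in> W" "u0 \<in> W" using u u0 a one_generator_word by auto
  have xu: "L.ev (Suc n) x = L.ev (Suc n) u" using u0 uW by (simp add: u_def L.ev_reduce_word)
  show "3 * \<gamma> - 1 \<le> length x"
  proof (cases "u = []")
    case True
    then have "L.ev (Suc n) x = \<one>\<^bsub>Sol (Suc n)\<^esub>" using xu by simp
    then have "3 * \<gamma> \<le> length x" using girth_Suc[OF girth] x unfolding girth_ge_def by blast
    then show ?thesis by simp
  next
    case False
    define LN where "LN = line n a"
    note LNc = line_closed[OF a, where n = n, folded LN_def]
    \<comment> \<open>\<open>None\<close> is the vertex to which the line is contracted. The a-arcs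
      along the line would become loops there and are left out of \<open>X\<close>.\<close>
    define \<kappa> where "\<kappa> g = (if g \<in> LN then None else Some g)" for g
    define X where "X = {e \<in> L.arcs n. \<not> (fst e \<in> LN \<and> fst (snd e) = a)}"
    have step: "L.head n e \<in> LN \<longleftrightarrow> fst e \<in> LN" if "e \<in> L.arcs n" "fst (snd e) = a" for e
      using line_step[OF a, of "fst e" n "snd e"] that by (auto simp: LN_def L.head_def L.arcs_def)
    interpret Q: graph_with_reversal "\<lambda>e. \<kappa> (fst e)" "\<lambda>e. \<kappa> (L.head n e)" "L.flip n" X
    proof
      fix e assume e: "e \<in> X"
      then have ea: "e \<in> L.arcs n" by (simp add: X_def)
      show "L.flip n (L.flip n e) = e" "L.flip n e \<noteq> e" using ea L.rv_rv L.rv_neq by blast+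
      show "\<kappa> (fst (L.flip n e)) = \<kappa> (L.head n e)" by (simp add: L.flip_def)
      have "fst (snd (L.flip n e)) = fst (snd e)" "fst (L.flip n e) = L.head n e"
        by (simp_all add: L.flip_def)
      then show "L.flip n e \<in> X" using e step[OF ea] L.rv_in[OF ea] by (auto simp: X_def)
    qed
    define P where "P = L.walk n \<one>\<^bsub>Sol n\<^esub> x"
    have Parcs: "set P \<subseteq> L.arcs n" using x by (simp add: P_def L.walk_arcs)
    have Ppath: "L.path n \<one>\<^bsub>Sol n\<^esub> P (L.ev n x)"
      using L.path_walk[of "\<one>\<^bsub>Sol n\<^esub>" n x] x by (simp add: P_def)
    define P' where "P' = filter (\<lambda>e. e \<in> X) P"
    have contract: "Q.path (\<kappa> g) (filter (\<lambda>e. e \<in> X) R) (\<kappa> h)" if "L.path n g R h" for g R h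
      using that
    proof (induction R arbitrary: g)
      case (Cons e R)
      then have e: "e \<in> L.arcs n" "fst e = g" "L.path n (L.head n e) R h" by auto
      show ?case
      proof (cases "e \<in> X")
        case True
        then show ?thesis using Cons.IH[OF e(3)] e by simp
      next
        case False
        then have "fst e \<in> LN" "L.head n e \<in> LN" using e step[OF e(1)] by (auto simp: X_def)
        then show ?thesis using Cons.IH[OF e(3)] e False by (simp add: \<kappa>_def)
      qed
    qed simp
    have evx: "L.ev n x = L.ev n u" using ev_Suc_eq(1)[OF x(1) uW(1) xu] .
    have "L.ev n u \<in> LN" using u by (auto simp: LN_def line_def)
    then have "\<kappa> (L.ev n x) = None" "\<kappa> \<one>\<^bsub>Sol n\<^esub> = None" using evx LNc(2) by (auto simp: \<kappa>_def)
    then have P'closed: "Q.path None P' None" using contract[OF Ppath] by (simp add: P'_def)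
    have fl: "L.flow n P e = L.flow n (L.walk n \<one>\<^bsub>Sol n\<^esub> u) e" if "e \<in> L.arcs n" for e
      using ev_Suc_eq(2)[OF x(1) uW(1) xu that] by (simp add: P_def)
    have uwalk: "fst e \<in> LN \<and> fst (snd e) = a" if "e \<in> set (L.walk n g w)" "g \<in> LN" "fst ` set w \<subseteq> {a}" for e g w
      using that
    proof (induction w arbitrary: g)
      case (Cons l w)
      then have "g \<otimes>\<^bsub>Sol n\<^esub> L.lv n l \<in> LN"
        using line_step[OF a, of g n l] LNc(1) by (auto simp: LN_def)
      then show ?case using Cons by auto
    qed simp
    \<comment> \<open>The flow of x is that of the power u of a, which runs along the line and
      crosses no arc of \<open>X\<close>.\<close>
    have bal: "count_list P' e = count_list P' (L.flip n e)" if e: "e \<in> X" for e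
    proof -
      have "count_list (filter (\<lambda>e. e \<in> X) R) f = count_list R f" if "f \<in> X" for R f
        using that by (induction R) auto
      then have cnt: "count_list P' e = count_list P e" "count_list P' (L.flip n e) = count_list P (L.flip n e)"
        using e Q.rv_in by (auto simp: P'_def)
      have "e \<notin> set (L.walk n \<one>\<^bsub>Sol n\<^esub> u)" "L.flip n e \<notin> set (L.walk n \<one>\<^bsub>Sol n\<^esub> u)"
        using uwalk[OF _ LNc(2) u(1)] e Q.rv_in[OF e] unfolding X_def by blast+
      then have "L.flow n (L.walk n \<one>\<^bsub>Sol n\<^esub> u) e = 0" by (simp add: L.flow_def)
      then show ?thesis using fl[of e] e cnt by (simp add: L.flow_def X_def)
    qed
    \<comment> \<open>If f reversed e, the segment B between them would be a closed reduced power of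
      a. It is nonempty as P is reduced, so its exponent sum is nonzero, which is impossible for a
      closed path on a level n > 0.\<close>
    have red: "Q.reduced P'"
      unfolding Q.reduced_def P'_def
    proof (rule successively_filterI)
      fix A e B f D
      assume PA: "P = A @ e # B @ f # D" and ef: "e \<in> X" "f \<in> X" and B: "\<forall>x \<in> set B. x \<notin> X"
      have redP: "L.reduced n P" using x by (simp add: P_def L.reduced_walk)
      have eB: "L.path n (L.head n e) B (fst f)" and he: "e \<in> L.arcs n"
        using Ppath unfolding PA by (auto simp: L.path_append)
      have hc: "L.head n e \<in> carrier (Sol n)" using he by (auto simp: L.arcs_def)
      show "f \<noteq> L.flip n e"
      proof
        assume f: "f = L.flip n e"
        show False
        proof (cases "B = []")
          case True
          then show False using redP f PA by (simp add: L.reduced_def successively_append_iff)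
        next
          case Bne: False
          define w where "w = map snd B"
          have w: "B = L.walk n (L.head n e) w" "w \<in> W" "fst f = L.head n e \<otimes>\<^bsub>Sol n\<^esub> L.ev n w"
            using L.path_is_walk[OF eB hc] by (auto simp: w_def)
          have "fst f = L.head n e" using f by (simp add: L.flip_def)
          then have "L.ev n w = \<one>\<^bsub>Sol n\<^esub>" using w hc L.mult_ev_eq_self by metis
          then have "expsum a w = expsum a []"
            using expsum_eq[OF w(2), of "[]" "n - 1" a] a n by simp
          moreover have "set B \<subseteq> L.arcs n" using Parcs PA by auto
          then have "fst ` set w \<subseteq> {a}" using B by (auto simp: w_def X_def)
          moreover have "L.reduced n B"
            using redP PA L.reduced_appendD(1)[of n B "f # D"]
              L.reduced_appendD(2)[of n "A @ [e]" "B @ f # D"] by simp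
          then have "freely_reduced w" using w(1) L.reduced_walk by metis
          moreover have "w \<noteq> []" using Bne by (simp add: w_def)
          ultimately show False using expsum_one_generator by fastforce
        qed
      qed
    qed
    have ne: "P' \<noteq> []"
    proof -
      obtain l w where "x = l # w" using x by (cases x) auto
      then show ?thesis using x by (simp add: P'_def P_def X_def)
    qed
    \<comment> \<open>A closed path that avoids \<open>None\<close> lifts to a closed path of the
      Cayley graph. One through \<open>None\<close> lifts, up to its first return, to an excursion
      from the line.\<close>
    have Qgirth: "\<gamma> - 1 \<le> length C"
      if C: "Q.path v C v" "C \<noteq> []" "distinct C" "Q.no_turn C" for v C
    proof (cases "\<exists>e \<in> set C. fst e \<in> LN")
      case False
      have lift: "\<exists>h. \<kappa> h = v \<and> L.path n g R h" if "Q.path (\<kappa> g) R v" "set R \<subseteq> set C" for g R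
        using that
      proof (induction R arbitrary: g)
        case (Cons e R)
        then have e: "e \<in> X" "\<kappa> (fst e) = \<kappa> g" "Q.path (\<kappa> (L.head n e)) R v" "fst e \<notin> LN"
          using False by auto
        then have "g = fst e" by (auto simp: \<kappa>_def split: if_splits)
        then show ?case using Cons.IH[OF e(3)] Cons.prems e(1) by (auto simp: X_def)
      qed auto
      define g where "g = fst (hd C)"
      have "g \<notin> LN" "\<kappa> g = v" using False C(1,2) by (cases C; auto simp: g_def)+
      then obtain h where h: "\<kappa> h = v" "L.path n g C h" using lift[of g C] C(1) by auto
      then have "h = g" using \<open>g \<notin> LN\<close> \<open>\<kappa> g = v\<close> by (auto simp: \<kappa>_def split: if_splits)
      then have "\<gamma> \<le> length C"
        using girth_closed_path[OF girth] h C by (auto simp: L.no_turn_def Q.no_turn_def)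
      then show ?thesis by simp
    next
      case True
      then obtain e where e: "e \<in> set C" "fst e \<in> LN" by blast
      then obtain A B where AB: "C = A @ e # B" by (meson split_list)
      define C' where "C' = e # B @ A"
      have k0: "\<kappa> (fst e) = None" using e by (simp add: \<kappa>_def)
      have C'p: "Q.path (\<kappa> (fst e)) C' (\<kappa> (fst e))" using C(1) AB by (auto simp: C'_def Q.path_append)
      have setC': "set C' = set C" by (auto simp: C'_def AB)
      have "\<exists>f \<in> set C'. L.head n f \<in> LN"
      proof -
        obtain R f where R: "C' = R @ [f]" by (metis C'_def list.distinct(1) rev_exhaust)
        then have "\<kappa> (L.head n f) = None" using C'p k0 by (auto simp: Q.path_append)
        then show ?thesis using R by (auto simp: \<kappa>_def split: if_splits)
      qed
      \<comment> \<open>C' starts on the line at e, and f is the arc with which it first comes back;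
        at the vertices before that, \<kappa> is injective and the path lifts uniquely.\<close>
      then obtain D f R where D: "C' = D @ f # R" "L.head n f \<in> LN" "\<forall>d \<in> set D. L.head n d \<notin> LN"
        using split_list_first_prop[of C' "\<lambda>f. L.head n f \<in> LN"] by blast
      have lift: "L.path n g (E @ [f]) (L.head n f)"
        if "Q.path (\<kappa> g) (E @ [f]) z" "g = fst (hd (E @ [f]))" "\<forall>d \<in> set E. L.head n d \<notin> LN" for g E z
        using that
      proof (induction E arbitrary: g)
        case Nil
        then have "f \<in> X" "fst f = g" by auto
        then show ?case by (auto simp: X_def)
      next
        case (Cons d E)
        then have d: "d \<in> X" "fst d = g" "Q.path (\<kappa> (L.head n d)) (E @ [f]) z" "L.head n d \<notin> LN" by auto
        have "\<kappa> (fst (hd (E @ [f]))) = \<kappa> (L.head n d)" using d(3) by (cases E) auto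
        then have "L.head n d = fst (hd (E @ [f]))" using d(4) by (auto simp: \<kappa>_def split: if_splits)
        moreover have "\<forall>d \<in> set E. L.head n d \<notin> LN" using Cons.prems(3) by simp
        ultimately have "L.path n (L.head n d) (E @ [f]) (L.head n f)" by (rule Cons.IH[OF d(3)])
        moreover have "d \<in> L.arcs n" using d(1) unfolding X_def by blast
        ultimately show ?case using d(2) by simp
      qed
      have "hd (D @ [f]) = e" using D(1) by (cases D) (auto simp: C'_def)
      moreover obtain z where "Q.path (\<kappa> (fst e)) (D @ [f]) z"
        using C'p D(1) Q.path_append[of "\<kappa> (fst e)" "D @ [f]" R] by auto
      ultimately have path: "L.path n (fst e) (D @ [f]) (L.head n f)" using lift D(3) by metis
      have "e \<in> set C'" by (simp add: C'_def)
      moreover have "f \<in> set C'" by (simp add: D(1))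
      ultimately have eX: "e \<in> X" "f \<in> X" using Q.path_in_X[OF C'p] by auto
      have ec: "fst e \<in> carrier (Sol n)" using e LNc(1) by auto
      define w where "w = map snd (D @ [f])"
      have w: "D @ [f] = L.walk n (fst e) w" "w \<in> W" "L.head n f = fst e \<otimes>\<^bsub>Sol n\<^esub> L.ev n w"
        using L.path_is_walk[OF path ec] by (auto simp: w_def)
      have "L.ev n w = inv\<^bsub>Sol n\<^esub> (fst e) \<otimes>\<^bsub>Sol n\<^esub> L.head n f"
        using w ec by (simp add: L.m_assoc[symmetric])
      then have "L.ev n w \<in> line n a" using LNc(3,4) e D(2) by (simp add: LN_def)
      moreover have "freely_reduced w"
      proof -
        have "set (D @ [f]) \<subseteq> set C" using D(1) setC' by auto
        then have "L.no_turn n (D @ [f])" using C(4) by (auto simp: L.no_turn_def Q.no_turn_def)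
        then show ?thesis using w(1) L.no_turn_walk_reduced by metis
      qed
      moreover have "fst (hd w) \<noteq> a"
        using \<open>hd (D @ [f]) = e\<close> eX e by (cases D) (auto simp: w_def X_def)
      moreover have "fst (last w) \<noteq> a"
        using eX(2) D(2) step[of f] by (auto simp: w_def X_def)
      moreover have "w \<noteq> []" by (simp add: w_def)
      ultimately have "\<gamma> - 1 \<le> length w" using exc a w(2) unfolding excursion_ge_def by blast
      moreover have "length w \<le> length C'" by (simp add: w_def D(1))
      ultimately show ?thesis by (simp add: C'_def AB)
    qed
    obtain s where s: "2 * s \<le> length P'" "3 * (\<gamma> - 1) \<le> 2 * s"
    proof -
      have "\<exists>s. 2 * s \<le> length P' \<and> 3 * (\<gamma> - 1) \<le> 2 * s"
        by (rule Q.tripling[OF _ P'closed ne red]) (use Qgirth bal in blast)+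
      then show ?thesis using that by blast
    qed
    \<comment> \<open>As \<gamma> is even, 3 (\<gamma> - 1) is odd, so the even number 2 s exceeds
      it by at least one.\<close>
    have "3 * \<gamma> - 2 \<le> 2 * s"
    proof -
      have "\<exists>k. \<gamma> = 2 * k" using \<open>even \<gamma>\<close> by (auto elim: evenE)
      then show ?thesis using s(2) \<open>\<gamma> > 0\<close> by (elim exE) arith
    qed
    \<comment> \<open>The nonempty reduced power u never goes back, so its first arc has positive
      flow. Hence x also crosses this edge of the line, and the crossing is dropped in P'.\<close>
    moreover have "length P' < length P"
    proof -
      obtain l v where lv: "u = l # v" using False by (cases u) auto
      then have sl: "set u = {l}" using freely_reduced_one_generator u by metis
      define f where "f = (\<one>\<^bsub>Sol n\<^esub>, l)"
      have fa: "f \<in> L.arcs n" using uW lv by (simp add: f_def)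
      have la: "fst l = a" using u lv by auto
      have fnot: "L.flip n f \<notin> set (L.walk n \<one>\<^bsub>Sol n\<^esub> u)"
      proof
        assume "L.flip n f \<in> set (L.walk n \<one>\<^bsub>Sol n\<^esub> u)"
        then have "snd (L.flip n f) \<in> set (map snd (L.walk n \<one>\<^bsub>Sol n\<^esub> u))" by (metis image_eqI set_map)
        then show False using sl by (simp add: f_def)
      qed
      have "L.flow n (L.walk n \<one>\<^bsub>Sol n\<^esub> u) f > 0"
        using fnot by (simp add: L.flow_def lv f_def)
      then have "f \<in> set P \<or> L.flip n f \<in> set P" using fl[OF fa] L.flow_nonzeroD[of n P f] by auto
      moreover have "f \<notin> X" using la LNc(2) by (simp add: X_def f_def)
      moreover from this have "L.flip n f \<notin> X" using Q.rv_in L.rv_rv[OF fa] by metis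
      ultimately obtain f' where "f' \<in> set P" "f' \<notin> X" by blast
      then show ?thesis unfolding P'_def by (rule length_filter_less)
    qed
    moreover have "length P = length x" by (simp add: P_def)
    ultimately show ?thesis using s(1) by linarith
  qed
qed

text \<open>All exponent sums vanish, so each letter is matched by its inverse; with fewer than four
  letters some such pair would be adjacent.\<close>

lemma girth_1: "girth_ge (Suc 0) 4"
  unfolding girth_ge_def
proof (intro ballI impI)
  fix x assume x: "x \<in> W" "freely_reduced x" "x \<noteq> []" "L.ev (Suc 0) x = \<one>\<^bsub>Sol (Suc 0)\<^esub>"
  have e: "expsum a x = 0" if "a < m" for a
    using expsum_eq[OF x(1), of "[]" 0 a] x that by simp
  show "4 \<le> length x"
  proof (rule ccontr)
    assume "\<not> 4 \<le> length x"
    then consider p where "x = [p]" | p q where "x = [p, q]" | p q r where "x = [p, q, r]"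
      using x(3) by (cases x; cases "tl x"; cases "tl (tl x)"; cases "tl (tl (tl x))"; auto)
    then show False
    proof cases
      case 1
      then show False using e[of "fst p"] x(1) by (auto simp: L.letters_def split: if_splits)
    next
      case 2
      then show False using e[of "fst p"] x(1,2)
        by (auto simp: L.letters_def freely_reduced_def inv_letter_def prod_eq_iff split: if_splits)
    next
      case 3
      then show False using e[of "fst p"] e[of "fst q"] x(1,2)
        by (auto simp: L.letters_def freely_reduced_def inv_letter_def prod_eq_iff split: if_splits)
    qed
  qed
qed

text \<open>All exponent sums except that of a vanish. The first letter thus needs its inverse later
  on, with at least one letter in between.\<close>

lemma excursion_1: "excursion_ge (Suc 0) 3"
  unfolding excursion_ge_def
proof (intro allI ballI impI)
  fix a x
  assume a: "a < m" and x: "x \<in> W" "freely_reduced x" "x \<noteq> []" "fst (hd x) \<noteq> a"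
    and xl: "L.ev (Suc 0) x \<in> line (Suc 0) a"
  obtain u where u: "fst ` set u \<subseteq> {a}" "L.ev (Suc 0) x = L.ev (Suc 0) u"
    using xl by (auto simp: line_def)
  have "expsum b u = 0" if "b \<noteq> a" for b using u(1) that by (induction u) auto
  then have e: "expsum b x = 0" if "b < m" "b \<noteq> a" for b
    using expsum_eq[OF x(1) _ u(2), of b] one_generator_word[OF a u(1)] that by simp
  show "3 \<le> length x"
  proof (rule ccontr)
    assume "\<not> 3 \<le> length x"
    then consider p where "x = [p]" | p q where "x = [p, q]"
      using x(3) by (cases x; cases "tl x"; cases "tl (tl x)"; auto)
    then show False
    proof cases
      case 1
      then show False using e[of "fst p"] x(1,4) by (auto simp: L.letters_def split: if_splits)
    next
      case 2
      then show False using e[of "fst p"] x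
        by (auto simp: L.letters_def freely_reduced_def inv_letter_def prod_eq_iff split: if_splits)
    qed
  qed
qed

text \<open>Both bounds are proved together because \<open>excursion_Suc\<close> uses the girth of
  its own level. The difference of one already occurs in b a b^-1 = a on level 1.\<close>

theorem girth_excursion:
  "girth_ge (Suc n) (4 * 3 ^ n) \<and> excursion_ge (Suc n) (4 * 3 ^ n - 1)"
proof (induction n)
  case 0
  then show ?case using girth_1 excursion_1 by simp
next
  case (Suc n)
  then show ?case
    using girth_Suc[of "Suc n" "4 * 3 ^ n"] excursion_Suc[of "Suc n" "4 * 3 ^ n"]
    by (simp add: mult.left_commute)
qed

end

section \<open>Detours around balls\<close>

lemma expsum_replicate [simp]:
  "expsum x (replicate k l) = (if fst l = x then (if snd l then int k else - int k) else 0)"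
  by (induction k) auto

lemma expsum_zero: "x \<notin> fst ` set w \<Longrightarrow> expsum x w = 0"
  by (induction w) auto

lemma word_inv_replicate: "word_inv (replicate k l) = replicate k (inv_letter l)"
  by (simp add: word_inv_def)

lemma word_inv_power: "word_inv (concat (replicate k w)) = concat (replicate k (word_inv w))"
proof (induction k)
  case (Suc k)
  have "concat (replicate k v) @ v = v @ concat (replicate k v)" for v :: "('s \<times> bool) list"
    by (induction k) auto
  then show ?case using Suc by simp
qed simp

context marked_group
begin

lemma replicate_words [simp]: "replicate k l \<in> words \<longleftrightarrow> k = 0 \<or> l \<in> letters"
  by (induction k) auto

lemma power_words [simp]: "w \<in> words \<Longrightarrow> concat (replicate k w) \<in> words"
  by (induction k) auto

lemma ev_power_one: "w \<in> words \<Longrightarrow> ev w = \<one> \<Longrightarrow> ev (concat (replicate k w)) = \<one>"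
  by (induction k) (auto simp: ev_append)

section \<open>Walks that avoid a ball\<close>

fun far_along :: "nat \<Rightarrow> 'a \<Rightarrow> ('s \<times> bool) list \<Rightarrow> bool" where
  "far_along D g [] \<longleftrightarrow> far D g"
| "far_along D g (l # w) \<longleftrightarrow> far D g \<and> far_along D (g \<otimes> lv l) w"

lemma far_along_start: "far_along D g w \<Longrightarrow> far D g"
  by (cases w) auto

lemma far_along_append:
  assumes "g \<in> carrier G" "u \<in> words" "v \<in> words"
  shows "far_along D g (u @ v) \<longleftrightarrow> far_along D g u \<and> far_along D (g \<otimes> ev u) v"
  using assms(1,2)
proof (induction u arbitrary: g)
  case Nil
  then show ?case using far_along_start by auto
next
  case (Cons l u)
  then show ?case using assms(3) by (auto simp: m_assoc)
qed

lemma far_along_near: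
  assumes "far (D + length w) g" "g \<in> carrier G" "w \<in> words"
  shows "far_along D g w"
  using assms
proof (induction w arbitrary: g)
  case (Cons l w)
  have "far (D + length w) (g \<otimes> lv l)"
    using far_step[OF Cons.prems(1,2), of "[l]"] Cons.prems(3) by simp
  then show ?case using Cons far_mono[OF Cons.prems(1)] by simp
qed simp

lemma far_along_rev:
  assumes "far_along D g w" "g \<in> carrier G" "w \<in> words"
  shows "far_along D (g \<otimes> ev w) (word_inv w)"
  using assms
proof (induction w arbitrary: g)
  case (Cons l w)
  have c: "lv l \<in> carrier G" "ev w \<in> carrier G" "w \<in> words" "l \<in> letters" using Cons.prems by auto
  have e: "g \<otimes> ev (l # w) = g \<otimes> lv l \<otimes> ev w" using Cons.prems c by (simp add: m_assoc)
  have "g \<otimes> lv l \<otimes> ev w \<otimes> inv (ev w) = g \<otimes> lv l" "g \<otimes> lv l \<otimes> inv (lv l) = g"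
    using c Cons.prems by (simp_all add: m_assoc)
  then show ?case unfolding e using Cons c far_along_start[of D "g \<otimes> lv l" w]
    by (simp add: far_along_append ev_word_inv lv_inv_letter)
qed simp

lemma far_along_walk:
  "far_along D g w \<Longrightarrow> e \<in> set (walk g w) \<Longrightarrow> far D (fst e) \<and> far D (head e)"
proof (induction w arbitrary: g)
  case (Cons l w)
  then show ?case using far_along_start by auto
qed simp

lemma far_along_translate:
  assumes "far_along D g w" "g \<in> carrier G" "w \<in> words" "v \<in> words"
  shows "far_along (D - length v) (ev v \<otimes> g) w"
  using assms
proof (induction w arbitrary: g)
  case (Cons l w)
  then have "far_along (D - length v) (ev v \<otimes> (g \<otimes> lv l)) w" by simp
  then show ?case using Cons far_translate by (auto simp: m_assoc)
qed (use far_translate in auto)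

end

context free_soluble
begin

lemma fl_append_closed:
  "u \<in> W \<Longrightarrow> v \<in> W \<Longrightarrow> L.ev n u = \<one>\<^bsub>Sol n\<^esub> \<Longrightarrow> fl n (u @ v) e = fl n u e + fl n v e"
  by (simp add: L.walk_append)

lemma fl_power_closed:
  assumes "u \<in> W" "L.ev n u = \<one>\<^bsub>Sol n\<^esub>"
  shows "fl n (concat (replicate k u)) e = int k * fl n u e"
proof (induction k)
  case (Suc k)
  then show ?case
    using fl_append_closed[OF assms(1) _ assms(2), of "concat (replicate k u)" e] assms
    by (simp add: algebra_simps)
qed simp

text \<open>The way out along u and the way back cancel, and the flow of v remains, translated by
  the value of u.\<close>

lemma fl_conjugate:
  assumes "u \<in> W" "v \<in> W" "L.ev n v = \<one>\<^bsub>Sol n\<^esub>" "h \<in> carrier (Sol n)" "l \<in> L.letters"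
  shows "fl n (u @ v @ word_inv u) (h, l) = fl n v (inv\<^bsub>Sol n\<^esub> (L.ev n u) \<otimes>\<^bsub>Sol n\<^esub> h, l)"
proof -
  have "fl n (u @ v @ word_inv u) (h, l) = fl n u (h, l) + L.flow n (L.walk n (L.ev n u) v) (h, l)
      + L.flow n (L.walk n (L.ev n u) (word_inv u)) (h, l)"
    using assms by (simp add: L.walk_append)
  moreover have "L.flow n (L.walk n (L.ev n u) (word_inv u)) (h, l) = - fl n u (h, l)"
    using L.flow_word_inv[of "\<one>\<^bsub>Sol n\<^esub>" n u "(h, l)"] assms by simp
  moreover have "L.flow n (L.walk n (L.ev n u) v) (h, l) = fl n v (inv\<^bsub>Sol n\<^esub> (L.ev n u) \<otimes>\<^bsub>Sol n\<^esub> h, l)"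
    using assms by (intro L.flow_walk_from) auto
  ultimately show ?thesis by simp
qed

lemma far_along_expsum:
  assumes "g \<in> W" "w \<in> W" "x < m" "\<And>p q. w = p @ q \<Longrightarrow> int D \<le> \<bar>expsum x (g @ p)\<bar>"
  shows "L.far_along (Suc n) D (L.ev (Suc n) g) w"
  using assms(1,2,4)
proof (induction w arbitrary: g)
  case Nil
  then show ?case using far_expsum[of g x D n] assms(3) by simp
next
  case (Cons l w)
  have far: "L.far (Suc n) D (L.ev (Suc n) g)"
    using far_expsum[of g x D n] Cons.prems(1) Cons.prems(3)[of "[]" "l # w"] assms(3) by simp
  have "L.far_along (Suc n) D (L.ev (Suc n) (g @ [l])) w"
  proof (rule Cons.IH)
    fix p q assume "w = p @ q"
    then show "int D \<le> \<bar>expsum x ((g @ [l]) @ p)\<bar>" using Cons.prems(3)[of "l # p" q] by simp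
  qed (use Cons.prems in auto)
  then show ?case using far Cons.prems by (simp add: L.ev_append)
qed

lemma far_along_other_generator:
  assumes "g \<in> W" "w \<in> W" "x < m" "x \<notin> fst ` set w" "int D \<le> \<bar>expsum x g\<bar>"
  shows "L.far_along (Suc n) D (L.ev (Suc n) g) w"
proof (rule far_along_expsum[OF assms(1-3)])
  fix p q assume "w = p @ q"
  then have "expsum x p = 0" using assms(4) by (intro expsum_zero) auto
  then show "int D \<le> \<bar>expsum x (g @ p)\<bar>" using assms(5) by simp
qed

text \<open>The exponent sum of x has the same value after each factor w and deviates by at most |w|
  in between.\<close>

lemma far_along_power_closed:
  assumes "g \<in> W" "w \<in> W" "x < m" "expsum x w = 0" "int (D + length w) \<le> \<bar>expsum x g\<bar>"
  shows "L.far_along (Suc n) D (L.ev (Suc n) g) (concat (replicate k w))"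
  using assms(1,5)
proof (induction k arbitrary: g)
  case 0
  then show ?case using far_expsum[of g x D n] assms(3) by simp
next
  case (Suc k)
  have "L.far_along (Suc n) D (L.ev (Suc n) g) w"
    using far_expsum[of g x "D + length w" n] Suc.prems assms by (intro L.far_along_near) auto
  moreover have "L.far_along (Suc n) D (L.ev (Suc n) (g @ w)) (concat (replicate k w))"
    using Suc.prems assms(2,4) by (intro Suc.IH) auto
  ultimately show ?case using Suc.prems assms(2) by (simp add: L.far_along_append L.ev_append)
qed

lemma far_along_ray:
  assumes "l \<in> L.letters" "D \<le> j"
  shows "L.far_along (Suc n) D (L.ev (Suc n) (replicate j l)) (replicate k l)"
proof (rule far_along_expsum[of _ _ "fst l"])
  fix p q assume "replicate k l = p @ q"
  then have "p = replicate (length p) l" by (metis append_eq_conv_conj min_def take_replicate length_append length_replicate le_add1)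
  then have "expsum (fst l) p = expsum (fst l) (replicate (length p) l)" by simp
  then show "int D \<le> \<bar>expsum (fst l) (replicate j l @ p)\<bar>" using assms(2) by simp
qed (use assms in \<open>auto simp: L.letters_def\<close>)

section \<open>Detours between axes\<close>

definition detour :: "nat \<Rightarrow> nat \<Rightarrow> nat \<times> bool \<Rightarrow> nat \<times> bool \<Rightarrow> (nat \<times> bool) list \<Rightarrow> bool" where
  "detour n D b c r \<longleftrightarrow> r \<in> W \<and> L.ev n (replicate D b @ r) = L.ev n (replicate D c) \<and>
     L.far_along n D (L.ev n (replicate D b)) r"

lemma ev_1_commute:
  "x \<in> W \<Longrightarrow> y \<in> W \<Longrightarrow> L.ev (Suc 0) x \<otimes>\<^bsub>Sol (Suc 0)\<^esub> L.ev (Suc 0) y = L.ev (Suc 0) y \<otimes>\<^bsub>Sol (Suc 0)\<^esub> L.ev (Suc 0) x"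
  using ev_Suc_commute[of x y 0] ev_0 by simp

text \<open>In the abelian group of level 1 the detour runs along sides of a square. For distinct
  generators it passes through b^D c^D; for c = b^-1 it uses another generator e and passes through
  b^D e^D and b^-D e^D. On every side some exponent sum keeps absolute value D.\<close>

lemma detour_1:
  assumes m: "m > 1" and b: "b \<in> L.letters" "c \<in> L.letters" "b \<noteq> c"
  shows "\<exists>r. detour (Suc 0) D b c r"
proof (cases "fst b = fst c")
  case False
  define r where "r = replicate D c @ word_inv (replicate D b)"
  have w: "replicate D b \<in> W" "replicate D c \<in> W" "fst b < m" "fst c < m"
    using b by (auto simp: L.letters_def)
  have com: "L.ev (Suc 0) (replicate D b @ replicate D c) = L.ev (Suc 0) (replicate D c @ replicate D b)"
    using ev_1_commute[OF w(1,2)] w by (simp add: L.ev_append)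
  have 1: "L.far_along (Suc 0) D (L.ev (Suc 0) (replicate D b)) (replicate D c)"
    using w False by (intro far_along_other_generator[of _ _ "fst b"]) auto
  have "L.far_along (Suc 0) D (L.ev (Suc 0) (replicate D b @ replicate D c)) (word_inv (replicate D b))"
    unfolding com word_inv_replicate using w b False
    by (intro far_along_other_generator[of _ _ "fst c"]) auto
  then have "L.far_along (Suc 0) D (L.ev (Suc 0) (replicate D b)) r"
    using 1 w unfolding r_def by (simp add: L.far_along_append L.ev_append)
  moreover have "L.ev (Suc 0) (replicate D b @ r) = L.ev (Suc 0) ((replicate D b @ replicate D c) @ word_inv (replicate D b))"
    by (simp add: r_def)
  then have "L.ev (Suc 0) (replicate D b @ r) = L.ev (Suc 0) (replicate D c)"
    using w com by (simp add: L.ev_append L.ev_word_inv L.m_assoc del: append_assoc)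
  ultimately show ?thesis using w by (intro exI[of _ r]) (auto simp: detour_def r_def)
next
  case True
  then have c: "c = inv_letter b" using b by (auto simp: inv_letter_def prod_eq_iff)
  obtain x where x: "x < m" "x \<noteq> fst b" using m by (metis One_nat_def less_trans zero_less_one zero_neq_one)
  define e where "e = (x, True)"
  define B E where "B = replicate D b" and "E = replicate D e"
  have w: "B \<in> W" "E \<in> W" "fst b < m" using b x by (auto simp: L.letters_def e_def B_def E_def)
  have C: "replicate D c = word_inv B" by (simp add: c B_def word_inv_replicate)
  define r where "r = E @ word_inv B @ word_inv B @ word_inv E"
  have xs: "expsum (fst b) B = (if snd b then int D else - int D)" "expsum x B = 0"
    "expsum x E = int D" "expsum (fst b) E = 0" using x by (auto simp: B_def E_def e_def)
  have xB: "x \<notin> fst ` set (word_inv B)" using x by (auto simp: B_def word_inv_replicate)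
  have bE: "fst b \<notin> fst ` set E" "fst b \<notin> fst ` set (word_inv E)"
    using x by (auto simp: E_def e_def word_inv_replicate)
  let ?ev = "L.ev (Suc 0)" and ?far = "L.far_along (Suc 0) D"
  have 1: "?far (?ev B) E" using w xs bE by (intro far_along_other_generator[of _ _ "fst b"]) auto
  have com: "?ev (B @ E) = ?ev (E @ B)" using ev_1_commute[OF w(1,2)] w by (simp add: L.ev_append)
  have 2: "?far (?ev (B @ E)) (word_inv B @ word_inv B)"
    using w xs xB x by (intro far_along_other_generator[of _ _ x]) auto
  have e3: "?ev (B @ E @ word_inv B @ word_inv B) = ?ev (word_inv B @ E)"
  proof -
    have "?ev (B @ E @ word_inv B @ word_inv B) = ?ev (B @ E) \<otimes>\<^bsub>Sol (Suc 0)\<^esub> ?ev (word_inv B @ word_inv B)"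
      using w by (simp add: L.ev_append L.m_assoc)
    also have "\<dots> = ?ev E \<otimes>\<^bsub>Sol (Suc 0)\<^esub> ?ev (word_inv B)"
    proof -
      have c: "?ev B \<in> carrier (Sol (Suc 0))" "?ev E \<in> carrier (Sol (Suc 0))" using w by auto
      then have "?ev B \<otimes>\<^bsub>Sol (Suc 0)\<^esub> (inv\<^bsub>Sol (Suc 0)\<^esub> ?ev B \<otimes>\<^bsub>Sol (Suc 0)\<^esub> inv\<^bsub>Sol (Suc 0)\<^esub> ?ev B)
          = inv\<^bsub>Sol (Suc 0)\<^esub> ?ev B"
        by (simp add: L.m_assoc[symmetric])
      then show ?thesis unfolding com using w by (simp add: L.ev_append L.ev_word_inv L.m_assoc)
    qed
    also have "\<dots> = ?ev (word_inv B @ E)" using w ev_1_commute[of E "word_inv B"] by (simp add: L.ev_append)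
    finally show ?thesis .
  qed
  have 3: "?far (?ev (word_inv B @ E)) (word_inv E)"
    using w xs bE by (intro far_along_other_generator[of _ _ "fst b"]) auto
  have "?far (?ev B) r"
    using 1 2 3 w e3 unfolding r_def by (simp add: L.far_along_append L.ev_append L.m_assoc)
  moreover have "?ev (B @ r) = ?ev (B @ E @ word_inv B @ word_inv B) \<otimes>\<^bsub>Sol (Suc 0)\<^esub> ?ev (word_inv E)"
    using w by (simp add: r_def L.ev_append L.m_assoc)
  then have "?ev (B @ r) = ?ev (word_inv B)"
    unfolding e3 using w by (simp add: L.ev_append L.ev_word_inv L.m_assoc)
  ultimately show ?thesis using w C by (intro exI[of _ r]) (auto simp: detour_def r_def B_def)
qed

text \<open>The detour avoids the identity, so the loop crosses the first edge once: it comes back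
  to the identity along another letter.\<close>

lemma detour_flow:
  assumes r: "detour (Suc n) 1 b c r" and b: "b \<in> L.letters" "c \<in> L.letters" "b \<noteq> c"
  shows "L.ev (Suc n) (b # r @ [inv_letter c]) = \<one>\<^bsub>Sol (Suc n)\<^esub>"
    and "fl (Suc n) (b # r @ [inv_letter c]) (\<one>\<^bsub>Sol (Suc n)\<^esub>, b) = 1"
proof -
  let ?one = "\<one>\<^bsub>Sol (Suc n)\<^esub>"
  have rW: "r \<in> W" and ev: "L.ev (Suc n) (b # r) = L.lv (Suc n) c"
    and far: "L.far_along (Suc n) 1 (L.lv (Suc n) b) r"
    using r b by (auto simp: detour_def)
  show "L.ev (Suc n) (b # r @ [inv_letter c]) = ?one"
    using ev b rW by (simp add: L.ev_append[of "b # r" "[inv_letter c]", simplified] L.lv_inv_letter)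
  have wk: "L.walk (Suc n) ?one (b # r @ [inv_letter c]) =
      (?one, b) # L.walk (Suc n) (L.lv (Suc n) b) r @ [(L.lv (Suc n) c, inv_letter c)]"
    using ev b rW by (simp add: L.walk_append)
  have nfar: "\<not> L.far (Suc n) 1 ?one" by (auto simp: L.far_def intro!: bexI[of _ "[]"])
  have "L.far (Suc n) 1 (L.ev (Suc n) [c])"
    using far_expsum[of "[c]" "fst c" 1 n] b(2) by (auto simp: L.letters_def)
  then have cne: "L.lv (Suc n) c \<noteq> ?one" using nfar b by auto
  have "(?one, b) \<notin> set (L.walk (Suc n) (L.lv (Suc n) b) r)"
    using L.far_along_walk[OF far, of "(?one, b)"] nfar by auto
  then have 1: "count_list (L.walk (Suc n) ?one (b # r @ [inv_letter c])) (?one, b) = 1"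
    unfolding wk using cne by simp
  have hd: "L.lv (Suc n) b \<otimes>\<^bsub>Sol (Suc n)\<^esub> L.lv (Suc n) (inv_letter b) = ?one"
    using b by (simp add: L.lv_inv_letter)
  have fl: "L.flip (Suc n) (?one, b) = (L.lv (Suc n) b, inv_letter b)" using b by simp
  have "(L.lv (Suc n) b, inv_letter b) \<notin> set (L.walk (Suc n) (L.lv (Suc n) b) r)"
    using L.far_along_walk[OF far, of "(L.lv (Suc n) b, inv_letter b)"] nfar hd by auto
  moreover have "inv_letter c \<noteq> inv_letter b" using b(3) by (metis inv_letter_inv_letter)
  ultimately have "count_list (L.walk (Suc n) ?one (b # r @ [inv_letter c])) (L.flip (Suc n) (?one, b)) = 0"
    unfolding wk fl by simp
  with 1 show "fl (Suc n) (b # r @ [inv_letter c]) (?one, b) = 1" by (simp add: L.flow_def)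
qed

text \<open>The ends of an arc with nonzero flow are values of prefixes of w. This confines the flow
  of a word to a ball of radius |w|.\<close>

lemma fl_support:
  assumes "w \<in> W" "L.flow n (L.walk n \<one>\<^bsub>Sol n\<^esub> w) (h, l) \<noteq> 0" "h \<in> carrier (Sol n)" "l \<in> L.letters"
  shows "\<exists>p \<in> W. h = L.ev n p \<and> length p \<le> length w"
proof -
  have pre: "(\<exists>p q. w = p @ q \<and> fst e = L.ev n p) \<and> (\<exists>p q. w = p @ q \<and> L.head n e = L.ev n p)"
    if e: "e \<in> set (L.walk n \<one>\<^bsub>Sol n\<^esub> w)" for e
  proof -
    have path: "L.path n \<one>\<^bsub>Sol n\<^esub> (L.walk n \<one>\<^bsub>Sol n\<^esub> w) (L.ev n w)"
      using L.path_walk[of "\<one>\<^bsub>Sol n\<^esub>" n w] assms(1) by simp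
    have 1: "\<exists>p q. w = p @ q \<and> x = L.ev n p"
      if "L.walk n \<one>\<^bsub>Sol n\<^esub> w = P1 @ P2" "L.path n \<one>\<^bsub>Sol n\<^esub> P1 x" for P1 P2 x
    proof -
      have "w = map snd P1 @ map snd P2" using arg_cong[OF that(1), of "map snd"] by simp
      then show ?thesis using L.path_is_walk[OF that(2)] L.ev_closed by auto
    qed
    show ?thesis
    proof
      show "\<exists>p q. w = p @ q \<and> fst e = L.ev n p" by (rule L.path_split_src[OF path e]) (rule 1)
      show "\<exists>p q. w = p @ q \<and> L.head n e = L.ev n p" by (rule L.path_split_tgt[OF path e]) (rule 1)
    qed
  qed
  have "(h, l) \<in> set (L.walk n \<one>\<^bsub>Sol n\<^esub> w) \<or> L.flip n (h, l) \<in> set (L.walk n \<one>\<^bsub>Sol n\<^esub> w)"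
    using L.flow_nonzeroD assms(2) by blast
  then obtain p q where "w = p @ q" "h = L.ev n p"
  proof
    assume "(h, l) \<in> set (L.walk n \<one>\<^bsub>Sol n\<^esub> w)"
    from pre[OF this] show ?thesis using that by auto
  next
    assume f: "L.flip n (h, l) \<in> set (L.walk n \<one>\<^bsub>Sol n\<^esub> w)"
    have "L.head n (L.flip n (h, l)) = h" using assms(3,4) by (simp add: L.lv_inv_letter L.m_assoc)
    then show ?thesis using pre[OF f] that by metis
  qed
  then show ?thesis using assms(1) by (intro bexI[of _ p]) auto
qed

lemma far_along_split:
  assumes "g \<in> W" "u \<in> W" "v \<in> W" "L.far_along n D (L.ev n g) u" "L.far_along n D (L.ev n (g @ u)) v"
  shows "L.far_along n D (L.ev n g) (u @ v)"
  using assms by (simp add: L.far_along_append L.ev_append)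

text \<open>Let \<open>\<alpha>\<close> be a word of nonzero flow that is trivial on level \<open>n + 1\<close>. The conjugates \<open>X\<close> and \<open>Y\<close> of
  \<open>\<alpha>\<^sup>K\<close> by \<open>b\<^sup>M\<close> and \<open>c\<^sup>M\<close> commute on level \<open>n + 2\<close>, and \<open>[X, Y]\<close> starts with \<open>b\<^sup>D\<close> and ends with
  \<open>c\<^sup>-\<^sup>D\<close>. Along the powers of \<open>\<alpha>\<close> the path is far from the identity by its exponent sums, and near
  \<open>X\<close>, \<open>X Y\<close> and \<open>Y\<close> by its flow.\<close>

lemma detour_Suc:
  assumes m: "m > 1" and step: "\<And>b c. \<lbrakk>b \<in> L.letters; c \<in> L.letters; b \<noteq> c\<rbrakk> \<Longrightarrow> \<exists>r. detour (Suc n) 1 b c r"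
    and b: "b \<in> L.letters" and c: "c \<in> L.letters" and bc: "b \<noteq> c"
  shows "\<exists>r. detour (Suc (Suc n)) D b c r"
proof -
  define b0 c0 where "b0 = (0 :: nat, True)" and "c0 = (1 :: nat, True)"
  have b0c0: "b0 \<in> L.letters" "c0 \<in> L.letters" "b0 \<noteq> c0" using m by (auto simp: b0_def c0_def L.letters_def)
  obtain r0 where r0: "detour (Suc n) 1 b0 c0 r0" using step b0c0 by blast
  define \<alpha> where "\<alpha> = b0 # r0 @ [inv_letter c0]"
  have \<alpha>W: "\<alpha> \<in> W" using r0 b0c0 by (simp add: \<alpha>_def detour_def)
  have \<alpha>1: "L.ev (Suc n) \<alpha> = \<one>\<^bsub>Sol (Suc n)\<^esub>" and \<alpha>fl: "fl (Suc n) \<alpha> (\<one>\<^bsub>Sol (Suc n)\<^esub>, b0) = 1"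
    using detour_flow[OF r0 b0c0] by (simp_all add: \<alpha>_def)
  have \<alpha>exp: "expsum x \<alpha> = 0" if "x < m" for x
    using expsum_eq[OF \<alpha>W, of "[]" n x] \<alpha>1 that by simp
  \<comment> \<open>M > |\<alpha>| puts the base arc of either conjugate outside the support of the
    other one, and M \<ge> D + |\<alpha>| keeps the powers of \<alpha> at distance D. The flow K = D
    + M leaves room for a further path of length M.\<close>
  define M where "M = D + length \<alpha> + 1"
  define K where "K = D + M"
  define A where "A = concat (replicate K \<alpha>)"
  have A: "A \<in> W" "L.ev (Suc n) A = \<one>\<^bsub>Sol (Suc n)\<^esub>" using \<alpha>W \<alpha>1 L.ev_power_one by (auto simp: A_def)
  have Ainv: "word_inv A = concat (replicate K (word_inv \<alpha>))" by (simp add: A_def word_inv_power)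
  have Aexp: "expsum x A = 0" if "x < m" for x using \<alpha>exp[OF that] by (simp add: A_def expsum_power)
  define B C where "B = replicate M b" and "C = replicate M c"
  have BC: "B \<in> W" "C \<in> W" using b c by (auto simp: B_def C_def)
  have bm: "fst b < m" "fst c < m" using b c by (auto simp: L.letters_def)
  have Bexp: "\<bar>expsum (fst b) B\<bar> = int M" "\<bar>expsum (fst c) C\<bar> = int M" by (auto simp: B_def C_def)
  define X Y where "X = B @ A @ word_inv B" and "Y = C @ A @ word_inv C"
  have XY: "X \<in> W" "Y \<in> W" using A BC by (auto simp: X_def Y_def)
  have XYexp: "expsum x X = 0" "expsum x Y = 0" if "x < m" for x using Aexp[OF that] by (auto simp: X_def Y_def)
  let ?n = "Suc n" and ?k = "Suc (Suc n)"
  have XY1: "L.ev ?n X = \<one>\<^bsub>Sol ?n\<^esub>" "L.ev ?n Y = \<one>\<^bsub>Sol ?n\<^esub>"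
    using A BC by (simp_all add: X_def Y_def L.ev_append L.ev_word_inv)
  have conj: "fl ?n (u @ A @ word_inv u) (L.ev ?n v, b0) =
      int K * fl ?n \<alpha> (inv\<^bsub>Sol ?n\<^esub> (L.ev ?n u) \<otimes>\<^bsub>Sol ?n\<^esub> L.ev ?n v, b0)" if "u \<in> W" "v \<in> W" for u v
    using fl_conjugate[OF that(1) A, of "L.ev ?n v" b0] fl_power_closed[OF \<alpha>W \<alpha>1, of K] that b0c0
    by (simp add: A_def)
  have same: "fl ?n (u @ A @ word_inv u) (L.ev ?n u, b0) = int K" if "u \<in> W" for u
    using conj[OF that that] \<alpha>fl that by simp
  have diff: "fl ?n (u @ A @ word_inv u) (L.ev ?n v, b0) = 0"
    if "u \<in> W" "v \<in> W" "x < m" "\<bar>expsum x v - expsum x u\<bar> \<ge> int M" for u v x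
  proof (rule ccontr)
    assume "fl ?n (u @ A @ word_inv u) (L.ev ?n v, b0) \<noteq> 0"
    then have "fl ?n \<alpha> (L.ev ?n (word_inv u @ v), b0) \<noteq> 0"
      using conj[OF that(1,2)] that by (simp add: L.ev_append L.ev_word_inv)
    moreover have "L.ev ?n (word_inv u @ v) \<in> carrier (Sol ?n)" using that by simp
    ultimately obtain p where p: "p \<in> W" "L.ev ?n (word_inv u @ v) = L.ev ?n p" "length p \<le> length \<alpha>"
      using fl_support[OF \<alpha>W _ _ b0c0(1)] by blast
    have "expsum x (word_inv u @ v) = expsum x p" using expsum_eq[OF _ p(1,2) that(3)] that by simp
    then show False using abs_expsum_le[of x p] p(3) that(4) by (auto simp: M_def)
  qed
  \<comment> \<open>For c = b^-1 the exponent sums of B and C differ by 2 M, and for distinct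
    generators by M.\<close>
  have sep: "\<exists>x < m. int M \<le> \<bar>expsum x C - expsum x B\<bar>"
  proof (cases "fst b = fst c")
    case True
    then have "snd b \<noteq> snd c" using bc by (simp add: prod_eq_iff)
    then show ?thesis using bm True by (intro exI[of _ "fst b"]) (auto simp: B_def C_def)
  next
    case False
    then show ?thesis using bm by (intro exI[of _ "fst b"]) (auto simp: B_def C_def)
  qed
  then obtain x where x: "x < m" "int M \<le> \<bar>expsum x C - expsum x B\<bar>" by blast
  \<comment> \<open>Each of X, X Y and Y has flow K at one of the two base arcs, because the other
    conjugate contributes nothing there.\<close>
  have flX: "fl ?n X (L.ev ?n B, b0) = int K" "fl ?n X (L.ev ?n C, b0) = 0"
    using same[OF BC(1)] diff[OF BC x] by (auto simp: X_def)
  have flY: "fl ?n Y (L.ev ?n C, b0) = int K" "fl ?n Y (L.ev ?n B, b0) = 0"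
    using same[OF BC(2)] diff[OF BC(2,1) x(1)] x(2) by (auto simp: Y_def)
  have arc: "(L.ev ?n B, b0) \<in> L.arcs ?n" "(L.ev ?n C, b0) \<in> L.arcs ?n" using BC b0c0 by auto
  have farX: "L.far ?k (D + M) (L.ev ?k X)"
    using far_flow[OF XY(1) arc(1)] flX by (simp add: K_def)
  have farY: "L.far ?k (D + M) (L.ev ?k Y)"
    using far_flow[OF XY(2) arc(2)] flY by (simp add: K_def)
  have farXY: "L.far ?k (D + M) (L.ev ?k (X @ Y))"
    using far_flow[OF _ arc(1), of "X @ Y"] flX flY XY fl_append_closed[OF XY XY1(1)] by (simp add: K_def)
  have lenBC: "length B = M" "length C = M" by (simp_all add: B_def C_def)
  have com: "L.ev ?k X \<otimes>\<^bsub>Sol ?k\<^esub> L.ev ?k Y = L.ev ?k Y \<otimes>\<^bsub>Sol ?k\<^esub> L.ev ?k X"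
    using ev_Suc_commute[OF XY XY1] .
  have XYX: "L.ev ?k (X @ Y @ word_inv X) = L.ev ?k Y"
  proof -
    have "L.ev ?k (X @ Y @ word_inv X) = L.ev ?k X \<otimes>\<^bsub>Sol ?k\<^esub> L.ev ?k Y \<otimes>\<^bsub>Sol ?k\<^esub> inv\<^bsub>Sol ?k\<^esub> (L.ev ?k X)"
      using XY by (simp add: L.ev_append L.ev_word_inv L.m_assoc)
    then show ?thesis unfolding com using XY by (simp add: L.m_assoc)
  qed
  have near: "L.far_along ?k D (L.ev ?k Z) V"
    if "Z \<in> W" "V \<in> W" "length V = M" "L.far ?k (D + M) (L.ev ?k Z)" for Z V
    using L.far_along_near[of ?k D V "L.ev ?k Z"] that by simp
  \<comment> \<open>A path of length M that ends at a far vertex Z' is followed backwards from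
    Z'.\<close>
  have retrace: "L.far_along ?k D (L.ev ?k Z) (word_inv V)"
    if "Z \<in> W" "V \<in> W" "Z' \<in> W" "length V = M" "L.far ?k (D + M) (L.ev ?k Z')"
      "L.ev ?k (Z @ word_inv V) = L.ev ?k Z'" for Z V Z'
  proof -
    have "L.far_along ?k D (L.ev ?k Z') V" using near that by blast
    then have "L.far_along ?k D (L.ev ?k Z' \<otimes>\<^bsub>Sol ?k\<^esub> L.ev ?k V) (word_inv V)"
      using L.far_along_rev that by simp
    moreover have "L.ev ?k Z' \<otimes>\<^bsub>Sol ?k\<^esub> L.ev ?k V = L.ev ?k Z"
      unfolding that(6)[symmetric] using that(1,2) by (simp add: L.ev_append L.ev_word_inv L.m_assoc)
    ultimately show ?thesis by simp
  qed
  have pow_far: "L.far_along ?k D (L.ev ?k Z) A" "L.far_along ?k D (L.ev ?k Z) (word_inv A)"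
    if "Z \<in> W" "y < m" "\<bar>expsum y Z\<bar> = int M" for Z y
    unfolding Ainv unfolding A_def
    using that \<alpha>W \<alpha>exp[OF that(2)] by (auto intro!: far_along_power_closed[of _ _ y] simp: M_def)
  \<comment> \<open>The detour runs from b^D to c^D and not from the identity to itself, so the
    first b^M and the last c^-M of the commutator are shortened by D letters.\<close>
  define U V
    where "U = replicate (M - D) b" and "V = replicate (M - D) c"
  have UV: "U \<in> W" "V \<in> W" using b c by (auto simp: U_def V_def)
  have DB: "replicate D b @ U = B" and DC: "replicate D c @ V = C"
    unfolding U_def V_def B_def C_def replicate_add[symmetric] by (simp_all add: M_def)
  have DW: "replicate D b \<in> W" "replicate D c \<in> W" using b c by auto
  \<comment> \<open>On level n + 2 the conjugate X Y X^-1 equals Y = C A C^-1, so the remaining C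
    A^-1 brings the path to C.\<close>
  have C12: "L.ev ?k (X @ Y @ word_inv X @ C @ word_inv A) = L.ev ?k C"
  proof -
    have "L.ev ?k (X @ Y @ word_inv X @ C @ word_inv A) = L.ev ?k (X @ Y @ word_inv X) \<otimes>\<^bsub>Sol ?k\<^esub> L.ev ?k (C @ word_inv A)"
      using XY BC A by (simp add: L.ev_append L.m_assoc)
    also have "\<dots> = L.ev ?k (C @ A @ word_inv C @ C @ word_inv A)"
      unfolding XYX using XY BC A by (simp add: Y_def L.ev_append L.m_assoc)
    also have "\<dots> = L.ev ?k C"
    proof -
      have "L.ev ?k A \<otimes>\<^bsub>Sol ?k\<^esub> (inv\<^bsub>Sol ?k\<^esub> (L.ev ?k C) \<otimes>\<^bsub>Sol ?k\<^esub> (L.ev ?k C \<otimes>\<^bsub>Sol ?k\<^esub> inv\<^bsub>Sol ?k\<^esub> (L.ev ?k A))) = \<one>\<^bsub>Sol ?k\<^esub>"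
        using BC A by (simp add: L.m_assoc[symmetric])
      then show ?thesis using BC A by (simp add: L.ev_append L.ev_word_inv)
    qed
    finally show ?thesis .
  qed
  have ray: "L.far_along ?k D (L.ev ?k C) (word_inv V)"
  proof -
    have "L.far_along ?k D (L.ev ?k (replicate D c)) V" unfolding V_def using far_along_ray c by simp
    then have "L.far_along ?k D (L.ev ?k (replicate D c) \<otimes>\<^bsub>Sol ?k\<^esub> L.ev ?k V) (word_inv V)"
      using L.far_along_rev DW UV by simp
    then show ?thesis using DC DW UV L.ev_append by metis
  qed
  define r where "r = U @ A @ word_inv B @ C @ A @ word_inv C @ B @ word_inv A @ word_inv B @ C @ word_inv A @ word_inv V"
  have s1: "L.far_along ?k D (L.ev ?k (replicate D b)) U" unfolding U_def using far_along_ray b by simp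
  have s2: "L.far_along ?k D (L.ev ?k B) A" using pow_far(1) BC bm Bexp by blast
  have s3: "L.far_along ?k D (L.ev ?k (B @ A)) (word_inv B)"
    using retrace[of "B @ A" B X] BC A XY farX lenBC by (simp add: X_def)
  have s4: "L.far_along ?k D (L.ev ?k X) C" using near XY BC farX lenBC by blast
  have s5: "L.far_along ?k D (L.ev ?k (X @ C)) A"
    using pow_far(1)[of "X @ C" "fst c"] BC XY bm Bexp XYexp by simp
  have s6: "L.far_along ?k D (L.ev ?k (X @ C @ A)) (word_inv C)"
    using retrace[of "X @ C @ A" C "X @ Y"] BC A XY farXY lenBC by (simp add: Y_def)
  have s7: "L.far_along ?k D (L.ev ?k (X @ Y)) B" using near[of "X @ Y" B] XY BC farXY lenBC by simp
  have s8: "L.far_along ?k D (L.ev ?k (X @ Y @ B)) (word_inv A)"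
    using pow_far(2)[of "X @ Y @ B" "fst b"] BC XY bm Bexp XYexp by simp
  have XA: "word_inv X = B @ word_inv A @ word_inv B" by (simp add: X_def)
  have s9: "L.far_along ?k D (L.ev ?k (X @ Y @ B @ word_inv A)) (word_inv B)"
    using retrace[of "X @ Y @ B @ word_inv A" B Y] BC A XY farY lenBC XYX by (simp add: XA)
  have s10: "L.far_along ?k D (L.ev ?k (X @ Y @ word_inv X)) C"
    unfolding XYX using near XY BC farY lenBC by blast
  have s11: "L.far_along ?k D (L.ev ?k (X @ Y @ word_inv X @ C)) (word_inv A)"
    using pow_far(2)[of "X @ Y @ word_inv X @ C" "fst c"] BC XY bm Bexp XYexp by simp
  have s12: "L.far_along ?k D (L.ev ?k (X @ Y @ word_inv X @ C @ word_inv A)) (word_inv V)"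
    unfolding C12 by (rule ray)
  have Xs: "B @ A @ word_inv B @ Z = X @ Z" "C @ A @ word_inv C @ Z = Y @ Z"
    "B @ word_inv A @ word_inv B @ Z = word_inv X @ Z" for Z
    by (simp_all add: X_def Y_def)
  have DBZ: "replicate D b @ U @ Z = B @ Z" for Z using DB by (metis append_assoc)
  note W = DW UV BC A(1) XY
  have f11: "L.far_along ?k D (L.ev ?k (X @ Y @ word_inv X @ C)) (word_inv A @ word_inv V)"
    by (rule far_along_split[OF _ _ _ s11]) (use W s12 in \<open>simp_all\<close>)
  have f10: "L.far_along ?k D (L.ev ?k (X @ Y @ word_inv X)) (C @ word_inv A @ word_inv V)"
    by (rule far_along_split[OF _ _ _ s10]) (use W f11 in \<open>simp_all\<close>)
  have f9: "L.far_along ?k D (L.ev ?k (X @ Y @ B @ word_inv A)) (word_inv B @ C @ word_inv A @ word_inv V)"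
    by (rule far_along_split[OF _ _ _ s9]) (use W f10[unfolded XA] in \<open>simp_all\<close>)
  have f8: "L.far_along ?k D (L.ev ?k (X @ Y @ B)) (word_inv A @ word_inv B @ C @ word_inv A @ word_inv V)"
    by (rule far_along_split[OF _ _ _ s8]) (use W f9 in \<open>simp_all\<close>)
  have f7: "L.far_along ?k D (L.ev ?k (X @ Y)) (B @ word_inv A @ word_inv B @ C @ word_inv A @ word_inv V)"
    by (rule far_along_split[OF _ _ _ s7]) (use W f8 in \<open>simp_all\<close>)
  have f6: "L.far_along ?k D (L.ev ?k (X @ C @ A)) (word_inv C @ B @ word_inv A @ word_inv B @ C @ word_inv A @ word_inv V)"
    by (rule far_along_split[OF _ _ _ s6]) (use W f7[unfolded Y_def] in \<open>simp_all\<close>)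
  have f5: "L.far_along ?k D (L.ev ?k (X @ C)) (A @ word_inv C @ B @ word_inv A @ word_inv B @ C @ word_inv A @ word_inv V)"
    by (rule far_along_split[OF _ _ _ s5]) (use W f6 in \<open>simp_all\<close>)
  have f4: "L.far_along ?k D (L.ev ?k (X)) (C @ A @ word_inv C @ B @ word_inv A @ word_inv B @ C @ word_inv A @ word_inv V)"
    by (rule far_along_split[OF _ _ _ s4]) (use W f5 in \<open>simp_all\<close>)
  have f3: "L.far_along ?k D (L.ev ?k (B @ A)) (word_inv B @ C @ A @ word_inv C @ B @ word_inv A @ word_inv B @ C @ word_inv A @ word_inv V)"
    by (rule far_along_split[OF _ _ _ s3]) (use W f4[unfolded X_def] in \<open>simp_all\<close>)
  have f2: "L.far_along ?k D (L.ev ?k (B)) (A @ word_inv B @ C @ A @ word_inv C @ B @ word_inv A @ word_inv B @ C @ word_inv A @ word_inv V)"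
    by (rule far_along_split[OF _ _ _ s2]) (use W f3 in \<open>simp_all\<close>)
  have f1: "L.far_along ?k D (L.ev ?k (replicate D b)) (U @ A @ word_inv B @ C @ A @ word_inv C @ B @ word_inv A @ word_inv B @ C @ word_inv A @ word_inv V)"
    by (rule far_along_split[OF _ _ _ s1]) (use W f2 in \<open>simp_all add: DB\<close>)
  have "L.far_along ?k D (L.ev ?k (replicate D b)) r" unfolding r_def by (rule f1)
  moreover have "L.ev ?k (replicate D b @ r) = L.ev ?k (replicate D c)"
  proof -
    have "replicate D b @ r = (X @ Y @ word_inv X @ C @ word_inv A) @ word_inv V"
      by (simp only: r_def DBZ Xs append_assoc)
    then have "L.ev ?k (replicate D b @ r) = L.ev ?k C \<otimes>\<^bsub>Sol ?k\<^esub> inv\<^bsub>Sol ?k\<^esub> (L.ev ?k V)"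
      using W C12 L.ev_append[of "X @ Y @ word_inv X @ C @ word_inv A" "word_inv V" ?k] by (simp add: L.ev_word_inv)
    also have "L.ev ?k C = L.ev ?k (replicate D c) \<otimes>\<^bsub>Sol ?k\<^esub> L.ev ?k V"
      using DC DW UV L.ev_append by metis
    finally show ?thesis using W by (simp add: L.m_assoc)
  qed
  moreover have "r \<in> W" using W by (simp add: r_def)
  ultimately show ?thesis unfolding detour_def by blast
qed

text \<open>From the level below only a detour of radius 1 enters, to supply a loop of nonzero flow;
  large powers of that loop produce every radius D.\<close>

theorem detour_exists:
  assumes "m > 1" "b \<in> L.letters" "c \<in> L.letters" "b \<noteq> c"
  shows "\<exists>r. detour (Suc n) D b c r"
  using assms(2-4)
proof (induction n arbitrary: b c D)
  case 0
  then show ?case using detour_1 assms(1) by blast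
next
  case (Suc n)
  then show ?case using detour_Suc[OF assms(1)] by blast
qed

end

section \<open>A circuit outside the ball\<close>

lemma freely_reduced_append_iff:
  "freely_reduced (u @ v) \<longleftrightarrow> freely_reduced u \<and> freely_reduced v \<and>
     (u \<noteq> [] \<longrightarrow> v \<noteq> [] \<longrightarrow> hd v \<noteq> inv_letter (last u))"
  by (auto simp: freely_reduced_def successively_append_iff)

lemma freely_reduced_word_inv: "freely_reduced w \<Longrightarrow> freely_reduced (word_inv w)"
proof (induction w)
  case (Cons l w)
  show ?case
  proof (cases w)
    case (Cons k v)
    then have "k \<noteq> inv_letter l" "freely_reduced w" using Cons.prems by (auto simp: freely_reduced_def)
    moreover have "last (word_inv w) = inv_letter k" using Cons by simp
    moreover have "freely_reduced [inv_letter l]" by (simp add: freely_reduced_def)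
    ultimately show ?thesis
      using Cons.IH freely_reduced_append_iff[of "word_inv w" "[inv_letter l]"] by auto
  qed (simp add: freely_reduced_def)
qed simp

lemma strip_common_prefix:
  assumes "freely_reduced u" "freely_reduced v" "u \<noteq> v"
  obtains p u' v' where "u = p @ u'" "v = p @ v'" "freely_reduced (word_inv u' @ v')" "word_inv u' @ v' \<noteq> []"
  using assms
proof (induction u arbitrary: v thesis)
  case Nil
  then show ?case by (intro Nil.prems(1)[of "[]" "[]" v]) auto
next
  case (Cons l u)
  show ?case
  proof (cases "\<exists>v1. v = l # v1")
    case True
    then obtain v1 where v1: "v = l # v1" by blast
    then have "freely_reduced u" "freely_reduced v1" "u \<noteq> v1"
      using Cons.prems freely_reduced_ConsD[of l u] freely_reduced_ConsD[of l v1] by auto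
    then obtain p u' v' where "u = p @ u'" "v1 = p @ v'" "freely_reduced (word_inv u' @ v')" "word_inv u' @ v' \<noteq> []"
      using Cons.IH by blast
    then show ?thesis using v1 Cons.prems(1)[of "l # p" u' v'] by simp
  next
    case False
    have "freely_reduced (word_inv (l # u) @ v)"
      unfolding freely_reduced_append_iff[of "word_inv (l # u)" v]
      using False Cons.prems(3) freely_reduced_word_inv[OF Cons.prems(2)] by (cases v) auto
    then show ?thesis using Cons.prems(1)[of "[]" "l # u" v] by simp
  qed
qed

text \<open>Cutting off the powers of a at both ends turns a word with value in the line into an
  excursion, or leaves nothing.\<close>

lemma trim_generator:
  obtains s x t where "w = s @ x @ t" "fst ` set s \<subseteq> {a}" "fst ` set t \<subseteq> {a}"
    "x \<noteq> [] \<longrightarrow> fst (hd x) \<noteq> a \<and> fst (last x) \<noteq> a"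
proof -
  let ?P = "\<lambda>l. fst l = a"
  define s y where "s = takeWhile ?P w" and "y = dropWhile ?P w"
  define x t where "x = rev (dropWhile ?P (rev y))" and "t = rev (takeWhile ?P (rev y))"
  have y: "y = x @ t" unfolding x_def t_def rev_append[symmetric] by simp
  have "w = s @ y" by (simp add: s_def y_def)
  then have "w = s @ x @ t" by (simp add: y)
  moreover have "fst ` set s \<subseteq> {a}" "fst ` set t \<subseteq> {a}"
    by (auto simp: s_def t_def dest: set_takeWhileD)
  moreover have "fst (hd x) \<noteq> a \<and> fst (last x) \<noteq> a" if "x \<noteq> []"
  proof
    have "hd y = hd x" "y \<noteq> []" using y that by auto
    then show "fst (hd x) \<noteq> a" using hd_dropWhile[of ?P w] by (simp add: y_def)
    show "fst (last x) \<noteq> a" using that hd_dropWhile[of ?P "rev y"] by (simp add: x_def last_rev)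
  qed
  ultimately show thesis using that by blast
qed

context marked_group
begin

definition norm :: "'a \<Rightarrow> nat" where
  "norm g = (LEAST j. \<exists>w \<in> words. ev w = g \<and> length w = j)"

lemma norm_le: "w \<in> words \<Longrightarrow> norm (ev w) \<le> length w"
  unfolding norm_def by (rule Least_le) auto

lemma norm_attained:
  assumes "g \<in> ev ` words"
  obtains w where "w \<in> words" "ev w = g" "length w = norm g"
proof -
  have "\<exists>w \<in> words. ev w = g \<and> length w = norm g"
    unfolding norm_def by (rule LeastI_ex) (use assms in auto)
  then show thesis using that by blast
qed

lemma far_iff_norm: "g \<in> ev ` words \<Longrightarrow> far D g \<longleftrightarrow> D \<le> norm g"
  unfolding far_def using norm_le by (metis norm_attained order_trans)

lemma norm_step:
  assumes "g \<in> ev ` words" "l \<in> letters"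
  shows "norm (g \<otimes> lv l) \<le> Suc (norm g)" "norm g \<le> Suc (norm (g \<otimes> lv l))"
proof -
  have *: "norm (g \<otimes> lv l) \<le> Suc (norm g)" if g: "g \<in> ev ` words" and l: "l \<in> letters" for g l
  proof -
    obtain w where w: "w \<in> words" "ev w = g" "length w = norm g" using norm_attained[OF g] by blast
    then have "ev (w @ [l]) = g \<otimes> lv l" using l by (simp add: ev_append)
    then show ?thesis using norm_le[of "w @ [l]"] w l by simp
  qed
  show "norm (g \<otimes> lv l) \<le> Suc (norm g)" using * assms by blast
  obtain w where w: "w \<in> words" "ev w = g" using assms by blast
  then have "g \<otimes> lv l = ev (w @ [l])" using assms by (simp add: ev_append)
  then have "g \<otimes> lv l \<in> ev ` words" using w assms by (auto intro!: image_eqI)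
  moreover have "g \<otimes> lv l \<otimes> lv (inv_letter l) = g"
    using w assms by (simp add: lv_inv_letter m_assoc ev_closed[of w, unfolded w(2)])
  ultimately show "norm g \<le> Suc (norm (g \<otimes> lv l))" using *[of "g \<otimes> lv l" "inv_letter l"] assms by simp
qed

end

context free_soluble
begin

section \<open>Small balls are trees, and rays leave them\<close>

text \<open>Two different words would leave, after removal of the common prefix, a nonempty reduced
  closed word shorter than the girth.\<close>

lemma reduced_words_injective:
  assumes "girth_ge n \<gamma>" "u \<in> W" "v \<in> W" "freely_reduced u" "freely_reduced v"
    "L.ev n u = L.ev n v" "length u + length v < \<gamma>"
  shows "u = v"
proof (rule ccontr)
  assume "u \<noteq> v"
  then obtain p u' v' where p: "u = p @ u'" "v = p @ v'" "freely_reduced (word_inv u' @ v')" "word_inv u' @ v' \<noteq> []"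
    using strip_common_prefix assms(4,5) by blast
  have W: "p \<in> W" "u' \<in> W" "v' \<in> W" using p assms(2,3) by auto
  then have "L.ev n u' = L.ev n v'" using assms(6) p by (simp add: L.ev_append)
  then have "L.ev n (word_inv u' @ v') = \<one>\<^bsub>Sol n\<^esub>" using W by (simp add: L.ev_append L.ev_word_inv)
  moreover have "word_inv u' @ v' \<in> W" using W by simp
  ultimately have "\<gamma> \<le> length (word_inv u' @ v')" using assms(1) p unfolding girth_ge_def by blast
  then show False using p assms(7) by simp
qed

lemma far_reduced_word:
  assumes "girth_ge n \<gamma>" "w \<in> W" "freely_reduced w" "2 * length w \<le> \<gamma>"
  shows "L.far n (length w) (L.ev n w)"
  unfolding L.far_def
proof (intro ballI impI, rule ccontr)
  fix v assume v: "v \<in> W" "L.ev n v = L.ev n w" "\<not> length w \<le> length v"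
  have "reduce_word v = w"
    using reduced_words_injective[OF assms(1), of "reduce_word v" w] assms v
      L.reduce_word_words L.freely_reduced_reduce_word[of v] L.ev_reduce_word L.length_reduce_word[of v]
    by simp
  then show False using v(3) L.length_reduce_word[of v] by simp
qed

text \<open>A word v shorter than w with the value of w b^j makes v^-1 w a path from the line < b >
  to itself; trimmed, it is an excursion shorter than 2 |w|.\<close>

lemma far_ray:
  assumes exc: "excursion_ge n \<delta>" and w: "w \<in> W" "freely_reduced w" "w \<noteq> []"
    and b: "b \<in> L.letters" "fst b \<noteq> fst (last w)" and len: "2 * length w \<le> \<delta>"
  shows "L.far n (length w) (L.ev n (w @ replicate j b))"
  unfolding L.far_def
proof (intro ballI impI, rule ccontr)
  fix v0 assume v0: "v0 \<in> W" "L.ev n v0 = L.ev n (w @ replicate j b)" "\<not> length w \<le> length v0"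
  define v where "v = reduce_word v0"
  have v: "v \<in> W" "freely_reduced v" "L.ev n v = L.ev n (w @ replicate j b)" "length v < length w"
    using v0 L.reduce_word_words L.freely_reduced_reduce_word[of v0] L.ev_reduce_word L.length_reduce_word[of v0]
    by (auto simp: v_def)
  define a where "a = fst b"
  have am: "a < m" using b by (simp add: a_def L.letters_def)
  have "v \<noteq> w" using v by auto
  then obtain p v' w' where p: "v = p @ v'" "w = p @ w'" "freely_reduced (word_inv v' @ w')" "word_inv v' @ w' \<noteq> []"
    using strip_common_prefix v w by blast
  have W: "p \<in> W" "v' \<in> W" "w' \<in> W" "replicate j b \<in> W" using p v w b by auto
  have w'ne: "w' \<noteq> []" using p v(4) by auto
  obtain s x t where x: "word_inv v' @ w' = s @ x @ t" "fst ` set s \<subseteq> {a}" "fst ` set t \<subseteq> {a}"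
    "x \<noteq> [] \<longrightarrow> fst (hd x) \<noteq> a \<and> fst (last x) \<noteq> a"
    by (rule trim_generator[of "word_inv v' @ w'" a])
  have "word_inv v' @ w' \<in> W" using W by simp
  then have xW: "s \<in> W" "x \<in> W" "t \<in> W" using x(1) by auto
  \<comment> \<open>The last letter of w survives the cancellation and belongs to another generator
    than b.\<close>
  have "x \<noteq> []"
  proof
    assume "x = []"
    then have "fst ` set (word_inv v' @ w') \<subseteq> {a}" using x by auto
    moreover have "last w \<in> set w'" using p w'ne by simp
    ultimately show False using b by (auto simp: a_def)
  qed
  have "L.ev n v' = L.ev n (w' @ replicate j b)" using v(3) W p by (simp add: L.ev_append L.m_assoc)
  then have "L.ev n (word_inv v' @ w') = L.ev n (word_inv (replicate j b))"
    using W by (simp add: L.ev_append L.ev_word_inv L.inv_mult_group L.m_assoc)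
  then have "L.ev n (s @ x @ t) \<in> line n a"
    unfolding x(1)[symmetric] line_def by (intro image_eqI) (auto simp: a_def word_inv_replicate)
  moreover have st: "L.ev n s \<in> line n a" "L.ev n t \<in> line n a" using x by (auto simp: line_def)
  moreover have "L.ev n x = inv\<^bsub>Sol n\<^esub> (L.ev n s) \<otimes>\<^bsub>Sol n\<^esub> L.ev n (s @ x @ t) \<otimes>\<^bsub>Sol n\<^esub> inv\<^bsub>Sol n\<^esub> (L.ev n t)"
  proof -
    have "inv\<^bsub>Sol n\<^esub> (L.ev n s) \<otimes>\<^bsub>Sol n\<^esub> (L.ev n s \<otimes>\<^bsub>Sol n\<^esub> L.ev n x) = L.ev n x"
      using xW by (simp add: L.m_assoc[symmetric])
    then show ?thesis using xW by (simp add: L.ev_append L.m_assoc)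
  qed
  ultimately have "L.ev n x \<in> line n a" using line_closed(3,4)[OF am] by metis
  moreover have "freely_reduced x" using p(3) unfolding x(1) by (simp add: freely_reduced_append_iff)
  ultimately have "\<delta> \<le> length x" using exc am xW x(4) \<open>x \<noteq> []\<close> unfolding excursion_ge_def by blast
  also have "\<dots> \<le> length (word_inv v' @ w')" unfolding x(1) by simp
  also have "\<dots> < 2 * length w" using p v(4) by simp
  finally show False using len by simp
qed

section \<open>The subgraph outside the ball\<close>

definition outer :: "nat \<Rightarrow> nat \<Rightarrow> ((nat \<times> bool) list set \<times> (nat \<times> bool)) set" where
  "outer n k = {e \<in> L.arcs n. L.far n k (fst e) \<and> L.far n k (L.head n e)}"

text \<open>Closed paths and cyclic edges are henceforth also taken inside this subgraph: an arc on
  a cycle of the Cayley graph can be a bridge outside the ball.\<close>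

sublocale O: graph_with_reversal fst "L.head n" "L.flip n" "outer n k" for n k
proof
  fix e assume e: "e \<in> outer n k"
  then have ea: "e \<in> L.arcs n" by (simp add: outer_def)
  show "L.flip n (L.flip n e) = e" "L.flip n e \<noteq> e" "fst (L.flip n e) = L.head n e"
    using ea L.rv_rv L.rv_neq L.src_rv by blast+
  show "L.flip n e \<in> outer n k"
    using e L.rv_in[OF ea] L.src_rv[OF ea] L.tgt_rv[OF ea] by (simp add: outer_def)
qed

lemma outer_path_iff: "O.path n k g P h \<longleftrightarrow> L.path n g P h \<and> set P \<subseteq> outer n k"
proof (induction P arbitrary: g)
  case (Cons e P)
  have "outer n k \<subseteq> L.arcs n" by (auto simp: outer_def)
  then show ?case using Cons by auto
qed simp

lemma far_along_outer:
  "g \<in> carrier (Sol n) \<Longrightarrow> w \<in> W \<Longrightarrow> L.far_along n k g w \<Longrightarrow> set (L.walk n g w) \<subseteq> outer n k"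
  using L.far_along_walk[of n k g w] L.walk_arcs[of g n w] by (auto simp: outer_def)

lemma walk_cyc_conn:
  assumes "g \<in> carrier (Sol n)" "w \<in> W" "set (L.walk n g w) \<subseteq> O.cyclic_edges n k"
  shows "(g, g \<otimes>\<^bsub>Sol n\<^esub> L.ev n w) \<in> O.cyc_conn n k"
  using assms
proof (induction w arbitrary: g)
  case Nil
  then show ?case by (simp add: O.cyc_conn_def)
next
  case (Cons l w)
  have e: "(g, l) \<in> O.cyclic_edges n k" using Cons.prems by simp
  then have "(g, g \<otimes>\<^bsub>Sol n\<^esub> L.lv n l) \<in> O.cyc_conn n k"
    unfolding O.cyc_conn_def by (intro r_into_rtrancl CollectI exI[of _ "(g, l)"]) simp
  moreover have "(g \<otimes>\<^bsub>Sol n\<^esub> L.lv n l, g \<otimes>\<^bsub>Sol n\<^esub> L.lv n l \<otimes>\<^bsub>Sol n\<^esub> L.ev n w) \<in> O.cyc_conn n k"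
    using Cons by simp
  ultimately have "(g, g \<otimes>\<^bsub>Sol n\<^esub> L.lv n l \<otimes>\<^bsub>Sol n\<^esub> L.ev n w) \<in> O.cyc_conn n k"
    by (rule transD[OF O.trans_cyc_conn])
  then show ?case using Cons.prems by (simp add: L.m_assoc)
qed

lemma far_ray_along:
  assumes "\<And>j. L.far n k (L.ev n (w @ replicate j b))" "w \<in> W" "b \<in> L.letters"
  shows "L.far_along n k (L.ev n (w @ replicate i b)) (replicate j b)"
proof (induction j arbitrary: i)
  case 0
  then show ?case using assms by simp
next
  case (Suc j)
  have "L.ev n (w @ replicate i b) \<otimes>\<^bsub>Sol n\<^esub> L.lv n b = L.ev n (w @ replicate (Suc i) b)"
    using assms L.ev_append[of "w @ replicate i b" "[b]" n]
    by (simp add: replicate_append_same)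
  then show ?case using assms(1)[of i] Suc[of "Suc i"] by simp
qed

end

locale sphere = free_soluble +
  fixes n k :: nat
  assumes m: "m > 1" and k: "k > 0" "2 * k + 2 = 4 * 3 ^ n"
begin

abbreviation "\<Gamma> \<equiv> Sol (Suc n)"
abbreviation "eval \<equiv> L.ev (Suc n)"
abbreviation "conn \<equiv> O.cyc_conn (Suc n) k"

definition sphere_words :: "(nat \<times> bool) list set" where
  "sphere_words = {w \<in> W. freely_reduced w \<and> length w = k}"

lemma girth: "girth_ge (Suc n) (2 * k + 2)" and exc: "excursion_ge (Suc n) (2 * k + 1)"
proof -
  have "4 * 3 ^ n - 1 = 2 * k + 1" using k(2) by linarith
  then show "girth_ge (Suc n) (2 * k + 2)" "excursion_ge (Suc n) (2 * k + 1)"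
    using girth_excursion[of n] k(2) by simp_all
qed

lemma conn_trans: "(x, y) \<in> conn \<Longrightarrow> (y, z) \<in> conn \<Longrightarrow> (x, z) \<in> conn"
  by (rule transD[OF O.trans_cyc_conn])

lemma conn_sym: "(x, y) \<in> conn \<Longrightarrow> (y, x) \<in> conn"
  by (rule symD[OF O.sym_cyc_conn])

lemma finite_letters: "finite (L.letters)"
proof -
  have "L.letters = {..<m} \<times> UNIV" by (auto simp: L.letters_def)
  then show ?thesis by simp
qed

text \<open>No arc at the identity is a bridge of \<Gamma>. The uniform bound makes the translated
  loops avoid the ball whenever they start at distance at least k + lp.\<close>

lemma short_loops:
  obtains lp where "\<And>b. b \<in> L.letters \<Longrightarrow>
    \<exists>z \<in> W. length z \<le> lp \<and> eval z = \<one>\<^bsub>\<Gamma>\<^esub> \<and> fl (Suc n) z (\<one>\<^bsub>\<Gamma>\<^esub>, b) \<noteq> 0"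
proof -
  have "\<exists>z \<in> W. eval z = \<one>\<^bsub>\<Gamma>\<^esub> \<and> fl (Suc n) z (\<one>\<^bsub>\<Gamma>\<^esub>, b) \<noteq> 0" if b: "b \<in> L.letters" for b
  proof -
    have c: "inv_letter b \<in> L.letters" "b \<noteq> inv_letter b" using b by auto
    then obtain r where r: "detour (Suc n) 1 b (inv_letter b) r" using detour_exists m b by blast
    then have "r \<in> W" by (simp add: detour_def)
    then show ?thesis using detour_flow[OF r b c] b by (intro bexI[of _ "b # r @ [inv_letter (inv_letter b)]"]) auto
  qed
  then obtain z where z: "\<And>b. b \<in> L.letters \<Longrightarrow> z b \<in> W \<and> eval (z b) = \<one>\<^bsub>\<Gamma>\<^esub> \<and> fl (Suc n) (z b) (\<one>\<^bsub>\<Gamma>\<^esub>, b) \<noteq> 0"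
    by metis
  have "length (z b) \<le> (\<Sum>b \<in> L.letters. length (z b))" if "b \<in> L.letters" for b
    using member_le_sum[OF that, of "\<lambda>b. length (z b)"] finite_letters by simp
  then show thesis using that z by blast
qed

text \<open>Close to the ball short loops could enter it. Instead the rays from w along b and b^-1,
  both outside the ball by \<open>far_ray\<close>, are closed by a translated detour; D \<ge> 2k
  since the translation by w costs k.\<close>

lemma ray_edges_cyclic:
  assumes w: "w \<in> sphere_words" and b: "b \<in> L.letters" "fst b \<noteq> fst (last w)" and D: "2 * k \<le> D" "j < D"
  shows "(eval (w @ replicate j b), b) \<in> O.cyclic_edges (Suc n) k"
proof -
  have wW: "w \<in> W" "freely_reduced w" "w \<noteq> []" "length w = k" using w k by (auto simp: sphere_words_def)
  let ?c = "inv_letter b"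
  have c: "?c \<in> L.letters" "b \<noteq> ?c" "fst ?c \<noteq> fst (last w)" using b by auto
  obtain r where r: "detour (Suc n) D b ?c r" using detour_exists m b c by blast
  define B where "B = replicate D b"
  have C: "replicate D ?c = word_inv B" by (simp add: B_def word_inv_replicate)
  have rW: "r \<in> W" "B \<in> W" and er: "eval (B @ r) = eval (word_inv B)"
    and fr: "L.far_along (Suc n) D (eval B) r" using r b C by (auto simp: detour_def B_def)
  \<comment> \<open>B r leads to b^-D, and the last B returns to the start along the opposite
    ray.\<close>
  define z where "z = B @ r @ B"
  have zW: "z \<in> W" using rW by (simp add: z_def)
  have z1: "eval z = \<one>\<^bsub>\<Gamma>\<^esub>"
  proof -
    have "eval z = eval (B @ r) \<otimes>\<^bsub>\<Gamma>\<^esub> eval B" using rW by (simp add: z_def L.ev_append L.m_assoc)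
    then show ?thesis unfolding er using rW by (simp add: L.ev_word_inv)
  qed
  have fb: "L.far (Suc n) k (eval (w @ replicate j b))" for j
    using far_ray[OF exc wW(1-3) b(1,2), of j] wW(4) by simp
  have fc: "L.far (Suc n) k (eval (w @ replicate j ?c))" for j
    using far_ray[OF exc wW(1-3) c(1,3), of j] wW(4) by simp
  have 1: "L.far_along (Suc n) k (eval w) B"
    using far_ray_along[OF fb wW(1) b(1), of 0 D] by (simp add: B_def)
  have 2: "L.far_along (Suc n) k (eval w \<otimes>\<^bsub>\<Gamma>\<^esub> eval B) r"
  proof -
    have a: "L.far_along (Suc n) (D - k) (eval w \<otimes>\<^bsub>\<Gamma>\<^esub> eval B) r"
      using L.far_along_translate[OF fr, of w] rW wW by simp
    have "L.far_along (Suc n) D' g v \<Longrightarrow> k \<le> D' \<Longrightarrow> L.far_along (Suc n) k g v" for D' g v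
      by (induction v arbitrary: g) (auto intro: L.far_mono)
    from this[OF a] show ?thesis using D by simp
  qed
  have 3: "L.far_along (Suc n) k (eval w \<otimes>\<^bsub>\<Gamma>\<^esub> eval (B @ r)) B"
  proof -
    have "L.far_along (Suc n) k (eval w) (word_inv B)"
      using far_ray_along[OF fc wW(1) c(1), of 0 D] C by simp
    then have "L.far_along (Suc n) k (eval w \<otimes>\<^bsub>\<Gamma>\<^esub> eval (word_inv B)) (word_inv (word_inv B))"
      using L.far_along_rev[of "Suc n" k "eval w" "word_inv B"] rW wW by simp
    then show ?thesis by (simp add: er)
  qed
  have all: "L.far_along (Suc n) k (eval w) z"
    using 1 2 3 rW wW unfolding z_def by (simp add: L.far_along_append L.ev_append L.m_assoc)
  have cl: "O.path (Suc n) k (eval w) (L.walk (Suc n) (eval w) z) (eval w)"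
    using L.path_walk[of "eval w" "Suc n" z] far_along_outer[OF _ zW all] zW wW z1
    by (simp add: outer_path_iff)
  have Bj: "replicate j b \<in> W" using b by simp
  let ?e = "(eval (replicate j b), b)"
  have Bsplit: "B = replicate j b @ b # replicate (D - j - 1) b"
    using D by (simp add: B_def replicate_add[symmetric] flip: replicate_Suc)
  have in1: "?e \<in> set (L.walk (Suc n) \<one>\<^bsub>\<Gamma>\<^esub> B)"
    unfolding Bsplit using Bj b by (simp add: L.walk_append)
  have wz: "L.walk (Suc n) \<one>\<^bsub>\<Gamma>\<^esub> z = L.walk (Suc n) \<one>\<^bsub>\<Gamma>\<^esub> B @ L.walk (Suc n) (eval B) r @ L.walk (Suc n) (eval (B @ r)) B"
    using rW by (simp add: z_def L.walk_append L.ev_append)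
  have "snd f = b" if "f \<in> set (L.walk (Suc n) g B)" for f g
  proof -
    have "snd f \<in> set (map snd (L.walk (Suc n) g B))" using that by (simp only: set_map image_eqI)
    then show ?thesis by (simp add: B_def)
  qed
  then have "L.flip (Suc n) ?e \<notin> set (L.walk (Suc n) g B)" for g
    by (metis L.flip_pair inv_letter_neq(1) snd_conv)
  \<comment> \<open>The reversed arc ends at b^j with j < D, and the detour stays at distance at
    least D.\<close>
  moreover have "L.flip (Suc n) ?e \<notin> set (L.walk (Suc n) (eval B) r)"
  proof
    assume "L.flip (Suc n) ?e \<in> set (L.walk (Suc n) (eval B) r)"
    then have "L.far (Suc n) D (L.head (Suc n) (L.flip (Suc n) ?e))" using L.far_along_walk[OF fr] by blast
    moreover have "?e \<in> L.arcs (Suc n)" using Bj b by simp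
    then have "L.head (Suc n) (L.flip (Suc n) ?e) = eval (replicate j b)" using L.tgt_rv[of ?e "Suc n"] by (metis fst_conv)
    ultimately have "L.far (Suc n) D (eval (replicate j b))" by metis
    then have "D \<le> length (replicate j b)" using Bj unfolding L.far_def by blast
    then show False using D by simp
  qed
  ultimately have "L.flip (Suc n) ?e \<notin> set (L.walk (Suc n) \<one>\<^bsub>\<Gamma>\<^esub> z)"
    unfolding wz set_append by blast
  moreover have "?e \<in> set (L.walk (Suc n) \<one>\<^bsub>\<Gamma>\<^esub> z)" using in1 wz by simp
  ultimately have "fl (Suc n) z ?e \<noteq> 0"
    unfolding L.flow_def by (metis count_list_0_iff diff_zero of_nat_0 of_nat_eq_0_iff)
  moreover have "L.flow (Suc n) (L.walk (Suc n) (eval w) z) (eval (w @ replicate j b), b) = fl (Suc n) z ?e"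
  proof -
    have "L.flow (Suc n) (L.walk (Suc n) (eval w \<otimes>\<^bsub>\<Gamma>\<^esub> \<one>\<^bsub>\<Gamma>\<^esub>) z) (eval w \<otimes>\<^bsub>\<Gamma>\<^esub> eval (replicate j b), b) = fl (Suc n) z ?e"
      using wW Bj zW b by (intro L.flow_walk_translate) auto
    then show ?thesis using wW Bj by (simp add: L.ev_append)
  qed
  ultimately have nz: "L.flow (Suc n) (L.walk (Suc n) (eval w) z) (eval (w @ replicate j b), b) \<noteq> 0" by simp
  have "(eval (w @ replicate j b), b) \<in> outer (Suc n) k"
  proof -
    have "eval (w @ replicate j b) \<otimes>\<^bsub>\<Gamma>\<^esub> L.lv (Suc n) b = eval (w @ replicate (Suc j) b)"
      using wW b L.ev_append[of "w @ replicate j b" "[b]" "Suc n"] by (simp add: replicate_append_same)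
    then show ?thesis using fb[of j] fb[of "Suc j"] wW b by (simp add: outer_def)
  qed
  then show ?thesis using cl nz unfolding O.cyclic_edges_def by blast
qed

text \<open>Each w on the sphere is joined to w b^D along a ray. For fixed v the points v b^D of all
  letters b are joined by detours, and v l^D l = v l l^D leads from v to v l by a single arc. Hence
  everything is joined to one point c0^D.\<close>

lemma sphere_connected:
  assumes "w \<in> sphere_words" "w' \<in> sphere_words"
  shows "(eval w, eval w') \<in> conn"
proof -
  obtain lp where lp: "\<And>b. b \<in> L.letters \<Longrightarrow>
    \<exists>z \<in> W. length z \<le> lp \<and> eval z = \<one>\<^bsub>\<Gamma>\<^esub> \<and> fl (Suc n) z (\<one>\<^bsub>\<Gamma>\<^esub>, b) \<noteq> 0"
    using short_loops by blast
  have far_edge: "(x, b) \<in> O.cyclic_edges (Suc n) k"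
    if x: "x \<in> carrier \<Gamma>" "L.far (Suc n) (k + lp) x" and b: "b \<in> L.letters" for x b
  proof -
    obtain z where z: "z \<in> W" "length z \<le> lp" "eval z = \<one>\<^bsub>\<Gamma>\<^esub>" "fl (Suc n) z (\<one>\<^bsub>\<Gamma>\<^esub>, b) \<noteq> 0"
      using lp[OF b] by blast
    have "L.far_along (Suc n) k x z"
      using z x L.far_mono[OF x(2), of "k + length z"] by (intro L.far_along_near) auto
    then have O: "set (L.walk (Suc n) x z) \<subseteq> outer (Suc n) k" using far_along_outer x z by blast
    have cl: "O.path (Suc n) k x (L.walk (Suc n) x z) x"
      using L.path_walk[of x "Suc n" z] O x z by (simp add: outer_path_iff)
    have nz: "L.flow (Suc n) (L.walk (Suc n) x z) (x, b) \<noteq> 0"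
      using L.flow_walk_from[of x "Suc n" x z b] x z b by simp
    then have "(x, b) \<in> outer (Suc n) k \<or> L.flip (Suc n) (x, b) \<in> outer (Suc n) k"
      using O L.flow_nonzeroD by blast
    moreover have "L.flip (Suc n) (L.flip (Suc n) (x, b)) = (x, b)" using x b by (intro L.rv_rv) simp
    ultimately have "(x, b) \<in> outer (Suc n) k" using O.rv_in by metis
    then show ?thesis using cl nz unfolding O.cyclic_edges_def by blast
  qed
  have far_walk: "(g, g \<otimes>\<^bsub>\<Gamma>\<^esub> eval v) \<in> conn"
    if "g \<in> carrier \<Gamma>" "v \<in> W" "L.far_along (Suc n) (k + lp) g v" for g v
  proof (rule walk_cyc_conn[OF that(1,2)], rule subsetI)
    fix e assume e: "e \<in> set (L.walk (Suc n) g v)"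
    then have "e \<in> L.arcs (Suc n)" "L.far (Suc n) (k + lp) (fst e)"
      using L.walk_arcs[OF that(1,2)] L.far_along_walk[OF that(3) e] by auto
    then show "e \<in> O.cyclic_edges (Suc n) k" using far_edge[of "fst e" "snd e"] by (auto simp: L.arcs_def)
  qed
  \<comment> \<open>After translation by a word of length at most k there remains distance k + lp +
    1. Its last unit pays for the single arc from v to v l; 2k is the radius required for
    rays.\<close>
  define D where "D = 2 * k + lp + 1"
  have mono: "L.far_along (Suc n) D' g v \<Longrightarrow> D'' \<le> D' \<Longrightarrow> L.far_along (Suc n) D'' g v" for D' D'' g v
    by (induction v arbitrary: g) (auto intro: L.far_mono)
  have hub: "(eval (v @ replicate D b), eval (v @ replicate D c)) \<in> conn"
    if v: "v \<in> W" "length v \<le> k" and bc: "b \<in> L.letters" "c \<in> L.letters" for v b c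
  proof (cases "b = c")
    case True
    then show ?thesis by (simp add: O.cyc_conn_def)
  next
    case False
    then obtain r where r: "detour (Suc n) D b c r" using detour_exists m bc by blast
    have DW: "replicate D b \<in> W" "replicate D c \<in> W" "r \<in> W" using bc r by (auto simp: detour_def)
    have "L.far_along (Suc n) (D - length v) (eval v \<otimes>\<^bsub>\<Gamma>\<^esub> eval (replicate D b)) r"
      using r DW v by (intro L.far_along_translate) (auto simp: detour_def)
    then have "L.far_along (Suc n) (k + lp) (eval (v @ replicate D b)) r"
      using v DW mono by (simp add: L.ev_append D_def)
    then have "(eval (v @ replicate D b), eval (v @ replicate D b) \<otimes>\<^bsub>\<Gamma>\<^esub> eval r) \<in> conn"
      using far_walk DW v by simp
    moreover have "eval (v @ replicate D b) \<otimes>\<^bsub>\<Gamma>\<^esub> eval r = eval (v @ replicate D c)"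
    proof -
      have "eval (v @ replicate D b) \<otimes>\<^bsub>\<Gamma>\<^esub> eval r = eval v \<otimes>\<^bsub>\<Gamma>\<^esub> eval (replicate D b @ r)"
        using DW v by (simp add: L.ev_append L.m_assoc)
      then show ?thesis using r DW v by (simp add: detour_def L.ev_append)
    qed
    ultimately show ?thesis by simp
  qed
  define c0 where "c0 = (0 :: nat, True)"
  have c0: "c0 \<in> L.letters" using m by (simp add: c0_def L.letters_def)
  have to_hub: "(eval (replicate D c0), eval (v @ replicate D c)) \<in> conn"
    if "v \<in> W" "length v \<le> k" "c \<in> L.letters" for v c
    using that
  proof (induction v arbitrary: c rule: rev_induct)
    case Nil
    then show ?case using hub[of "[]" c0 c] c0 by simp
  next
    case (snoc l v)
    then have v: "v \<in> W" "length v \<le> k" "l \<in> L.letters" by auto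
    have DW: "replicate D l \<in> W" using v by simp
    have "L.far (Suc n) (D - length v) (eval v \<otimes>\<^bsub>\<Gamma>\<^esub> eval (replicate D l))"
      using far_expsum[OF DW, of "fst l" D n] v by (intro L.far_translate) (auto simp: L.letters_def)
    then have "L.far (Suc n) (k + lp + length [l]) (eval (v @ replicate D l))"
      using v DW L.far_mono[of "Suc n" "D - length v" _ "Suc (k + lp)"] by (simp add: L.ev_append D_def)
    then have "L.far_along (Suc n) (k + lp) (eval (v @ replicate D l)) [l]"
      using v DW by (intro L.far_along_near) auto
    then have "(eval (v @ replicate D l), eval (v @ replicate D l) \<otimes>\<^bsub>\<Gamma>\<^esub> eval [l]) \<in> conn"
      using far_walk[of "eval (v @ replicate D l)" "[l]"] v DW by simp
    moreover have "eval (v @ replicate D l) \<otimes>\<^bsub>\<Gamma>\<^esub> eval [l] = eval ((v @ [l]) @ replicate D l)"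
      using v DW L.ev_append[of "v @ replicate D l" "[l]" "Suc n"]
      by (simp add: replicate_append_same)
    moreover have "(eval (replicate D c0), eval (v @ replicate D l)) \<in> conn" using snoc.IH v by blast
    moreover have "(eval ((v @ [l]) @ replicate D l), eval ((v @ [l]) @ replicate D c)) \<in> conn"
      using snoc.prems v by (intro hub) auto
    ultimately show ?case by (metis conn_trans)
  qed
  have from_hub: "(eval (replicate D c0), eval w) \<in> conn" if w: "w \<in> sphere_words" for w
  proof -
    have wW: "w \<in> W" "length w = k" using w by (auto simp: sphere_words_def)
    obtain a where a: "a < m" "a \<noteq> fst (last w)" using m by (metis One_nat_def less_trans zero_less_one zero_neq_one)
    define b where "b = (a, True)"
    have b: "b \<in> L.letters" "fst b \<noteq> fst (last w)" using a by (auto simp: b_def L.letters_def)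
    have BW: "replicate D b \<in> W" using b by simp
    have "(eval w, eval w \<otimes>\<^bsub>\<Gamma>\<^esub> eval (replicate D b)) \<in> conn"
    proof (rule walk_cyc_conn)
      have "set (L.walk (Suc n) (eval (w @ replicate i b)) (replicate j b)) \<subseteq> O.cyclic_edges (Suc n) k"
        if "i + j \<le> D" for i j
        using that
      proof (induction j arbitrary: i)
        case (Suc j)
        have "eval (w @ replicate i b) \<otimes>\<^bsub>\<Gamma>\<^esub> L.lv (Suc n) b = eval (w @ replicate (Suc i) b)"
          using wW b L.ev_append[of "w @ replicate i b" "[b]" "Suc n"] by (simp add: replicate_append_same)
        then show ?case using Suc.IH[of "Suc i"] Suc.prems ray_edges_cyclic[OF w b, of D i]
          by (simp add: D_def)
      qed simp
      from this[of 0 D] show "set (L.walk (Suc n) (eval w) (replicate D b)) \<subseteq> O.cyclic_edges (Suc n) k" by simp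
    qed (use wW BW in auto)
    then have "(eval (w @ replicate D b), eval w) \<in> conn"
      using conn_sym wW BW by (simp add: L.ev_append)
    moreover have "(eval (replicate D c0), eval (w @ replicate D b)) \<in> conn"
      using to_hub wW b by simp
    ultimately show ?thesis by (metis conn_trans)
  qed
  show ?thesis using from_hub assms conn_trans conn_sym by blast
qed

end

section \<open>The dead end\<close>

context sphere
begin

lemma finite_sphere_words: "finite sphere_words"
proof -
  have "sphere_words \<subseteq> {w. set w \<subseteq> L.letters \<and> length w = k}"
    by (auto simp: sphere_words_def L.words_def)
  then show ?thesis using finite_lists_length_eq[OF finite_letters] finite_subset by blast
qed

lemma constant_sphere_word: "l \<in> L.letters \<Longrightarrow> replicate k l \<in> sphere_words"
proof -
  assume l: "l \<in> L.letters"
  have "freely_reduced (replicate j l)" for j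
    by (induction j) (auto simp: freely_reduced_def successively_Cons)
  then show ?thesis using l by (simp add: sphere_words_def)
qed

text \<open>\<open>no_turn_closed_path_visiting\<close> is applied in the outer subgraph to the
  finite set of values of the sphere words, and the path found there is read as a word.\<close>

lemma outer_circuit:
  obtains w0 t where "w0 \<in> sphere_words" "t \<in> W" "t \<noteq> []" "eval t = \<one>\<^bsub>\<Gamma>\<^esub>"
    "set (L.walk (Suc n) (eval w0) t) \<subseteq> outer (Suc n) k"
    "L.no_turn (Suc n) (L.walk (Suc n) (eval w0) t)"
    "\<And>w. w \<in> sphere_words \<Longrightarrow> \<exists>t1 t2. t = t1 @ t2 \<and> eval (w0 @ t1) = eval w"
proof -
  define l where "l = (0 :: nat, True)"
  have l: "l \<in> L.letters" "inv_letter l \<in> L.letters" using m by (simp_all add: l_def L.letters_def)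
  define w0 w1 where "w0 = replicate k l" and "w1 = replicate k (inv_letter l)"
  have w01: "w0 \<in> sphere_words" "w1 \<in> sphere_words"
    using constant_sphere_word l by (simp_all add: w0_def w1_def)
  have W01: "w0 \<in> W" "w1 \<in> W" using w01 by (simp_all add: sphere_words_def)
  \<comment> \<open>Two different vertices to be visited force t to be nonempty.\<close>
  have ne: "eval w0 \<noteq> eval w1"
  proof
    assume "eval w0 = eval w1"
    then have "expsum 0 w0 = expsum 0 w1" using expsum_eq[OF W01] m by simp
    then show False using k(1) by (simp add: w0_def w1_def l_def inv_letter_def)
  qed
  obtain P where P: "O.path (Suc n) k (eval w0) P (eval w0)" "O.no_turn (Suc n) P"
    "eval ` sphere_words \<subseteq> O.visits (Suc n) (eval w0) P"
    using O.no_turn_closed_path_visiting[of "eval ` sphere_words" "eval w0" "Suc n" k]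
      finite_sphere_words sphere_connected[OF w01(1)] by auto
  have LP: "L.path (Suc n) (eval w0) P (eval w0)" "set P \<subseteq> outer (Suc n) k"
    using P(1) by (simp_all add: outer_path_iff)
  define t where "t = map snd P"
  have wc: "eval w0 \<in> carrier \<Gamma>" using W01 by simp
  have t: "P = L.walk (Suc n) (eval w0) t" "t \<in> W" "eval w0 = eval w0 \<otimes>\<^bsub>\<Gamma>\<^esub> eval t"
    using L.path_is_walk[OF LP(1) wc] by (auto simp: t_def)
  have t1: "eval t = \<one>\<^bsub>\<Gamma>\<^esub>" using t W01 L.mult_ev_eq_self[of "eval w0" "Suc n" t] by simp
  have "t \<noteq> []"
  proof
    assume "t = []"
    then have "P = []" by (simp add: t_def)
    then have "eval w1 = eval w0" using P(3) w01 by (auto simp: O.visits_def)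
    then show False using ne by simp
  qed
  moreover have "\<exists>t1 t2. t = t1 @ t2 \<and> eval (w0 @ t1) = eval w" if "w \<in> sphere_words" for w
  proof -
    have "eval w \<in> L.visits (Suc n) (eval w0) P" using P(3) that by (auto simp: O.visits_def L.visits_def)
    then obtain P1 P2 where "P = P1 @ P2" "L.path (Suc n) (eval w0) P1 (eval w)"
      using L.path_split_visit[OF LP(1)] by blast
    moreover from this have "map snd P1 \<in> W" "eval w = eval w0 \<otimes>\<^bsub>\<Gamma>\<^esub> eval (map snd P1)"
      using L.path_is_walk[OF _ wc] by blast+
    ultimately show ?thesis using W01
      by (intro exI[of _ "map snd P1"] exI[of _ "map snd P2"]) (simp add: t_def L.ev_append)
  qed
  moreover have "L.no_turn (Suc n) (L.walk (Suc n) (eval w0) t)"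
    using P(2) t(1) by (simp add: O.no_turn_def L.no_turn_def)
  ultimately show thesis using that[of w0 t] w01 t t1 LP(2) by simp
qed

lemma carrier_ev: "carrier \<Gamma> = eval ` W" by (rule carrier_Sol)

lemma outer_iff_norm:
  "e \<in> L.arcs (Suc n) \<Longrightarrow> e \<in> outer (Suc n) k \<longleftrightarrow>
    k \<le> L.norm (Suc n) (fst e) \<and> k \<le> L.norm (Suc n) (L.head (Suc n) e)"
proof -
  assume e: "e \<in> L.arcs (Suc n)"
  then have "fst e \<in> carrier \<Gamma>" "L.head (Suc n) e \<in> carrier \<Gamma>" by (auto simp: L.arcs_def)
  then show ?thesis using e L.far_iff_norm carrier_ev unfolding outer_def by simp
qed

text \<open>The truncated norm \<open>min k |g|\<close> is constant along outer arcs and 1-Lipschitz along the others.\<close>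

lemma inner_arcs_ge:
  assumes "L.path (Suc n) g P h"
  defines "inner \<equiv> length (filter (\<lambda>e. e \<notin> outer (Suc n) k) P)"
  shows "min k (L.norm (Suc n) h) \<le> min k (L.norm (Suc n) g) + inner"
    and "min k (L.norm (Suc n) g) \<le> min k (L.norm (Suc n) h) + inner"
proof -
  have "min k (L.norm (Suc n) h) \<le> min k (L.norm (Suc n) g) + length (filter (\<lambda>e. e \<notin> outer (Suc n) k) P) \<and>
      min k (L.norm (Suc n) g) \<le> min k (L.norm (Suc n) h) + length (filter (\<lambda>e. e \<notin> outer (Suc n) k) P)"
    using assms(1)
  proof (induction P arbitrary: g)
    case (Cons e P)
    then have e: "e \<in> L.arcs (Suc n)" "fst e = g" "L.path (Suc n) (L.head (Suc n) e) P h" by auto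
    then obtain l where l: "e = (g, l)" "l \<in> L.letters" "g \<in> carrier \<Gamma>" by (cases e) auto
    have n: "L.norm (Suc n) (L.head (Suc n) e) \<le> Suc (L.norm (Suc n) g)"
      "L.norm (Suc n) g \<le> Suc (L.norm (Suc n) (L.head (Suc n) e))"
      using L.norm_step[of g "Suc n" l] l carrier_ev by simp_all
    show ?case using Cons.IH[OF e(3)] n outer_iff_norm[OF e(1)] e(2) by (auto split: if_splits)
  qed simp
  then show "min k (L.norm (Suc n) h) \<le> min k (L.norm (Suc n) g) + inner"
    and "min k (L.norm (Suc n) g) \<le> min k (L.norm (Suc n) h) + inner"
    by (simp_all add: inner_def)
qed

section \<open>The length of g p from below and from above\<close>

lemma dead_end_lower_bound:
  assumes w0: "w0 \<in> W" and t: "t \<in> W" "t \<noteq> []" "eval t = \<one>\<^bsub>\<Gamma>\<^esub>"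
    and out: "set (L.walk (Suc n) (eval w0) t) \<subseteq> outer (Suc n) k"
    and nt: "L.no_turn (Suc n) (L.walk (Suc n) (eval w0) t)"
    and p: "p \<in> W" "length p \<le> k"
  shows "L.far (Suc (Suc n)) (length t + 2 * k - length p)
    (L.ev (Suc (Suc n)) ((w0 @ t @ word_inv w0) @ p))"
  unfolding L.far_def
proof (intro ballI impI)
  fix v assume v: "v \<in> W" "L.ev (Suc (Suc n)) v = L.ev (Suc (Suc n)) ((w0 @ t @ word_inv w0) @ p)"
  define T where "T = L.walk (Suc n) (eval w0) t"
  define Q where "Q = L.walk (Suc n) \<one>\<^bsub>\<Gamma>\<^esub> v"
  have g: "w0 @ t @ word_inv w0 \<in> W" "eval (w0 @ t @ word_inv w0) = \<one>\<^bsub>\<Gamma>\<^esub>"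
    using w0 t by (simp_all add: L.ev_append L.ev_word_inv)
  have gp: "(w0 @ t @ word_inv w0) @ p \<in> W" using g p by simp
  have ev: "eval v = eval p" using ev_Suc_eq(1)[OF v(1) gp v(2)] g p
      L.ev_append[of "w0 @ t @ word_inv w0" p "Suc n"] by simp
  \<comment> \<open>The arcs of p start at values of proper prefixes, which are at distance less
    than k, so p contributes no outer flow.\<close>
  have pin: "e \<notin> outer (Suc n) k" if e: "e \<in> set (L.walk (Suc n) \<one>\<^bsub>\<Gamma>\<^esub> p)" for e
  proof -
    have path: "L.path (Suc n) \<one>\<^bsub>\<Gamma>\<^esub> (L.walk (Suc n) \<one>\<^bsub>\<Gamma>\<^esub> p) (eval p)"
      using L.path_walk[of "\<one>\<^bsub>\<Gamma>\<^esub>" "Suc n" p] p by simp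
    obtain P1 P2 where P: "L.walk (Suc n) \<one>\<^bsub>\<Gamma>\<^esub> p = P1 @ P2" "L.path (Suc n) \<one>\<^bsub>\<Gamma>\<^esub> P1 (fst e)" "P2 \<noteq> []"
      using L.path_split_src[OF path e] by metis
    have "map snd P1 \<in> W" "fst e = eval (map snd P1)"
      using L.path_is_walk[OF P(2)] L.ev_closed by auto
    moreover have "length P1 < length p" using arg_cong[OF P(1), of length] P(3) by (cases P2) auto
    ultimately have "\<not> L.far (Suc n) k (fst e)" using p(2) unfolding L.far_def
      by (metis length_map not_less order_less_le_trans)
    then show ?thesis by (simp add: outer_def)
  qed
  have Tarcs: "set T \<subseteq> L.arcs (Suc n)" using L.walk_arcs w0 t by (simp add: T_def)
  \<comment> \<open>Since T has no turns, its number of crossings of e is its flow there; this is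
    also the flow of Q, which is at most the number of crossings by Q.\<close>
  have cnt: "count_list T e \<le> count_list Q e" if e: "e \<in> set T" for e
  proof -
    have ea: "e \<in> L.arcs (Suc n)" using e Tarcs by auto
    have eo: "e \<in> outer (Suc n) k" using e out by (auto simp: T_def)
    then have "L.flip (Suc n) e \<in> outer (Suc n) k" by (rule O.rv_in)
    then have "fl (Suc n) p e = 0" using pin eo unfolding L.flow_def
      by (metis count_list_0_iff diff_self)
    moreover have "fl (Suc n) (w0 @ t @ word_inv w0) e = L.flow (Suc n) T e"
    proof -
      have "fl (Suc n) (w0 @ t @ word_inv w0) e = fl (Suc n) w0 e + L.flow (Suc n) T e
          + L.flow (Suc n) (L.walk (Suc n) (eval w0) (word_inv w0)) e"
        using w0 t by (simp add: L.walk_append T_def)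
      moreover have "L.flow (Suc n) (L.walk (Suc n) (eval w0) (word_inv w0)) e = - fl (Suc n) w0 e"
        using L.flow_word_inv[of "\<one>\<^bsub>\<Gamma>\<^esub>" "Suc n" w0 e] w0 ea by simp
      ultimately show ?thesis by simp
    qed
    ultimately have "L.flow (Suc n) Q e = L.flow (Suc n) T e"
      using ev_Suc_eq(2)[OF v(1) gp v(2) ea] fl_append_closed[OF g(1) p(1) g(2)] by (simp add: Q_def)
    moreover have "count_list T (L.flip (Suc n) e) = 0"
      using nt e by (auto simp: T_def L.no_turn_def)
    ultimately show ?thesis by (simp add: L.flow_def)
  qed
  have "mset T \<subseteq># mset (filter (\<lambda>e. e \<in> outer (Suc n) k) Q)"
  proof (rule mset_subset_eqI)
    fix e
    show "count (mset T) e \<le> count (mset (filter (\<lambda>e. e \<in> outer (Suc n) k) Q)) e"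
    proof (cases "e \<in> set T")
      case True
      then have "e \<in> outer (Suc n) k" using out by (auto simp: T_def)
      then show ?thesis using cnt[OF True] by (simp add: count_mset)
    next
      case False
      then show ?thesis by (simp add: count_mset count_list_0_iff)
    qed
  qed
  from size_mset_mono[OF this] have "length T \<le> length (filter (\<lambda>e. e \<in> outer (Suc n) k) Q)"
    unfolding size_mset .
  then have outer_ge: "length t \<le> length (filter (\<lambda>e. e \<in> outer (Suc n) k) Q)"
    by (simp add: T_def)
  \<comment> \<open>One common arc of T and Q shows that Q reaches distance k; Q1 climbs there from
    0, and Q2 descends to at most |p|.\<close>
  obtain e where e: "e \<in> set T" using t(2) by (cases T) (auto simp: T_def)
  then have "e \<in> set Q" using cnt[OF e] by (metis count_list_0_iff le_zero_eq)
  moreover have Qp: "L.path (Suc n) \<one>\<^bsub>\<Gamma>\<^esub> Q (eval p)"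
    using L.path_walk[of "\<one>\<^bsub>\<Gamma>\<^esub>" "Suc n" v] v ev p by (simp add: Q_def)
  ultimately obtain Q1 Q2 where Q: "Q = Q1 @ Q2" "L.path (Suc n) \<one>\<^bsub>\<Gamma>\<^esub> Q1 (fst e)" "L.path (Suc n) (fst e) Q2 (eval p)"
    using L.path_split_src by metis
  have "k \<le> L.norm (Suc n) (fst e)"
    using e out outer_iff_norm[of e] Tarcs by (auto simp: T_def)
  moreover have "L.norm (Suc n) \<one>\<^bsub>\<Gamma>\<^esub> = 0" using L.norm_le[of "[]" "Suc n"] by simp
  moreover have "L.norm (Suc n) (eval p) \<le> length p" using L.norm_le p by simp
  ultimately have "2 * k - length p \<le> length (filter (\<lambda>e. e \<notin> outer (Suc n) k) Q)"
    using inner_arcs_ge(1)[OF Q(2)] inner_arcs_ge(2)[OF Q(3)] p(2) by (simp add: Q(1))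
  then have "length t + (2 * k - length p) \<le> length Q"
    using outer_ge sum_length_filter_compl[of "\<lambda>e. e \<in> outer (Suc n) k" Q] by linarith
  then show "length t + 2 * k - length p \<le> length v" using p(2) by (simp add: Q_def)
qed

text \<open>The loop c = w0 t1 w^-1 is closed in \<Gamma> and so commutes with g one level up. As g
  c = c (w t2 t1 w^-1) by cancellation, g is also the loop t entered at the end of w, and w^-1 p
  shortens to q^-1.\<close>

lemma dead_end_word:
  assumes w0: "w0 \<in> W" and w: "w \<in> W" and t: "t1 \<in> W" "t2 \<in> W" "eval (t1 @ t2) = \<one>\<^bsub>\<Gamma>\<^esub>"
    and e: "eval (w0 @ t1) = eval w" and w12: "w = p @ q"
  defines "E \<equiv> L.ev (Suc (Suc n))"
  shows "E ((w0 @ (t1 @ t2) @ word_inv w0) @ p) = E (w @ t2 @ t1 @ word_inv q)"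
proof -
  let ?G = "Sol (Suc (Suc n))"
  define g c where "g = w0 @ (t1 @ t2) @ word_inv w0" and "c = w0 @ t1 @ word_inv w"
  have W: "g \<in> W" "c \<in> W" "p \<in> W" "q \<in> W" using assms by (auto simp: g_def c_def)
  have E1: "eval g = \<one>\<^bsub>\<Gamma>\<^esub>" using w0 t L.ev_append[of "t1 @ t2" "word_inv w0" "Suc n"]
    by (simp add: g_def L.ev_append L.ev_word_inv)
  have E2: "eval c = \<one>\<^bsub>\<Gamma>\<^esub>"
    using w0 w t e L.ev_append[of "w0 @ t1" "word_inv w" "Suc n"] by (simp add: c_def L.ev_word_inv)
  have com: "E g \<otimes>\<^bsub>?G\<^esub> E c = E c \<otimes>\<^bsub>?G\<^esub> E g"
    using ev_Suc_commute[OF W(1,2) E1 E2] by (simp add: E_def)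
  have c1: "E w0 \<in> carrier ?G" "E t1 \<in> carrier ?G" "E t2 \<in> carrier ?G" "E w \<in> carrier ?G" "E p \<in> carrier ?G" "E q \<in> carrier ?G"
    using w0 w t W by (simp_all add: E_def)
  have Eg: "E g = E w0 \<otimes>\<^bsub>?G\<^esub> (E t1 \<otimes>\<^bsub>?G\<^esub> (E t2 \<otimes>\<^bsub>?G\<^esub> inv\<^bsub>?G\<^esub> (E w0)))"
    using w0 t c1 by (simp add: E_def g_def L.ev_append L.ev_word_inv L.m_assoc)
  have Ec: "E c = E w0 \<otimes>\<^bsub>?G\<^esub> (E t1 \<otimes>\<^bsub>?G\<^esub> inv\<^bsub>?G\<^esub> (E w))"
    using w0 w t by (simp add: E_def c_def L.ev_append L.ev_word_inv)
  have Ew: "E w = E p \<otimes>\<^bsub>?G\<^esub> E q" using w12 W by (simp add: E_def L.ev_append)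
  have cancel: "x \<otimes>\<^bsub>?G\<^esub> (inv\<^bsub>?G\<^esub> x \<otimes>\<^bsub>?G\<^esub> y) = y" "inv\<^bsub>?G\<^esub> x \<otimes>\<^bsub>?G\<^esub> (x \<otimes>\<^bsub>?G\<^esub> y) = y"
    if "x \<in> carrier ?G" "y \<in> carrier ?G" for x y
    using that by (simp_all add: L.m_assoc[symmetric])
  have "E c \<otimes>\<^bsub>?G\<^esub> (E w \<otimes>\<^bsub>?G\<^esub> (E t2 \<otimes>\<^bsub>?G\<^esub> (E t1 \<otimes>\<^bsub>?G\<^esub> inv\<^bsub>?G\<^esub> (E w)))) = E g \<otimes>\<^bsub>?G\<^esub> E c"
    unfolding Eg Ec using c1 by (simp add: L.m_assoc cancel)
  also have "\<dots> = E c \<otimes>\<^bsub>?G\<^esub> E g" by (rule com)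
  finally have "E w \<otimes>\<^bsub>?G\<^esub> (E t2 \<otimes>\<^bsub>?G\<^esub> (E t1 \<otimes>\<^bsub>?G\<^esub> inv\<^bsub>?G\<^esub> (E w))) = E g"
    using c1 W by (simp add: E_def)
  then have "E g \<otimes>\<^bsub>?G\<^esub> E p = E w \<otimes>\<^bsub>?G\<^esub> (E t2 \<otimes>\<^bsub>?G\<^esub> (E t1 \<otimes>\<^bsub>?G\<^esub> (inv\<^bsub>?G\<^esub> (E w) \<otimes>\<^bsub>?G\<^esub> E p)))"
    using c1 by (simp add: L.m_assoc[symmetric])
  also have "inv\<^bsub>?G\<^esub> (E w) \<otimes>\<^bsub>?G\<^esub> E p = inv\<^bsub>?G\<^esub> (E q)"
    unfolding Ew using c1 by (simp add: L.inv_mult_group L.m_assoc)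
  finally have main: "E g \<otimes>\<^bsub>?G\<^esub> E p = E w \<otimes>\<^bsub>?G\<^esub> (E t2 \<otimes>\<^bsub>?G\<^esub> (E t1 \<otimes>\<^bsub>?G\<^esub> inv\<^bsub>?G\<^esub> (E q)))" .
  have "E ((w0 @ (t1 @ t2) @ word_inv w0) @ p) = E g \<otimes>\<^bsub>?G\<^esub> E p"
    unfolding g_def[symmetric] E_def using W by (intro L.ev_append)
  moreover have "E (w @ t2 @ t1 @ word_inv q) = E w \<otimes>\<^bsub>?G\<^esub> (E t2 \<otimes>\<^bsub>?G\<^esub> (E t1 \<otimes>\<^bsub>?G\<^esub> inv\<^bsub>?G\<^esub> (E q)))"
    using w t W by (simp add: E_def L.ev_append L.ev_word_inv)
  ultimately show ?thesis using main by simp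
qed

lemma strict_dead_end_exists:
  "\<exists>g \<in> carrier (Sol (Suc (Suc n))). strict_dead_end (Sol (Suc (Suc n))) (free_soluble_gens m (Suc (Suc n))) k g"
proof -
  let ?d = "Suc (Suc n)"
  obtain w0 t where w0: "w0 \<in> sphere_words" and t: "t \<in> W" "t \<noteq> []" "eval t = \<one>\<^bsub>\<Gamma>\<^esub>"
    and out: "set (L.walk (Suc n) (eval w0) t) \<subseteq> outer (Suc n) k"
    and nt: "L.no_turn (Suc n) (L.walk (Suc n) (eval w0) t)"
    and visit: "\<And>w. w \<in> sphere_words \<Longrightarrow> \<exists>t1 t2. t = t1 @ t2 \<and> eval (w0 @ t1) = eval w"
    using outer_circuit by blast
  have w0W: "w0 \<in> W" using w0 by (simp add: sphere_words_def)
  define g where "g = w0 @ t @ word_inv w0"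
  have gW: "g \<in> W" using w0W t by (simp add: g_def)
  have len: "word_length (Sol ?d) (sgen ?d ` {..<m}) (L.ev ?d g \<otimes>\<^bsub>Sol ?d\<^esub> L.ev ?d (take i w)) = length t + 2 * k - i"
    if w: "w \<in> W" "freely_reduced w" "length w = k" and i: "i \<le> k" for w i
  proof -
    have ws: "w \<in> sphere_words" using w by (simp add: sphere_words_def)
    obtain t1 t2 where t12: "t = t1 @ t2" "eval (w0 @ t1) = eval w" using visit[OF ws] by blast
    \<comment> \<open>The loop is entered at the end of all of w, not of its prefix of length i. The
      way out is w, and only the last k - i letters of w are retraced.\<close>
    have tw: "take i w \<in> W" "drop i w \<in> W" using w(1) append_take_drop_id[of i w] L.words_simps(3) by metis+
    define u where "u = w @ t2 @ t1 @ word_inv (drop i w)"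
    have uW: "u \<in> W" using w tw t t12 by (simp add: u_def)
    have ev: "L.ev ?d ((w0 @ t @ word_inv w0) @ take i w) = L.ev ?d u"
      unfolding u_def t12(1)
      by (rule dead_end_word) (use w0W w(1) t t12 in auto)
    have lp: "length (take i w) = i" using w i by simp
    have "L.far ?d (length t + 2 * k - i) (L.ev ?d u)"
      using dead_end_lower_bound[OF w0W t out nt tw(1)] lp i unfolding ev by simp
    moreover have "length u = length t + 2 * k - i" using w i by (simp add: u_def t12)
    ultimately have "word_length (Sol ?d) (sgen ?d ` {..<m}) (L.ev ?d u) = length t + 2 * k - i"
      using L.word_length_eqI[OF uW] by blast
    then show ?thesis using ev gW tw by (simp add: g_def[symmetric] L.ev_append[OF gW])
  qed
  have "strict_dead_end (Sol ?d) (sgen ?d ` {..<m}) k (L.ev ?d g)"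
    by (rule L.strict_dead_endI) (use gW len in auto)
  then show ?thesis using gW unfolding gens_eq by (intro bexI[of _ "L.ev ?d g"]) auto
qed

end

theorem theorem2:
  fixes m d :: nat
  assumes "m > 1" and "d \<ge> 2"
  shows "\<exists>k \<ge> 2 * 3 ^ (d - 2) - 1. \<exists>g \<in> carrier (free_soluble_group m d).
           strict_dead_end (free_soluble_group m d) (free_soluble_gens m d) k g"
proof -
  define n k where "n = d - 2" and "k = 2 * 3 ^ n - (1 :: nat)"
  have d: "d = Suc (Suc n)" using assms(2) by (simp add: n_def)
  have "(1 :: nat) \<le> 3 ^ n" by simp
  then have k: "k > 0" "2 * k + 2 = 4 * 3 ^ n" unfolding k_def by linarith+
  interpret sphere m n k by unfold_locales (use assms(1) k in auto)
  show ?thesis using strict_dead_end_exists unfolding d by (intro exI[of _ k]) (simp add: k_def)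
qed

end
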